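(* Let $d\ge1$, $r,s\ge0$ and $1\le p\le\infty$. Let $g\in M^1_{r,s}$ be admissible, i.e. $\|g\|_{L^2(\mathbb{R}^d)}=1$. Then there is a compact neighbourhood $U\subset\mathbb{R}^d\times\mathbb{R}^d$ of $(0,0)$ such that for all $U$-well-spread families $(x_j,\omega_j)_{j\in I}\subset\mathbb{R}^d\times\mathbb{R}^d$ the functions $$g_j(t)=M_{\omega_j}T_{x_j}g(t)=e^{2\pi i\omega_jt}g(t-x_j),\quad j\in I,$$ define a Banach frame $(g_j)_{j\in I}$ for $M^p_{r,s}$ with respect to the sequence space $\ell^p_{\widetilde v_{r,s}}(I)$, where $\widetilde v_{r,s}(j)=(1+|x_j|)^r(1+|\omega_j|)^s$.
   Context: $T_xf(t)=f(t-x)$, $M_\omega f(t)=e^{2\pi i\omega t}f(t)$ (dot product). $V_gf(x,\omega)=\langle f,M_\omega T_xg\rangle_{L^2(\mathbb{R}^d)}$ is the short-time Fourier transform. $v_{r,s}(x,\omega)=(1+|x|)^r(1+|\omega|)^s$; $L^p_{v_{r,s}}(\mathbb{R}^{2d})$ has norm $\|Fv_{r,s}\|_{L^p}$; $\ell^p_{\widetilde v}(I)$ has norm $\|(c_j\widetilde v(j))_j\|_{\ell^p}$. $\mathcal{A}_{v_{r,s}}=\{g\in L^2(\mathbb{R}^d):V_gg\in L^1_{v_{r,s}}(\mathbb{R}^{2d})\}$. Fix $g_0\in\mathcal{A}_{v_{r,s}}\setminus\{0\}$. $M^1_{r,s}=\{f\in L^2(\mathbb{R}^d):V_{g_0}f\in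 L^1_{v_{r,s}}(\mathbb{R}^{2d})\}$ with norm $\|V_{g_0}f\|_{L^1_{v_{r,s}}}$; it is a Banach space invariant under all $M_\omega T_x$, and as a set $M^1_{r,s}=\mathcal{A}_{v_{r,s}}$. Let $\mathcal{R}_{v_{r,s}}$ be its antidual (bounded antilinear functionals), pairing $\langle f,g\rangle=f(g)$, and for $f\in\mathcal{R}_{v_{r,s}}$, $g\in M^1_{r,s}$ set $V_gf(x,\omega)=\langle f,M_\omega T_xg\rangle$. The modulation space is $M^p_{r,s}=\{f\in\mathcal{R}_{v_{r,s}}:V_{g_0}f\in L^p_{v_{r,s}}(\mathbb{R}^{2d})\}$ with norm $\|V_{g_0}f\|_{L^p_{v_{r,s}}}$; up to equivalent norms it is independent of $g_0$. A countable family $(z_j)_{j\in I}\subset\mathbb{R}^{2d}$ is $U$-well-spread if $\bigcup_j(z_j+U)=\mathbb{R}^{2d}$ and for each compact $K$, $\sup_{i\in I}|\{j\in I:(z_i+K)\cap(z_j+K)\ne\emptyset\}|<\infty$. A family $(g_j)_{j\in I}\subset M^1_{r,s}$ is a Banach frame for $M^p_{r,s}$ with respect to a Banach space $B_d$ of sequences if $f\mapsto\|(\langle f,g_j\rangle)_j\|_{B_d}$ is a well-defined norm on $M^p_{r,s}$ equivalent to its given norm and there is a bounded linear $R:B_d\to M^p_{r,s}$ with $R((\langle f,g_j\rangle)_j)=f$ for all $f\in M^p_{r,s}$. *)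

theory Defs
  imports "HOL-Probability.Probability"
begin

section \<open>Lebesgue spaces\<close>

text \<open>
  Lebesgue spaces are rendered as sets of representatives: their elements are Borel measurable
  functions, and equality of elements is equality almost everywhere. Every Lebesgue measurable
  function agrees almost everywhere with a Borel measurable one, so over \<open>lborel\<close> these are the
  usual spaces.
\<close>

definition Lp_space :: "ennreal \<Rightarrow> 'a measure \<Rightarrow> ('a \<Rightarrow> complex) set" where
  "Lp_space p M = {F \<in> borel_measurable M.
     if p = \<infinity> then esssup M (\<lambda>x. ereal (norm (F x))) < \<infinity>
     else integrable M (\<lambda>x. norm (F x) powr enn2real p)}"

definition Lp_norm :: "ennreal \<Rightarrow> 'a measure \<Rightarrow> ('a \<Rightarrow> complex) \<Rightarrow> real" where
  "Lp_norm p M F =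
     (if p = \<infinity> then real_of_ereal (esssup M (\<lambda>x. ereal (norm (F x))))
      else (\<integral>x. norm (F x) powr enn2real p \<partial>M) powr (1 / enn2real p))"

definition weighted_Lp_space ::
    "ennreal \<Rightarrow> ('a \<Rightarrow> real) \<Rightarrow> 'a measure \<Rightarrow> ('a \<Rightarrow> complex) set" where
  "weighted_Lp_space p w M = {F. (\<lambda>x. F x * of_real (w x)) \<in> Lp_space p M}"

definition weighted_Lp_norm ::
    "ennreal \<Rightarrow> ('a \<Rightarrow> real) \<Rightarrow> 'a measure \<Rightarrow> ('a \<Rightarrow> complex) \<Rightarrow> real" where
  "weighted_Lp_norm p w M F = Lp_norm p M (\<lambda>x. F x * of_real (w x))"

text \<open>
  Families indexed by \<open>I\<close> are functions vanishing off \<open>I\<close>, so that distinct functions are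
  distinct families.
\<close>

definition weighted_seq_space ::
    "ennreal \<Rightarrow> ('i \<Rightarrow> real) \<Rightarrow> 'i set \<Rightarrow> ('i \<Rightarrow> complex) set" where
  "weighted_seq_space p w I =
     {c \<in> weighted_Lp_space p w (count_space I). \<forall>j. j \<notin> I \<longrightarrow> c j = 0}"

definition weighted_seq_norm ::
    "ennreal \<Rightarrow> ('i \<Rightarrow> real) \<Rightarrow> 'i set \<Rightarrow> ('i \<Rightarrow> complex) \<Rightarrow> real" where
  "weighted_seq_norm p w I = weighted_Lp_norm p w (count_space I)"


section \<open>Time-frequency analysis\<close>

definition transl :: "real^'d \<Rightarrow> (real^'d \<Rightarrow> complex) \<Rightarrow> real^'d \<Rightarrow> complex" where
  "transl x f = (\<lambda>t. f (t - x))"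

definition modul :: "real^'d \<Rightarrow> (real^'d \<Rightarrow> complex) \<Rightarrow> real^'d \<Rightarrow> complex" where
  "modul \<omega> f = (\<lambda>t. exp (2 * of_real pi * \<i> * of_real (\<omega> \<bullet> t)) * f t)"

definition L2_inner :: "(real^'d \<Rightarrow> complex) \<Rightarrow> (real^'d \<Rightarrow> complex) \<Rightarrow> complex" where
  "L2_inner f g = (\<integral>t. f t * cnj (g t) \<partial>lborel)"

definition STFT ::
    "(real^'d \<Rightarrow> complex) \<Rightarrow> (real^'d \<Rightarrow> complex) \<Rightarrow> (real^'d) \<times> (real^'d) \<Rightarrow> complex" where
  "STFT g f = (\<lambda>(x, \<omega>). L2_inner f (modul \<omega> (transl x g)))"

definition tf_weight :: "real \<Rightarrow> real \<Rightarrow> (real^'d) \<times> (real^'d) \<Rightarrow> real" where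
  "tf_weight r s = (\<lambda>(x, \<omega>). (1 + norm x) powr r * (1 + norm \<omega>) powr s)"

definition window_class :: "real \<Rightarrow> real \<Rightarrow> (real^'d \<Rightarrow> complex) set" where
  "window_class r s =
     {g \<in> Lp_space 2 lborel. STFT g g \<in> weighted_Lp_space 1 (tf_weight r s) lborel}"

definition M1_space :: "real \<Rightarrow> real \<Rightarrow> (real^'d \<Rightarrow> complex) \<Rightarrow> (real^'d \<Rightarrow> complex) set" where
  "M1_space r s g0 =
     {f \<in> Lp_space 2 lborel. STFT g0 f \<in> weighted_Lp_space 1 (tf_weight r s) lborel}"

definition M1_norm :: "real \<Rightarrow> real \<Rightarrow> (real^'d \<Rightarrow> complex) \<Rightarrow> (real^'d \<Rightarrow> complex) \<Rightarrow> real" where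
  "M1_norm r s g0 f = weighted_Lp_norm 1 (tf_weight r s) lborel (STFT g0 f)"

text \<open>
  Bounded antilinear functionals on \<open>M1_space r s g0\<close>. Boundedness forces equal values on
  representatives that agree almost everywhere, and the value 0 off the space makes equality of
  functionals coincide with equality of functions.
\<close>

definition antidual ::
    "real \<Rightarrow> real \<Rightarrow> (real^'d \<Rightarrow> complex) \<Rightarrow> ((real^'d \<Rightarrow> complex) \<Rightarrow> complex) set" where
  "antidual r s g0 = {\<phi>.
     (\<forall>h. h \<notin> M1_space r s g0 \<longrightarrow> \<phi> h = 0) \<and>
     (\<forall>h\<in>M1_space r s g0. \<forall>k\<in>M1_space r s g0. \<phi> (\<lambda>t. h t + k t) = \<phi> h + \<phi> k) \<and>
     (\<forall>a. \<forall>h\<in>M1_space r s g0. \<phi> (\<lambda>t. a * h t) = cnj a * \<phi> h) \<and>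
     (\<exists>C. \<forall>h\<in>M1_space r s g0. norm (\<phi> h) \<le> C * M1_norm r s g0 h)}"

definition STFT_dual ::
    "(real^'d \<Rightarrow> complex) \<Rightarrow> ((real^'d \<Rightarrow> complex) \<Rightarrow> complex) \<Rightarrow> (real^'d) \<times> (real^'d) \<Rightarrow> complex" where
  "STFT_dual g \<phi> = (\<lambda>(x, \<omega>). \<phi> (modul \<omega> (transl x g)))"

definition modulation_space ::
    "ennreal \<Rightarrow> real \<Rightarrow> real \<Rightarrow> (real^'d \<Rightarrow> complex) \<Rightarrow> ((real^'d \<Rightarrow> complex) \<Rightarrow> complex) set" where
  "modulation_space p r s g0 =
     {\<phi> \<in> antidual r s g0. STFT_dual g0 \<phi> \<in> weighted_Lp_space p (tf_weight r s) lborel}"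

definition modulation_norm ::
    "ennreal \<Rightarrow> real \<Rightarrow> real \<Rightarrow> (real^'d \<Rightarrow> complex) \<Rightarrow> ((real^'d \<Rightarrow> complex) \<Rightarrow> complex) \<Rightarrow> real" where
  "modulation_norm p r s g0 \<phi> = weighted_Lp_norm p (tf_weight r s) lborel (STFT_dual g0 \<phi>)"


section \<open>Well-spread families\<close>

definition well_spread :: "'b::real_normed_vector set \<Rightarrow> 'i set \<Rightarrow> ('i \<Rightarrow> 'b) \<Rightarrow> bool" where
  "well_spread U I z \<longleftrightarrow> countable I \<and>
     (\<Union>j\<in>I. (+) (z j) ` U) = UNIV \<and>
     (\<forall>K. compact K \<longrightarrow> (\<exists>n. \<forall>i\<in>I.
        finite {j \<in> I. (+) (z i) ` K \<inter> (+) (z j) ` K \<noteq> {}} \<and>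
        card {j \<in> I. (+) (z i) ` K \<inter> (+) (z j) ` K \<noteq> {}} \<le> n))"


section \<open>Banach frames\<close>

text \<open>
  Vector spaces of complex-valued functions, with pointwise operations. This covers both
  sequence spaces and spaces of functionals.
\<close>

definition fun_subspace :: "('a \<Rightarrow> complex) set \<Rightarrow> bool" where
  "fun_subspace B \<longleftrightarrow> (\<lambda>_. 0) \<in> B \<and>
     (\<forall>f\<in>B. \<forall>h\<in>B. (\<lambda>x. f x + h x) \<in> B) \<and> (\<forall>a. \<forall>f\<in>B. (\<lambda>x. a * f x) \<in> B)"

definition is_norm_on :: "('a \<Rightarrow> complex) set \<Rightarrow> (('a \<Rightarrow> complex) \<Rightarrow> real) \<Rightarrow> bool" where
  "is_norm_on B N \<longleftrightarrow>
     (\<forall>f\<in>B. 0 \<le> N f \<and> (N f = 0 \<longleftrightarrow> f = (\<lambda>_. 0))) \<and>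
     (\<forall>a. \<forall>f\<in>B. N (\<lambda>x. a * f x) = norm a * N f) \<and>
     (\<forall>f\<in>B. \<forall>h\<in>B. N (\<lambda>x. f x + h x) \<le> N f + N h)"

definition fun_banach_space :: "('a \<Rightarrow> complex) set \<Rightarrow> (('a \<Rightarrow> complex) \<Rightarrow> real) \<Rightarrow> bool" where
  "fun_banach_space B N \<longleftrightarrow> fun_subspace B \<and> is_norm_on B N \<and>
     (\<forall>u :: nat \<Rightarrow> 'a \<Rightarrow> complex. (\<forall>n. u n \<in> B) \<and>
        (\<forall>e>0. \<exists>n0. \<forall>m\<ge>n0. \<forall>n\<ge>n0. N (\<lambda>x. u m x - u n x) < e) \<longrightarrow>
        (\<exists>l\<in>B. (\<lambda>n. N (\<lambda>x. u n x - l x)) \<longlonglongrightarrow> 0))"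

definition equivalent_on :: "'b set \<Rightarrow> ('b \<Rightarrow> real) \<Rightarrow> ('b \<Rightarrow> real) \<Rightarrow> bool" where
  "equivalent_on X N N' \<longleftrightarrow> (\<exists>A>0. \<exists>B>0. \<forall>f\<in>X. A * N f \<le> N' f \<and> N' f \<le> B * N f)"

definition bounded_linear_between ::
    "('a \<Rightarrow> complex) set \<Rightarrow> (('a \<Rightarrow> complex) \<Rightarrow> real) \<Rightarrow>
     ('b \<Rightarrow> complex) set \<Rightarrow> (('b \<Rightarrow> complex) \<Rightarrow> real) \<Rightarrow>
     (('a \<Rightarrow> complex) \<Rightarrow> 'b \<Rightarrow> complex) \<Rightarrow> bool" where
  "bounded_linear_between X NX Y NY R \<longleftrightarrow> (\<forall>c\<in>X. R c \<in> Y) \<and>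
     (\<forall>c\<in>X. \<forall>d\<in>X. R (\<lambda>j. c j + d j) = (\<lambda>y. R c y + R d y)) \<and>
     (\<forall>a. \<forall>c\<in>X. R (\<lambda>j. a * c j) = (\<lambda>y. a * R c y)) \<and>
     (\<exists>C. \<forall>c\<in>X. NY (R c) \<le> C * NX c)"

definition frame_coeffs :: "'i set \<Rightarrow> ('i \<Rightarrow> 'h) \<Rightarrow> ('h \<Rightarrow> complex) \<Rightarrow> 'i \<Rightarrow> complex" where
  "frame_coeffs I gs \<phi> = (\<lambda>j. if j \<in> I then \<phi> (gs j) else 0)"

text \<open>
  \<open>H\<close> is the space containing the family \<open>gs\<close>, \<open>(X, N)\<close> a space of functionals on \<open>H\<close>, and
  \<open>(Bd, Nd)\<close> the space of sequences.
\<close>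

definition banach_frame ::
    "'h set \<Rightarrow> ('h \<Rightarrow> complex) set \<Rightarrow> (('h \<Rightarrow> complex) \<Rightarrow> real) \<Rightarrow>
     ('i \<Rightarrow> complex) set \<Rightarrow> (('i \<Rightarrow> complex) \<Rightarrow> real) \<Rightarrow> 'i set \<Rightarrow> ('i \<Rightarrow> 'h) \<Rightarrow> bool" where
  "banach_frame H X N Bd Nd I gs \<longleftrightarrow>
     fun_banach_space Bd Nd \<and>
     (\<forall>j\<in>I. gs j \<in> H) \<and>
     (\<forall>\<phi>\<in>X. frame_coeffs I gs \<phi> \<in> Bd) \<and>
     is_norm_on X (\<lambda>\<phi>. Nd (frame_coeffs I gs \<phi>)) \<and>
     equivalent_on X N (\<lambda>\<phi>. Nd (frame_coeffs I gs \<phi>)) \<and>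
     (\<exists>R. bounded_linear_between Bd Nd X N R \<and> (\<forall>\<phi>\<in>X. R (frame_coeffs I gs \<phi>) = \<phi>))"

end

(*
  The transform F = STFT_dual g phi of a functional reproduces itself under integration against
  the kernel STFT g g (Moyal's identity, extended to functionals by approximating an integral of
  time-frequency shifts in the norm of M^1). Replacing F by the step function interpolating its
  samples at a U-dense family changes it, by Schur's test, by at most the weighted L^1 norm of
  the oscillation of the kernel over U. This norm tends to 0 with U because the local supremum
  of the kernel is still integrable against the weight, which is seen by comparison with a
  Gaussian window. Hence sampling, interpolation by step functions and synthesis compose to an
  operator close to the identity, and a Neumann series inverts it; the bounded overlap of
  the family is used only to bound the sampling operator.
*)

theory Submission
  imports Defs
begin

text \<open>The exponent p is arbitrary, infinity included, so the argument rests neither on duality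
  nor on density of M^1 in M^p. Schur's test gives the bounds for all p at once, and the Neumann
  series converges pointwise on M^1, Fatou's lemma recovering the norm. Time-frequency shifts
  commute only up to a phase, which rotates fast far from the origin, so plain interpolation of
  samples would fail. The step function multiplies each sample by the phase relating the two shifts;
  the error is then phi applied to a shift of g - \<open>tf_shift u g\<close> with small u. U must
  be chosen before the family. The error bound involves only the norms of analysis with g and of
  synthesis and the oscillation of g, none of which depends on the family; the norms of sampling and
  interpolation enter only the frame bounds. Moyal's identity has to cope with products of f and a
  translate of g that are merely integrable. A Gaussian factor in the frequency variable stands in
  for Plancherel's theorem.\<close>

section \<open>Bounds in Lebesgue spaces\<close>

text \<open>An inequality in place of a norm: it states that the norm is at most a without
  presupposing integrability, so estimates compose for all p at once.
  \<open>Lp_bounded_spaceD\<close> and \<open>Lp_bounded_norm\<close> translate to and from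
  \<open>Lp_space\<close> and \<open>Lp_norm\<close>.\<close>

definition Lp_bounded :: "ennreal \<Rightarrow> 'a measure \<Rightarrow> ('a \<Rightarrow> complex) \<Rightarrow> real \<Rightarrow> bool" where
  "Lp_bounded p M F a \<longleftrightarrow> F \<in> borel_measurable M \<and> 0 \<le> a \<and>
     (if p = \<infinity> then AE x in M. norm (F x) \<le> a
      else (\<integral>\<^sup>+x. ennreal (norm (F x) powr enn2real p) \<partial>M) \<le> ennreal (a powr enn2real p))"

lemma enn2real_ge_1: "1 \<le> p \<Longrightarrow> p \<noteq> \<infinity> \<Longrightarrow> 1 \<le> enn2real p"
  by (cases p) (auto simp: ennreal_le_iff2 simp flip: ennreal_1)

lemma Lp_boundedD:
  assumes "Lp_bounded p M F a"
  shows "F \<in> borel_measurable M" "0 \<le> a"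
  using assms by (auto simp: Lp_bounded_def)

lemma Lp_bounded_spaceD:
  assumes p: "1 \<le> p" and b: "Lp_bounded p M F a"
  shows "F \<in> Lp_space p M" "Lp_norm p M F \<le> a"
proof -
  have [measurable]: "F \<in> borel_measurable M" and a: "0 \<le> a"
    using b by (auto simp: Lp_bounded_def)
  have "F \<in> Lp_space p M \<and> Lp_norm p M F \<le> a"
  proof (cases "p = \<infinity>")
    case True
    then have "AE x in M. ereal (norm (F x)) \<le> ereal a"
      using b by (auto simp: Lp_bounded_def)
    then have e: "esssup M (\<lambda>x. ereal (norm (F x))) \<le> ereal a"
      by (intro esssup_I) auto
    then have "real_of_ereal (esssup M (\<lambda>x. ereal (norm (F x)))) \<le> a"
      using a by (cases "esssup M (\<lambda>x. ereal (norm (F x)))") auto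
    with e True show ?thesis
      by (auto simp: Lp_space_def Lp_norm_def)
  next
    case False
    define q where "q = enn2real p"
    have q: "1 \<le> q" using p False enn2real_ge_1 q_def by auto
    have le: "(\<integral>\<^sup>+x. ennreal (norm (F x) powr q) \<partial>M) \<le> ennreal (a powr q)"
      using b False by (auto simp: Lp_bounded_def q_def)
    have int: "integrable M (\<lambda>x. norm (F x) powr q)"
      using le by (intro integrableI_bounded) (auto simp: less_top[symmetric] top_unique)
    have "ennreal (\<integral>x. norm (F x) powr q \<partial>M) \<le> ennreal (a powr q)"
      using le nn_integral_eq_integral[OF int] by auto
    then have "(\<integral>x. norm (F x) powr q \<partial>M) \<le> a powr q"
      by (simp add: ennreal_le_iff)
    then have "(\<integral>x. norm (F x) powr q \<partial>M) powr (1/q) \<le> (a powr q) powr (1/q)"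
      using q by (intro powr_mono2) (auto intro: integral_nonneg_AE)
    also have "\<dots> = a" using q a by (simp add: powr_powr)
    finally show ?thesis
      using int False by (auto simp: Lp_space_def Lp_norm_def q_def)
  qed
  then show "F \<in> Lp_space p M" "Lp_norm p M F \<le> a" by auto
qed

lemma Lp_bounded_norm:
  assumes p: "1 \<le> p" and F: "F \<in> Lp_space p M"
  shows "Lp_bounded p M F (Lp_norm p M F)"
proof -
  have [measurable]: "F \<in> borel_measurable M"
    using F by (auto simp: Lp_space_def)
  show ?thesis
  proof (cases "p = \<infinity>")
    case True
    define e where "e = esssup M (\<lambda>x. ereal (norm (F x)))"
    have lt: "e < \<infinity>" using F True by (auto simp: Lp_space_def e_def)
    have AE: "AE x in M. ereal (norm (F x)) \<le> e"
      unfolding e_def by (rule esssup_AE)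
    have AE2: "AE x in M. norm (F x) \<le> real_of_ereal e"
    proof (use AE in eventually_elim)
      case (elim x) then show ?case using lt by (cases e) auto
    qed
    have "0 \<le> real_of_ereal e"
    \<comment> \<open>A negative essential supremum of a nonnegative function means a null measure.
      It is then \<open>-\<infinity>\<close>, which \<open>real_of_ereal\<close> sends to 0.\<close>
    proof (cases "e \<ge> 0")
      case False
      have "AE x in M. False"
        using AE
      proof (rule eventually_mono)
        fix x assume "ereal (norm (F x)) \<le> e"
        moreover have "0 \<le> ereal (norm (F x))" by simp
        ultimately have "0 \<le> e" by (rule order_trans[rotated])
        with False show False by simp
      qed
      then have *: "AE x in M. ereal (norm (F x)) \<le> -\<infinity>" by (rule eventually_mono) simp
      have "esssup M (\<lambda>x. ereal (norm (F x))) \<le> -\<infinity>"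
        by (rule esssup_I[OF _ *]) simp
      then have "e = -\<infinity>" by (simp add: e_def)
      then show ?thesis by simp
    qed (simp add: real_of_ereal_pos)
    then show ?thesis using AE2 True by (auto simp: Lp_bounded_def Lp_norm_def e_def)
  next
    case False
    define q where "q = enn2real p"
    have q: "1 \<le> q" using p False enn2real_ge_1 q_def by auto
    have int: "integrable M (\<lambda>x. norm (F x) powr q)"
      using F False by (auto simp: Lp_space_def q_def)
    have "(\<integral>x. norm (F x) powr q \<partial>M) = ((\<integral>x. norm (F x) powr q \<partial>M) powr (1/q)) powr q"
      using q by (simp add: powr_powr integral_nonneg_AE)
    then show ?thesis
      using nn_integral_eq_integral[OF int] False by (auto simp: Lp_bounded_def Lp_norm_def q_def)
  qed
qed

lemma Lp_norm_nonneg: "1 \<le> p \<Longrightarrow> F \<in> Lp_space p M \<Longrightarrow> 0 \<le> Lp_norm p M F"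
  using Lp_bounded_norm Lp_boundedD by blast

lemma Lp_bounded_mono:
  assumes "Lp_bounded p M F a" and [measurable]: "G \<in> borel_measurable M"
    and AE: "AE x in M. norm (G x) \<le> norm (F x)" and "a \<le> b" and p: "1 \<le> p"
  shows "Lp_bounded p M G b"
proof (cases "p = \<infinity>")
  case True
  then show ?thesis using assms by (auto simp: Lp_bounded_def)
next
  case False
  note q = enn2real_ge_1[OF p False]
  have "(\<integral>\<^sup>+x. ennreal (norm (G x) powr enn2real p) \<partial>M) \<le> (\<integral>\<^sup>+x. ennreal (norm (F x) powr enn2real p) \<partial>M)"
    using AE q by (intro nn_integral_mono_AE) (auto elim!: eventually_mono intro!: ennreal_leI powr_mono2)
  also have "\<dots> \<le> ennreal (a powr enn2real p)"
    using assms(1) False by (auto simp: Lp_bounded_def)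
  also have "\<dots> \<le> ennreal (b powr enn2real p)"
    using assms(1,4) q by (intro ennreal_leI powr_mono2) (auto simp: Lp_bounded_def)
  finally show ?thesis using False assms(1,4) by (auto simp: Lp_bounded_def)
qed

lemma Lp_bounded_scale:
  assumes b: "Lp_bounded p M F a"
  shows "Lp_bounded p M (\<lambda>x. c * F x) (norm c * a)"
proof -
  have [measurable]: "F \<in> borel_measurable M"
    using b by (auto simp: Lp_bounded_def)
  have "(\<integral>\<^sup>+x. ennreal (norm (c * F x) powr enn2real p) \<partial>M) =
     ennreal (norm c powr enn2real p) * (\<integral>\<^sup>+x. ennreal (norm (F x) powr enn2real p) \<partial>M)"
    by (subst nn_integral_cmult[symmetric]) (auto simp: norm_mult powr_mult ennreal_mult)
  then show ?thesis
    using b by (auto simp: Lp_bounded_def norm_mult powr_mult ennreal_mult elim!: eventually_mono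
      intro!: mult_left_mono)
qed

lemma Lp_bounded_0:
  assumes p: "1 \<le> p" and b: "Lp_bounded p M F 0"
  shows "AE x in M. F x = 0"
proof (cases "p = \<infinity>")
  case False
  have [measurable]: "F \<in> borel_measurable M"
    using b by (auto simp: Lp_bounded_def)
  have "(\<integral>\<^sup>+x. ennreal (norm (F x) powr enn2real p) \<partial>M) = 0"
    using b False by (auto simp: Lp_bounded_def)
  then have "AE x in M. ennreal (norm (F x) powr enn2real p) = 0"
    by (subst (asm) nn_integral_0_iff_AE) auto
  then show ?thesis by (auto elim!: eventually_mono simp: ennreal_eq_0_iff)
qed (use b in \<open>auto simp: Lp_bounded_def\<close>)

text \<open>Convexity of the power is taken on the open half-line. If u or v vanishes, the claim
  reduces to t^q \<le> t for t in [0, 1].\<close>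

lemma powr_convex_nonneg:
  fixes u v q l :: real
  assumes "0 \<le> u" "0 \<le> v" "1 \<le> q" "0 \<le> l" "l \<le> 1"
  shows "(l * u + (1 - l) * v) powr q \<le> l * u powr q + (1 - l) * v powr q"
proof -
  have small: "(t * x) powr q \<le> t * x powr q" if "0 \<le> t" "t \<le> 1" "0 \<le> x" for t x :: real
  proof -
    have "t powr q \<le> t"
    proof (cases "t = 0")
      case False
      then show ?thesis using that assms powr_mono'[of 1 q t] by simp
    qed simp
    then show ?thesis using that by (simp add: powr_mult mult_right_mono)
  qed
  consider "u = 0" | "v = 0" | "u > 0" "v > 0" using assms by linarith
  then show ?thesis
  proof cases
    case 1 then show ?thesis using small[of "1 - l" v] assms by simp
  next
    case 2 then show ?thesis using small[of l u] assms by simp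
  next
    case 3
    have "convex_on {0<..} (\<lambda>x. x powr q)" using assms by (intro powr_convex) auto
    from convex_onD[OF this, of "1-l" u v] 3 assms show ?thesis by simp
  qed
qed

text \<open>Minkowski's inequality from convexity alone: with l = a / (a + b), the sum is (a + b)
  times a convex combination of F / a and G / b, each with q-th moment at most 1. The division
  forces a separate treatment of a = 0 and b = 0, where one summand vanishes almost
  everywhere.\<close>

lemma Lp_bounded_add:
  assumes p: "1 \<le> p" and F: "Lp_bounded p M F a" and G: "Lp_bounded p M G b"
  shows "Lp_bounded p M (\<lambda>x. F x + G x) (a + b)"
proof -
  have [measurable]: "F \<in> borel_measurable M" "G \<in> borel_measurable M" and ab: "0 \<le> a" "0 \<le> b"
    using F G by (auto simp: Lp_bounded_def)
  consider "a = 0" | "b = 0" | "p = \<infinity>" | "a > 0" "b > 0" "p \<noteq> \<infinity>" using ab by fastforce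
  then show ?thesis
  proof cases
    case 1
    have "AE x in M. F x = 0" using F 1 p Lp_bounded_0 by blast
    then have "AE x in M. norm (F x + G x) \<le> norm (G x)" by auto
    then show ?thesis using 1 by (intro Lp_bounded_mono[OF G]) (use p in auto)
  next
    case 2
    have "AE x in M. G x = 0" using G 2 p Lp_bounded_0 by blast
    then have "AE x in M. norm (F x + G x) \<le> norm (F x)" by auto
    then show ?thesis using 2 by (intro Lp_bounded_mono[OF F]) (use p in auto)
  next
    case 3
    then have "AE x in M. norm (F x) \<le> a" "AE x in M. norm (G x) \<le> b"
      using F G by (auto simp: Lp_bounded_def)
    then have "AE x in M. norm (F x + G x) \<le> a + b"
      by eventually_elim (use norm_triangle_mono in blast)
    then show ?thesis using 3 ab by (auto simp: Lp_bounded_def)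
  next
    case 4
    define q where "q = enn2real p"
    have q: "1 \<le> q" using p 4 enn2real_ge_1 q_def by auto
    define l where "l = a / (a + b)"
    have l: "0 \<le> l" "l \<le> 1" "l * (a+b) = a" "(1-l) * (a+b) = b" using 4 by (auto simp: l_def field_simps)
    have ring_id: "(a + b) * (l * X + (1 - l) * Y) = (l * (a+b)) * X + ((1 - l) * (a+b)) * Y" for X Y
      by (simp add: algebra_simps)
    have pt: "norm (F x + G x) powr q \<le>
       (a + b) powr q * (l * a powr (-q)) * norm (F x) powr q + (a + b) powr q * ((1 - l) * b powr (-q)) * norm (G x) powr q" for x
    proof -
      have "norm (F x + G x) \<le> (a + b) * (l * (norm (F x) / a) + (1 - l) * (norm (G x) / b))"
      proof -
        have "(a + b) * (l * (norm (F x) / a) + (1 - l) * (norm (G x) / b)) = (l * (a+b)) * (norm (F x) / a) + ((1 - l) * (a+b)) * (norm (G x) / b)"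
          by (rule ring_id)
        also have "\<dots> = norm (F x) + norm (G x)" using 4 by (simp only: l(3,4)) simp
        finally show ?thesis using norm_triangle_ineq by metis
      qed
      then have "norm (F x + G x) powr q \<le> ((a + b) * (l * (norm (F x) / a) + (1 - l) * (norm (G x) / b))) powr q"
        using q by (intro powr_mono2) auto
      also have "\<dots> = (a + b) powr q * (l * (norm (F x) / a) + (1 - l) * (norm (G x) / b)) powr q"
        using 4 l by (simp add: powr_mult)
      also have "\<dots> \<le> (a + b) powr q * (l * (norm (F x) / a) powr q + (1 - l) * (norm (G x) / b) powr q)"
        using 4 l q by (intro mult_left_mono powr_convex_nonneg) auto
      finally show ?thesis using 4 by (simp add: powr_divide powr_minus field_simps)
    qed
    have c1: "(\<integral>\<^sup>+x. ennreal (norm (F x) powr q) \<partial>M) \<le> ennreal (a powr q)"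
     and c2: "(\<integral>\<^sup>+x. ennreal (norm (G x) powr q) \<partial>M) \<le> ennreal (b powr q)"
      using F G 4 by (auto simp: Lp_bounded_def q_def)
    have "(\<integral>\<^sup>+x. ennreal (norm (F x + G x) powr q) \<partial>M) \<le>
      (\<integral>\<^sup>+x. ennreal ((a + b) powr q * (l * a powr (-q))) * ennreal (norm (F x) powr q) +
        ennreal ((a + b) powr q * ((1 - l) * b powr (-q))) * ennreal (norm (G x) powr q) \<partial>M)"
      using pt l 4 by (intro nn_integral_mono)
        (auto simp flip: ennreal_plus ennreal_mult intro!: ennreal_leI)
    also have "\<dots> = ennreal ((a + b) powr q * (l * a powr (-q))) * (\<integral>\<^sup>+x. ennreal (norm (F x) powr q) \<partial>M) +
        ennreal ((a + b) powr q * ((1 - l) * b powr (-q))) * (\<integral>\<^sup>+x. ennreal (norm (G x) powr q) \<partial>M)"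
      by (simp add: nn_integral_add nn_integral_cmult)
    also have "\<dots> \<le> ennreal ((a + b) powr q * (l * a powr (-q))) * ennreal (a powr q) +
        ennreal ((a + b) powr q * ((1 - l) * b powr (-q))) * ennreal (b powr q)"
      by (intro add_mono mult_left_mono c1 c2) auto
    also have "\<dots> = ennreal ((a + b) powr q * (l * a powr (-q)) * a powr q + (a + b) powr q * ((1 - l) * b powr (-q)) * b powr q)"
      using l by (simp add: ennreal_mult[symmetric])
    also have "(a + b) powr q * (l * a powr (-q)) * a powr q + (a + b) powr q * ((1 - l) * b powr (-q)) * b powr q = (a + b) powr q"
      using 4 by (simp add: powr_minus field_simps)
    finally show ?thesis using 4 by (auto simp: Lp_bounded_def q_def)
  qed
qed

text \<open>The completeness argument used throughout: norm bounds survive pointwise limits.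
  Completeness of the sequence spaces and closedness of the modulation space both rest on
  it.\<close>

lemma Lp_bounded_Fatou:
  assumes p: "1 \<le> p" and F: "\<And>n. Lp_bounded p M (F n) a"
    and lim: "\<And>x. x \<in> space M \<Longrightarrow> (\<lambda>n. F n x) \<longlonglongrightarrow> G x"
  shows "Lp_bounded p M G a"
proof -
  have [measurable]: "\<And>n. F n \<in> borel_measurable M" and a: "0 \<le> a"
    using F by (auto simp: Lp_bounded_def)
  have [measurable]: "G \<in> borel_measurable M"
    by (rule borel_measurable_LIMSEQ_metric[OF _ lim]) measurable
  show ?thesis
  proof (cases "p = \<infinity>")
    case True
    then have "AE x in M. \<forall>n. norm (F n x) \<le> a"
      using F by (auto simp: Lp_bounded_def AE_all_countable)
    with AE_space have "AE x in M. norm (G x) \<le> a"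
    proof eventually_elim
      case (elim x)
      then show ?case using tendsto_norm[OF lim[of x]] by (intro LIMSEQ_le_const2[of "\<lambda>n. norm (F n x)"]) auto
    qed
    then show ?thesis using True a by (auto simp: Lp_bounded_def)
  next
    case False
    define q where "q = enn2real p"
    have q: "1 \<le> q" using p False enn2real_ge_1 q_def by auto
    have lim2: "(\<lambda>n. ennreal (norm (F n x) powr q)) \<longlonglongrightarrow> ennreal (norm (G x) powr q)" if "x \<in> space M" for x
      using q by (intro tendsto_ennrealI tendsto_powr' tendsto_norm lim that) auto
    have "(\<integral>\<^sup>+x. ennreal (norm (G x) powr q) \<partial>M) = (\<integral>\<^sup>+x. liminf (\<lambda>n. ennreal (norm (F n x) powr q)) \<partial>M)"
      using lim2 by (intro nn_integral_cong) (metis lim_imp_Liminf sequentially_bot)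
    also have "\<dots> \<le> liminf (\<lambda>n. \<integral>\<^sup>+x. ennreal (norm (F n x) powr q) \<partial>M)"
      by (intro nn_integral_liminf) auto
    also have "\<dots> \<le> liminf (\<lambda>n. ennreal (a powr q))"
      using F False by (intro Liminf_mono always_eventually) (auto simp: Lp_bounded_def q_def)
    also have "\<dots> = ennreal (a powr q)" by (simp add: Liminf_const)
    finally show ?thesis using False a by (auto simp: Lp_bounded_def q_def)
  qed
qed

text \<open>Jensen's inequality for the measure with density k, of mass at most C, obtained by
  optimising Young's inequality over a parameter b. A real t below the integral, rather than the
  integral itself, avoids powers of infinite values.\<close>

lemma nn_integral_weighted_Jensen:
  fixes f :: "'a \<Rightarrow> real"
  assumes q: "1 \<le> q" and C: "0 < C" and [measurable]: "f \<in> borel_measurable M" "k \<in> borel_measurable M"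
    and f: "\<And>x. 0 \<le> f x" and kC: "(\<integral>\<^sup>+x. k x \<partial>M) \<le> ennreal C"
    and t: "0 \<le> t" "ennreal t \<le> (\<integral>\<^sup>+x. k x * ennreal (f x) \<partial>M)"
  shows "ennreal (t powr q) \<le> ennreal (C powr (q - 1)) * (\<integral>\<^sup>+x. k x * ennreal (f x powr q) \<partial>M)"
proof (cases "(\<integral>\<^sup>+x. k x * ennreal (f x powr q) \<partial>M)")
  case top
  then show ?thesis using C by (simp add: ennreal_mult_top)
next
  case (real j)
  \<comment> \<open>Young's inequality as the tangent line of the power function at b: equality
    holds for f x = b.\<close>
  have young: "f x \<le> (b powr (1 - q) / q) * f x powr q + (1 - 1/q) * b" if "b > 0" for b x
  proof (cases "f x = 0")
    case False
    have "(f x powr q * b powr (1-q)) powr (1/q) * b powr (1 - 1/q) \<le> (1/q) * (f x powr q * b powr (1-q)) + (1-1/q) * b"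
      using q that False f[of x] by (intro Youngs_inequality_0) auto
    also have "(f x powr q * b powr (1-q)) powr (1/q) * b powr (1 - 1/q) = f x * (b powr ((1-q)/q) * b powr (1-1/q))"
      using q f[of x] that by (simp add: powr_mult powr_powr)
    also have "b powr ((1-q)/q) * b powr (1-1/q) = 1"
      using that q by (simp add: powr_add[symmetric] field_simps)
    finally show ?thesis by (simp add: mult_ac)
  qed (use q that in auto)
  have tb: "t \<le> (b powr (1 - q) / q) * j + (1 - 1/q) * b * C" if "b > 0" for b
  proof -
    have "ennreal t \<le> (\<integral>\<^sup>+x. k x * ennreal (f x) \<partial>M)" by fact
    also have "\<dots> \<le> (\<integral>\<^sup>+x. ennreal (b powr (1 - q) / q) * (k x * ennreal (f x powr q)) + ennreal ((1 - 1/q) * b) * k x \<partial>M)"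
    proof (intro nn_integral_mono)
      fix x
      have "k x * ennreal (f x) \<le> k x * ennreal ((b powr (1 - q) / q) * f x powr q + (1 - 1/q) * b)"
        by (intro mult_left_mono ennreal_leI young that) auto
      also have "ennreal ((b powr (1 - q) / q) * f x powr q + (1 - 1/q) * b) =
          ennreal (b powr (1 - q) / q) * ennreal (f x powr q) + ennreal ((1 - 1/q) * b)"
        using q that by (subst ennreal_plus) (auto simp only: ennreal_mult'' powr_ge_zero, auto)
      also have "k x * \<dots> = ennreal (b powr (1 - q) / q) * (k x * ennreal (f x powr q)) + ennreal ((1 - 1/q) * b) * k x"
        by (simp only: distrib_left mult_ac)
      finally show "k x * ennreal (f x) \<le> \<dots>" .
    qed
    also have "\<dots> = ennreal (b powr (1 - q) / q) * ennreal j + ennreal ((1 - 1/q) * b) * (\<integral>\<^sup>+x. k x \<partial>M)"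
      using real by (simp add: nn_integral_add nn_integral_cmult)
    also have "\<dots> \<le> ennreal (b powr (1 - q) / q) * ennreal j + ennreal ((1 - 1/q) * b) * ennreal C"
      by (intro add_left_mono mult_left_mono kC) auto
    also have "\<dots> = ennreal ((b powr (1 - q) / q) * j + (1 - 1/q) * b * C)"
      using q that real C by (simp add: ennreal_mult[symmetric] ennreal_plus[symmetric] del: ennreal_plus)
    finally show ?thesis
      using q that real C by (subst (asm) ennreal_le_iff) (auto intro!: add_nonneg_nonneg mult_nonneg_nonneg)
  qed
  have "t powr q \<le> C powr (q - 1) * j"
  proof (cases "j = 0")
    case True
    \<comment> \<open>With j = 0 the bound \<open>tb\<close> improves as b tends to 0; b = e / C
      leaves at most e.\<close>
    have "t \<le> 0"
    proof (rule field_le_epsilon)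
      fix e :: real assume "e > 0"
      have "t \<le> (1 - 1/q) * (e / C) * C" using tb[of "e / C"] \<open>e > 0\<close> C True by simp
      also have "\<dots> = (1-1/q) * e" using C by simp
      also have "\<dots> \<le> 1 * e" using \<open>e > 0\<close> q by (intro mult_right_mono) auto
      finally show "t \<le> 0 + e" by simp
    qed
    then show ?thesis using t True by simp
  next
    case False
    then have j: "j > 0" using real by simp
    \<comment> \<open>A minimiser of the right-hand side of \<open>tb\<close>; it turns j into C
      times the q-th power of b.\<close>
    define b where "b = (j / C) powr (1/q)"
    have b: "b > 0" using j C by (simp add: b_def)
    have bq: "j = C * b powr q" using j C q by (simp add: b_def powr_powr)
    have "b powr (1-q) * b powr q = b" using b by (simp flip: powr_add)
    then have "(b powr (1 - q) / q) * j = C * b / q" unfolding bq by (metis (no_types, lifting) mult.left_commute times_divide_eq_left times_divide_eq_right mult.commute)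
    then have "t \<le> C * b / q + (1 - 1/q) * b * C" using tb[OF b] by (simp only:)
    also have "\<dots> = C * b" by (simp add: algebra_simps)
    finally have "t powr q \<le> (C * b) powr q" using t q by (intro powr_mono2) auto
    also have "\<dots> = C powr (q-1) * j"
      using C b unfolding bq by (simp add: powr_mult powr_diff)
    finally show ?thesis .
  qed
  then show ?thesis using real by (simp flip: ennreal_mult' add: ennreal_leI)
qed

text \<open>Jensen's inequality in each row, then Tonelli and the column bound; for p = \<infinity>
  the row bound alone. T is only dominated by the kernel integral and the two measures may differ,
  so one statement handles convolution, interpolation from sequences to functions, sampling in the
  other direction, and pairing with a single function.\<close>

lemma Schur_test:
  assumes p: "1 \<le> p" and C: "0 < C" and "sigma_finite_measure M" "sigma_finite_measure N"
    and K[measurable]: "(\<lambda>(z, y). K z y) \<in> borel_measurable (N \<Otimes>\<^sub>M M)"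
    and row: "\<And>z. z \<in> space N \<Longrightarrow> (\<integral>\<^sup>+y. K z y \<partial>M) \<le> ennreal C"
    and col: "\<And>y. y \<in> space M \<Longrightarrow> (\<integral>\<^sup>+z. K z y \<partial>N) \<le> ennreal C"
    and F: "Lp_bounded p M F a" and T[measurable]: "T \<in> borel_measurable N"
    and le: "\<And>z. z \<in> space N \<Longrightarrow> ennreal (norm (T z)) \<le> (\<integral>\<^sup>+y. K z y * ennreal (norm (F y)) \<partial>M)"
  shows "Lp_bounded p N T (C * a)"
proof -
  interpret M: sigma_finite_measure M by fact
  interpret N: sigma_finite_measure N by fact
  interpret pair_sigma_finite N M ..
  have [measurable]: "F \<in> borel_measurable M" and a: "0 \<le> a"
    using F by (auto simp: Lp_bounded_def)
  show ?thesis
  proof (cases "p = \<infinity>")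
    case True
    then have AE: "AE y in M. norm (F y) \<le> a" using F by (auto simp: Lp_bounded_def)
    have "norm (T z) \<le> C * a" if z: "z \<in> space N" for z
    proof -
      have [measurable]: "K z \<in> borel_measurable M" using z K by (rule measurable_Pair2[of "\<lambda>(z, y). K z y", simplified, rotated])
      have "ennreal (norm (T z)) \<le> (\<integral>\<^sup>+y. K z y * ennreal (norm (F y)) \<partial>M)" using le z by auto
      also have "\<dots> \<le> (\<integral>\<^sup>+y. K z y * ennreal a \<partial>M)"
        using AE by (intro nn_integral_mono_AE) (auto elim!: eventually_mono intro!: mult_left_mono ennreal_leI)
      also have "\<dots> = (\<integral>\<^sup>+y. K z y \<partial>M) * ennreal a" by (simp add: nn_integral_multc)
      also have "\<dots> \<le> ennreal C * ennreal a" by (intro mult_right_mono row z) auto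
      also have "\<dots> = ennreal (C * a)" using C a by (simp add: ennreal_mult)
      finally show ?thesis using C a by (simp add: ennreal_le_iff)
    qed
    then show ?thesis using True C a by (auto simp: Lp_bounded_def)
  next
    case False
    define q where "q = enn2real p"
    have q: "1 \<le> q" using p False enn2real_ge_1 q_def by auto
    have Fq: "(\<integral>\<^sup>+x. ennreal (norm (F x) powr q) \<partial>M) \<le> ennreal (a powr q)"
      using F False by (auto simp: Lp_bounded_def q_def)
    have "(\<integral>\<^sup>+z. ennreal (norm (T z) powr q) \<partial>N) \<le>
        (\<integral>\<^sup>+z. ennreal (C powr (q - 1)) * (\<integral>\<^sup>+y. K z y * ennreal (norm (F y) powr q) \<partial>M) \<partial>N)"
    proof (intro nn_integral_mono)
      fix z assume z: "z \<in> space N"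
      have [measurable]: "K z \<in> borel_measurable M" using z K by (rule measurable_Pair2[of "\<lambda>(z, y). K z y", simplified, rotated])
      show "ennreal (norm (T z) powr q) \<le> ennreal (C powr (q - 1)) * (\<integral>\<^sup>+y. K z y * ennreal (norm (F y) powr q) \<partial>M)"
        by (intro nn_integral_weighted_Jensen q C row le z) auto
    qed
    also have "\<dots> = ennreal (C powr (q - 1)) * (\<integral>\<^sup>+z. (\<integral>\<^sup>+y. K z y * ennreal (norm (F y) powr q) \<partial>M) \<partial>N)"
      by (intro nn_integral_cmult) measurable
    also have "(\<integral>\<^sup>+z. (\<integral>\<^sup>+y. K z y * ennreal (norm (F y) powr q) \<partial>M) \<partial>N) = (\<integral>\<^sup>+y. (\<integral>\<^sup>+z. K z y * ennreal (norm (F y) powr q) \<partial>N) \<partial>M)"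
      by (rule Fubini'[symmetric]) measurable
    also have "\<dots> \<le> (\<integral>\<^sup>+y. ennreal C * ennreal (norm (F y) powr q) \<partial>M)"
    proof (intro nn_integral_mono)
      fix y assume y: "y \<in> space M"
      have [measurable]: "(\<lambda>z. K z y) \<in> borel_measurable N" using y K by (rule measurable_Pair1[of "\<lambda>(z, y). K z y", simplified, rotated])
      show "(\<integral>\<^sup>+z. K z y * ennreal (norm (F y) powr q) \<partial>N) \<le> ennreal C * ennreal (norm (F y) powr q)"
        by (subst nn_integral_multc) (auto intro!: mult_right_mono col y)
    qed
    also have "\<dots> = ennreal C * (\<integral>\<^sup>+y. ennreal (norm (F y) powr q) \<partial>M)"
      by (simp add: nn_integral_cmult)
    also have "ennreal (C powr (q - 1)) * (ennreal C * (\<integral>\<^sup>+y. ennreal (norm (F y) powr q) \<partial>M)) \<le>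
       ennreal (C powr (q - 1)) * (ennreal C * ennreal (a powr q))"
      by (intro mult_left_mono Fq) auto
    also have "\<dots> = ennreal (C powr (q - 1) * C * a powr q)"
      using C by (simp add: ennreal_mult mult.assoc)
    also have "C powr (q - 1) * C * a powr q = (C * a) powr q"
      using C a by (simp add: powr_mult powr_diff)
    finally show ?thesis using False C a by (auto simp: Lp_bounded_def q_def mult_left_mono)
  qed
qed

section \<open>Weighted sequence spaces and Neumann series\<close>

text \<open>The inequality for c and the inequality for its inverse combine to an equality.\<close>

lemma Lp_norm_scale:
  assumes p: "1 \<le> p" and F: "F \<in> Lp_space p M"
  shows "Lp_norm p M (\<lambda>x. c * F x) = norm c * Lp_norm p M F"
proof (cases "c = 0")
  case True
  have "Lp_norm p M (\<lambda>x. c * F x) \<le> norm c * Lp_norm p M F"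
    by (intro Lp_bounded_spaceD(2) p Lp_bounded_scale Lp_bounded_norm F)
  moreover have "0 \<le> Lp_norm p M (\<lambda>x. c * F x)"
    by (rule Lp_norm_nonneg[OF p Lp_bounded_spaceD(1)[OF p Lp_bounded_scale[OF Lp_bounded_norm[OF p F]]]])
  ultimately show ?thesis using True by simp
next
  case False
  have b: "Lp_bounded p M (\<lambda>x. c * F x) (norm c * Lp_norm p M F)"
    by (intro p Lp_bounded_scale Lp_bounded_norm F)
  have le: "Lp_norm p M (\<lambda>x. c * F x) \<le> norm c * Lp_norm p M F"
    by (intro Lp_bounded_spaceD(2) p b)
  have "Lp_norm p M (\<lambda>x. inverse c * (c * F x)) \<le> norm (inverse c) * Lp_norm p M (\<lambda>x. c * F x)"
    by (intro Lp_bounded_spaceD(2) p Lp_bounded_scale Lp_bounded_norm Lp_bounded_spaceD(1)[OF p b])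
  moreover have "(\<lambda>x. inverse c * (c * F x)) = F" using False by (simp add: fun_eq_iff mult.assoc[symmetric])
  ultimately have "Lp_norm p M F \<le> norm (inverse c) * Lp_norm p M (\<lambda>x. c * F x)"
    by simp
  then have "norm c * Lp_norm p M F \<le> Lp_norm p M (\<lambda>x. c * F x)"
    using False by (simp add: norm_inverse norm_divide field_simps)
  with le show ?thesis by simp
qed

section \<open>Weighted spaces and completeness of the sequence spaces\<close>

abbreviation weighted_Lp_bounded ::
    "ennreal \<Rightarrow> ('a \<Rightarrow> real) \<Rightarrow> 'a measure \<Rightarrow> ('a \<Rightarrow> complex) \<Rightarrow> real \<Rightarrow> bool" where
  "weighted_Lp_bounded p w M F a \<equiv> Lp_bounded p M (\<lambda>x. F x * of_real (w x)) a"

lemma weighted_Lp_boundedD: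
  assumes p: "1 \<le> p" and b: "weighted_Lp_bounded p w M F a"
  shows "F \<in> weighted_Lp_space p w M" "weighted_Lp_norm p w M F \<le> a"
  using Lp_bounded_spaceD[OF p b] by (auto simp: weighted_Lp_space_def weighted_Lp_norm_def)

lemma weighted_Lp_bounded_norm:
  "1 \<le> p \<Longrightarrow> F \<in> weighted_Lp_space p w M \<Longrightarrow>
    weighted_Lp_bounded p w M F (weighted_Lp_norm p w M F)"
  by (auto simp: weighted_Lp_space_def weighted_Lp_norm_def Lp_bounded_norm)

lemma weighted_Lp_norm_nonneg:
  "1 \<le> p \<Longrightarrow> F \<in> weighted_Lp_space p w M \<Longrightarrow> 0 \<le> weighted_Lp_norm p w M F"
  by (auto simp: weighted_Lp_space_def weighted_Lp_norm_def Lp_norm_nonneg)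

lemma weighted_Lp_bounded_add:
  assumes "1 \<le> p" "weighted_Lp_bounded p w M F a" "weighted_Lp_bounded p w M G b"
  shows "weighted_Lp_bounded p w M (\<lambda>x. F x + G x) (a + b)"
  using Lp_bounded_add[OF assms] by (simp add: distrib_right)

lemma weighted_Lp_bounded_scale:
  assumes "weighted_Lp_bounded p w M F a"
  shows "weighted_Lp_bounded p w M (\<lambda>x. c * F x) (norm c * a)"
  using Lp_bounded_scale[OF assms, of c] by (simp add: mult.assoc)

lemma weighted_Lp_norm_scale:
  assumes "1 \<le> p" "F \<in> weighted_Lp_space p w M"
  shows "weighted_Lp_norm p w M (\<lambda>x. c * F x) = norm c * weighted_Lp_norm p w M F"
  using Lp_norm_scale[OF assms(1), of "\<lambda>x. F x * of_real (w x)" M c] assms(2)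
  by (simp add: weighted_Lp_norm_def weighted_Lp_space_def mult.assoc)

lemma Lp_bounded_count_space_pointwise:
  assumes p: "1 \<le> p" and F: "Lp_bounded p (count_space I) F a" and j: "j \<in> I"
  shows "norm (F j) \<le> a"
proof (cases "p = \<infinity>")
  case True
  then show ?thesis using F j by (auto simp: Lp_bounded_def AE_count_space)
next
  case False
  define q where "q = enn2real p"
  have q: "1 \<le> q" using p False enn2real_ge_1 q_def by auto
  have a: "0 \<le> a" using F by (auto simp: Lp_bounded_def)
  have "ennreal (norm (F j) powr q) = (\<integral>\<^sup>+i. ennreal (norm (F j) powr q) * indicator {j} i \<partial>count_space I)"
    using j by (simp add: nn_integral_cmult_indicator)
  also have "\<dots> \<le> (\<integral>\<^sup>+i. ennreal (norm (F i) powr q) \<partial>count_space I)"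
    by (intro nn_integral_mono) (auto simp: indicator_def)
  also have "\<dots> \<le> ennreal (a powr q)" using F False by (auto simp: Lp_bounded_def q_def)
  finally have "norm (F j) powr q \<le> a powr q" by (simp add: ennreal_le_iff)
  then show ?thesis using q a by (meson norm_ge_zero not_le powr_less_mono2 order_less_le_trans zero_less_one)
qed

lemma weighted_seq_bounded_pointwise:
  assumes p: "1 \<le> p" and w: "\<And>j. j \<in> I \<Longrightarrow> 0 < w j" and F: "weighted_Lp_bounded p w (count_space I) F a" and j: "j \<in> I"
  shows "norm (F j) \<le> a / w j"
  using Lp_bounded_count_space_pointwise[OF p F j] w[OF j] by (simp add: norm_mult field_simps)

lemma weighted_seq_space_subspace:
  assumes p: "1 \<le> p"
  shows "fun_subspace (weighted_seq_space p w I)"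
proof -
  have "weighted_Lp_bounded p w (count_space I) (\<lambda>_. 0) 0"
    by (auto simp: Lp_bounded_def)
  then show ?thesis
    unfolding fun_subspace_def weighted_seq_space_def
    using weighted_Lp_boundedD(1)[OF p weighted_Lp_bounded_add[OF p weighted_Lp_bounded_norm[OF p] weighted_Lp_bounded_norm[OF p]]]
      weighted_Lp_boundedD(1)[OF p weighted_Lp_bounded_scale[OF weighted_Lp_bounded_norm[OF p]]]
    by (auto intro: weighted_Lp_boundedD(1)[OF p])
qed

lemma weighted_seq_norm_is_norm:
  assumes p: "1 \<le> p" and w: "\<And>j. j \<in> I \<Longrightarrow> 0 < w j"
  shows "is_norm_on (weighted_seq_space p w I) (weighted_seq_norm p w I)"
  unfolding is_norm_on_def
proof (intro conjI ballI allI)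
  fix f assume f: "f \<in> weighted_seq_space p w I"
  then have f': "f \<in> weighted_Lp_space p w (count_space I)" and f0: "\<And>j. j \<notin> I \<Longrightarrow> f j = 0"
    by (auto simp: weighted_seq_space_def)
  show "0 \<le> weighted_seq_norm p w I f"
    using f' p by (simp add: weighted_seq_norm_def weighted_Lp_norm_nonneg)
  show "weighted_seq_norm p w I f = 0 \<longleftrightarrow> f = (\<lambda>_. 0)"
  proof
    assume *: "weighted_seq_norm p w I f = 0"
    have "norm (f j) \<le> 0" if "j \<in> I" for j
      using weighted_seq_bounded_pointwise[OF p w weighted_Lp_bounded_norm[OF p f'] that] *
      by (simp add: weighted_seq_norm_def)
    then show "f = (\<lambda>_. 0)" using f0 by fastforce
  next
    assume *: "f = (\<lambda>_. 0)"
    have "weighted_Lp_bounded p w (count_space I) (\<lambda>_. 0) 0"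
      by (auto simp: Lp_bounded_def)
    from weighted_Lp_boundedD(2)[OF p this] weighted_Lp_norm_nonneg[OF p f'] show "weighted_seq_norm p w I f = 0"
      unfolding * weighted_seq_norm_def by linarith
  qed
  show "weighted_seq_norm p w I (\<lambda>x. a * f x) = norm a * weighted_seq_norm p w I f" for a
    unfolding weighted_seq_norm_def by (rule weighted_Lp_norm_scale[OF p f'])
  fix h assume "h \<in> weighted_seq_space p w I"
  then have h': "h \<in> weighted_Lp_space p w (count_space I)"
    by (auto simp: weighted_seq_space_def)
  show "weighted_seq_norm p w I (\<lambda>x. f x + h x) \<le> weighted_seq_norm p w I f + weighted_seq_norm p w I h"
    unfolding weighted_seq_norm_def
    by (intro weighted_Lp_boundedD(2) p weighted_Lp_bounded_add weighted_Lp_bounded_norm f' h')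
qed

text \<open>Coordinates are bounded functionals because the weights are positive, so a Cauchy
  sequence has a coordinatewise limit. \<open>Lp_bounded_Fatou\<close>, applied to differences with
  one late term fixed, upgrades this to convergence in norm.\<close>

lemma weighted_seq_space_banach:
  assumes p: "1 \<le> p" and w: "\<And>j. j \<in> I \<Longrightarrow> 0 < w j"
  shows "fun_banach_space (weighted_seq_space p w I) (weighted_seq_norm p w I)"
  unfolding fun_banach_space_def
proof (intro conjI allI impI weighted_seq_space_subspace[OF p] weighted_seq_norm_is_norm[OF p w])
  let ?N = "weighted_seq_norm p w I"
  fix u :: "nat \<Rightarrow> 'a \<Rightarrow> complex"
  assume "(\<forall>n. u n \<in> weighted_seq_space p w I) \<and> (\<forall>e>0. \<exists>n0. \<forall>m\<ge>n0. \<forall>n\<ge>n0. ?N (\<lambda>x. u m x - u n x) < e)"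
  then have u: "\<And>n. u n \<in> weighted_Lp_space p w (count_space I)" and u0: "\<And>n j. j \<notin> I \<Longrightarrow> u n j = 0"
    and cau: "\<And>e. e > 0 \<Longrightarrow> \<exists>n0. \<forall>m\<ge>n0. \<forall>n\<ge>n0. ?N (\<lambda>x. u m x - u n x) < e"
    by (auto simp: weighted_seq_space_def)
  have diff: "weighted_Lp_bounded p w (count_space I) (\<lambda>x. u m x - u n x) (?N (\<lambda>x. u m x - u n x))" for m n
    unfolding weighted_seq_norm_def
    using weighted_Lp_bounded_add[OF p weighted_Lp_bounded_norm[OF p u] weighted_Lp_bounded_scale[OF weighted_Lp_bounded_norm[OF p u]], of m "-1" n]
    by (intro weighted_Lp_bounded_norm p) (auto dest: weighted_Lp_boundedD(1)[OF p])
  have "Cauchy (\<lambda>n. u n j)" for j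
  proof (cases "j \<in> I")
    case True
    show ?thesis
    proof (rule CauchyI)
      fix e :: real assume "e > 0"
      then obtain n0 where n0: "\<And>m n. m \<ge> n0 \<Longrightarrow> n \<ge> n0 \<Longrightarrow> ?N (\<lambda>x. u m x - u n x) < e * w j"
        using cau[of "e * w j"] w[OF True] by auto
      have "norm (u m j - u n j) < e" if "m \<ge> n0" "n \<ge> n0" for m n
      proof -
        have "norm (u m j - u n j) \<le> ?N (\<lambda>x. u m x - u n x) / w j"
          by (rule weighted_seq_bounded_pointwise[OF p w diff True])
        also have "\<dots> < e" using n0[OF that] w[OF True] by (simp add: field_simps)
        finally show ?thesis .
      qed
      then show "\<exists>M. \<forall>m\<ge>M. \<forall>n\<ge>M. norm (u m j - u n j) < e" by blast
    qed
  qed (simp add: u0 Cauchy_def)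
  then have "\<exists>l. (\<lambda>n. u n j) \<longlonglongrightarrow> l" for j
    using Cauchy_convergent[of "\<lambda>n. u n j"] unfolding convergent_def by blast
  then obtain l where l: "\<And>j. (\<lambda>n. u n j) \<longlonglongrightarrow> l j" by metis
  have lim: "\<exists>n0. \<forall>n\<ge>n0. weighted_Lp_bounded p w (count_space I) (\<lambda>x. u n x - l x) e" if "e > 0" for e
  proof -
    obtain n0 where n0: "\<And>m n. m \<ge> n0 \<Longrightarrow> n \<ge> n0 \<Longrightarrow> ?N (\<lambda>x. u m x - u n x) < e"
      using cau[OF \<open>e > 0\<close>] by auto
    have "weighted_Lp_bounded p w (count_space I) (\<lambda>x. u n x - l x) e" if "n \<ge> n0" for n
    proof (rule Lp_bounded_Fatou[OF p])
      show "weighted_Lp_bounded p w (count_space I) (\<lambda>x. u n x - u (m + n0) x) e" for m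
        by (rule Lp_bounded_mono[OF diff[of n "m + n0"] _ _ less_imp_le p]) (use n0 that in auto)
      show "(\<lambda>m. (u n x - u (m + n0) x) * of_real (w x)) \<longlonglongrightarrow> (u n x - l x) * of_real (w x)" for x
        by (intro tendsto_intros LIMSEQ_ignore_initial_segment l)
    qed
    then show ?thesis by blast
  qed
  obtain n1 where "weighted_Lp_bounded p w (count_space I) (\<lambda>x. u n1 x - l x) 1"
    using lim[of 1] by auto
  from weighted_Lp_bounded_add[OF p weighted_Lp_bounded_norm[OF p u] weighted_Lp_bounded_scale[OF this], of n1 "-1"]
  have "weighted_Lp_bounded p w (count_space I) l (weighted_Lp_norm p w (count_space I) (u n1) + norm (-1::complex) * 1)" by simp
  moreover have "l j = 0" if "j \<notin> I" for j
    using l[of j] u0[OF that] by (simp add: LIMSEQ_const_iff)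
  ultimately have l_in: "l \<in> weighted_seq_space p w I"
    using weighted_Lp_boundedD(1)[OF p] by (auto simp: weighted_seq_space_def)
  have "(\<lambda>n. ?N (\<lambda>x. u n x - l x)) \<longlonglongrightarrow> 0"
  proof (rule LIMSEQ_I)
    fix e :: real assume "e > 0"
    then obtain n0 where n0: "\<And>n. n \<ge> n0 \<Longrightarrow> weighted_Lp_bounded p w (count_space I) (\<lambda>x. u n x - l x) (e/2)"
      using lim[of "e/2"] by auto
    have "norm (?N (\<lambda>x. u n x - l x) - 0) < e" if "n \<ge> n0" for n
      using weighted_Lp_boundedD[OF p n0[OF that]] weighted_Lp_norm_nonneg[OF p weighted_Lp_boundedD(1)[OF p n0[OF that]]] \<open>e > 0\<close>
      by (simp add: weighted_seq_norm_def)
    then show "\<exists>n0. \<forall>n\<ge>n0. norm (?N (\<lambda>x. u n x - l x) - 0) < e" by blast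
  qed
  then show "\<exists>l\<in>weighted_seq_space p w I. (\<lambda>n. ?N (\<lambda>x. u n x - l x)) \<longlonglongrightarrow> 0"
    using l_in by blast
qed

section \<open>Neumann series\<close>

lemma fun_subspaceD:
  assumes "fun_subspace X"
  shows "(\<lambda>_. 0) \<in> X" "f \<in> X \<Longrightarrow> h \<in> X \<Longrightarrow> (\<lambda>x. f x + h x) \<in> X" "f \<in> X \<Longrightarrow> (\<lambda>x. a * f x) \<in> X"
    "f \<in> X \<Longrightarrow> h \<in> X \<Longrightarrow> (\<lambda>x. f x - h x) \<in> X"
proof -
  show *: "(\<lambda>_. 0) \<in> X" "f \<in> X \<Longrightarrow> h \<in> X \<Longrightarrow> (\<lambda>x. f x + h x) \<in> X" "f \<in> X \<Longrightarrow> (\<lambda>x. a * f x) \<in> X" for f h a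
    using assms by (auto simp: fun_subspace_def)
  show "f \<in> X \<Longrightarrow> h \<in> X \<Longrightarrow> (\<lambda>x. f x - h x) \<in> X"
    using *(2)[of f "\<lambda>x. -1 * h x"] *(3)[of h "-1"] by simp
qed

text \<open>
  The Neumann series for the inverse of \<open>D \<circ> C\<close> is summed pointwise, so completeness of \<open>X\<close>
  enters only through closure under bounded pointwise limits.
\<close>

lemma Neumann_left_inverse:
  fixes X :: "('h \<Rightarrow> complex) set" and B :: "('i \<Rightarrow> complex) set"
  assumes X: "fun_subspace X"
    and N0: "\<And>f. f \<in> X \<Longrightarrow> 0 \<le> N f"
    and Nadd: "\<And>f h. f \<in> X \<Longrightarrow> h \<in> X \<Longrightarrow> N (\<lambda>x. f x + h x) \<le> N f + N h"
    and Nz: "N (\<lambda>_. 0) = 0"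
    and closed: "\<And>u a f. (\<And>n :: nat. u n \<in> X) \<Longrightarrow> (\<And>n. N (u n) \<le> a) \<Longrightarrow> (\<And>x. (\<lambda>n. u n x) \<longlonglongrightarrow> f x) \<Longrightarrow>
       f \<in> X \<and> N f \<le> a"
    and ev: "\<And>x. \<exists>c. \<forall>f\<in>X. norm (f x) \<le> c * N f"
    and D: "bounded_linear_between B Nb X N D"
    and CB: "\<And>f. f \<in> X \<Longrightarrow> C f \<in> B"
    and Cadd: "\<And>f h. f \<in> X \<Longrightarrow> h \<in> X \<Longrightarrow> C (\<lambda>x. f x + h x) = (\<lambda>j. C f j + C h j)"
    and Cscale: "\<And>f a. f \<in> X \<Longrightarrow> C (\<lambda>x. a * f x) = (\<lambda>j. a * C f j)"
    and half: "\<And>f. f \<in> X \<Longrightarrow> N (\<lambda>x. f x - D (C f) x) \<le> 1/2 * N f"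
  shows "\<exists>R. bounded_linear_between B Nb X N R \<and> (\<forall>f\<in>X. R (C f) = f)"
proof -
  note sub = fun_subspaceD[OF X]
  have DX: "\<And>c. c \<in> B \<Longrightarrow> D c \<in> X"
    and Dadd: "\<And>c d. c \<in> B \<Longrightarrow> d \<in> B \<Longrightarrow> D (\<lambda>j. c j + d j) = (\<lambda>y. D c y + D d y)"
    and Dscale: "\<And>a c. c \<in> B \<Longrightarrow> D (\<lambda>j. a * c j) = (\<lambda>y. a * D c y)"
    using D by (auto simp: bounded_linear_between_def)
  obtain K where K: "\<And>c. c \<in> B \<Longrightarrow> N (D c) \<le> K * Nb c"
    using D unfolding bounded_linear_between_def by blast
  define S where "S f = (\<lambda>x. f x - D (C f) x)" for f
  have SX: "S f \<in> X" if "f \<in> X" for f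
    unfolding S_def using that CB DX sub by auto
  have Sadd: "S (\<lambda>x. f x + h x) = (\<lambda>x. S f x + S h x)" if "f \<in> X" "h \<in> X" for f h
    unfolding S_def Cadd[OF that] Dadd[OF CB[OF that(1)] CB[OF that(2)]] by (simp add: algebra_simps)
  have Sscale: "S (\<lambda>x. a * f x) = (\<lambda>x. a * S f x)" if "f \<in> X" for f a
    unfolding S_def Cscale[OF that] Dscale[OF CB[OF that]] by (simp add: algebra_simps)
  have SkX: "(S ^^ k) f \<in> X" if "f \<in> X" for f k
    by (induction k) (auto simp: that SX)
  have Skadd: "(S ^^ k) (\<lambda>x. f x + h x) = (\<lambda>x. (S ^^ k) f x + (S ^^ k) h x)" if "f \<in> X" "h \<in> X" for f h k
    by (induction k) (auto simp: that Sadd SkX)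
  have Skscale: "(S ^^ k) (\<lambda>x. a * f x) = (\<lambda>x. a * (S ^^ k) f x)" if "f \<in> X" for f a k
    by (induction k) (auto simp: that Sscale SkX)
  have Sk: "N ((S ^^ k) f) \<le> (1/2) ^ k * N f" if "f \<in> X" for f k
  proof (induction k)
    case (Suc k)
    have "N ((S ^^ Suc k) f) \<le> 1/2 * N ((S ^^ k) f)" using half[OF SkX[OF that]] by (simp add: S_def)
    with Suc show ?case by simp
  qed simp
  \<comment> \<open>Evaluation at x is dominated by N, so the geometric decay of N along the
    iterates of S gives absolute convergence at each x.\<close>
  have sm: "summable (\<lambda>k. (S ^^ k) f x)" if "f \<in> X" for f x
  proof -
    obtain c where c: "\<And>f. f \<in> X \<Longrightarrow> norm (f x) \<le> c * N f" using ev by blast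
    have c': "norm (f x) \<le> \<bar>c\<bar> * N f" if "f \<in> X" for f
      using c[OF that] N0[OF that] by (meson abs_ge_self mult_right_mono order_trans)
    have "norm ((S ^^ k) f x) \<le> \<bar>c\<bar> * N f * (1/2) ^ k" for k
    proof -
      have "norm ((S ^^ k) f x) \<le> \<bar>c\<bar> * N ((S ^^ k) f)" using c' SkX that by auto
      also have "\<dots> \<le> \<bar>c\<bar> * ((1/2) ^ k * N f)" by (intro mult_left_mono Sk that) auto
      finally show ?thesis by (simp add: mult_ac)
    qed
    moreover have "summable (\<lambda>k. \<bar>c\<bar> * N f * (1/2) ^ k)"
      by (intro summable_mult summable_geometric) auto
    ultimately show ?thesis by (rule summable_comparison_test'[of _ 0, rotated])
  qed
  \<comment> \<open>Since S is the identity minus D \<circ> C, this is the inverse of D \<circ> C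
    applied after D.\<close>
  define R where "R c = (\<lambda>x. \<Sum>k. (S ^^ k) (D c) x)" for c
  have part: "(\<lambda>x. \<Sum>k<n. (S ^^ k) f x) \<in> X \<and> N (\<lambda>x. \<Sum>k<n. (S ^^ k) f x) \<le> (\<Sum>k<n. (1/2) ^ k * N f)" if "f \<in> X" for f n
  proof (induction n)
    case (Suc n)
    then have "N (\<lambda>x. (\<Sum>k<n. (S ^^ k) f x) + (S ^^ n) f x) \<le> N (\<lambda>x. \<Sum>k<n. (S ^^ k) f x) + N ((S ^^ n) f)"
      using Nadd SkX that by auto
    then show ?case using Suc Sk[OF that, of n] sub(2) SkX[OF that, of n] by auto
  qed (use sub Nz in auto)
  \<comment> \<open>The partial sums stay below the geometric series and converge pointwise, which
    is all that \<open>closed\<close> asks for; convergence with respect to N is never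
    shown.\<close>
  have RX: "R c \<in> X \<and> N (R c) \<le> 2 * N (D c)" if "c \<in> B" for c
  proof (rule closed)
    fix n
    show "(\<lambda>x. \<Sum>k<n. (S ^^ k) (D c) x) \<in> X" using part DX that by auto
    have "(\<Sum>k<n. (1/2) ^ k * N (D c)) = (\<Sum>k<n. (1/2) ^ k) * N (D c)" by (simp add: sum_distrib_right)
    also have "\<dots> \<le> 2 * N (D c)"
    proof (rule mult_right_mono)
      have "(\<Sum>k<n. (1/2::real) ^ k) \<le> (\<Sum>k. (1/2) ^ k)" by (intro sum_le_suminf) (auto simp: summable_geometric)
      also have "\<dots> = 2" by (subst suminf_geometric) auto
      finally show "(\<Sum>k<n. (1/2::real) ^ k) \<le> 2" .
    qed (use N0 DX that in auto)
    finally show "N (\<lambda>x. \<Sum>k<n. (S ^^ k) (D c) x) \<le> 2 * N (D c)" using part[of "D c" n] DX that by auto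
    show "(\<lambda>n. \<Sum>k<n. (S ^^ k) (D c) x) \<longlonglongrightarrow> R c x" for x
      unfolding R_def by (intro summable_LIMSEQ sm DX that)
  qed
  have "bounded_linear_between B Nb X N R"
    unfolding bounded_linear_between_def
  proof (intro conjI ballI allI)
    show "R c \<in> X" if "c \<in> B" for c using RX that by blast
    show "R (\<lambda>j. c j + d j) = (\<lambda>y. R c y + R d y)" if "c \<in> B" "d \<in> B" for c d
      unfolding R_def using that by (simp add: Dadd Skadd DX suminf_add sm)
    show "R (\<lambda>j. a * c j) = (\<lambda>y. a * R c y)" if "c \<in> B" for a c
      unfolding R_def using that by (simp add: Dscale Skscale DX suminf_mult sm)
    have "N (R c) \<le> (2 * K) * Nb c" if "c \<in> B" for c using RX[OF that] K[OF that] by simp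
    then show "\<exists>Ca. \<forall>c\<in>B. N (R c) \<le> Ca * Nb c" by blast
  qed
  moreover have "R (C f) = f" if f: "f \<in> X" for f
  proof
    fix x
    \<comment> \<open>D (C f) = f - S f, so the series telescopes to f.\<close>
    have "(S ^^ k) (D (C f)) x = (S ^^ k) f x - (S ^^ Suc k) f x" for k
    proof -
      have "(S ^^ k) (\<lambda>x. S f x + D (C f) x) = (\<lambda>x. (S ^^ k) (S f) x + (S ^^ k) (D (C f)) x)"
        using f by (intro Skadd SX DX CB)
      moreover have "(\<lambda>x. S f x + D (C f) x) = f" by (simp add: S_def)
      ultimately have "(S ^^ k) f x = (S ^^ k) (S f) x + (S ^^ k) (D (C f)) x" by metis
      then show ?thesis by (simp add: funpow_swap1)
    qed
    moreover have "(\<lambda>k. (S ^^ k) f x - (S ^^ Suc k) f x) sums ((S ^^ 0) f x - 0)"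
      by (rule telescope_sums') (rule summable_LIMSEQ_zero[OF sm[OF f]])
    ultimately show "R (C f) x = f x"
      unfolding R_def by (simp add: sums_iff)
  qed
  ultimately show ?thesis by blast
qed

section \<open>Continuity of translations in the mean\<close>

lemma nn_integral_lborel_affine:
  fixes t :: "'a::euclidean_space"
  assumes [measurable]: "f \<in> borel_measurable borel" and c: "c \<noteq> 0"
  shows "(\<integral>\<^sup>+x. f x \<partial>lborel) = ennreal (\<bar>c\<bar> ^ DIM('a)) * (\<integral>\<^sup>+x. f (t + c *\<^sub>R x) \<partial>lborel)"
  by (subst lborel_affine[OF c, of t])
     (simp add: nn_integral_density nn_integral_distr nn_integral_cmult ennreal_power)

lemma integral_lborel_affine:
  fixes t :: "'a::euclidean_space" and f :: "'a \<Rightarrow> 'b::{banach, second_countable_topology}"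
  assumes [measurable]: "f \<in> borel_measurable borel" and c: "c \<noteq> 0"
  shows "(\<integral>x. f x \<partial>lborel) = \<bar>c\<bar> ^ DIM('a) *\<^sub>R (\<integral>x. f (t + c *\<^sub>R x) \<partial>lborel)"
proof -
  have eq: "lborel = density (distr lborel borel (\<lambda>x. t + c *\<^sub>R x)) (\<lambda>_. ennreal (\<bar>c\<bar> ^ DIM('a)))"
    using lborel_affine[OF c, of t] by (simp add: ennreal_power)
  show ?thesis
    by (subst eq) (simp add: integral_density integral_distr)
qed

lemma nn_integral_lborel_shift:
  fixes a :: "'a::euclidean_space"
  assumes [measurable]: "f \<in> borel_measurable borel"
  shows "(\<integral>\<^sup>+x. f (x + a) \<partial>lborel) = (\<integral>\<^sup>+x. f x \<partial>lborel)"
    "(\<integral>\<^sup>+x. f (x - a) \<partial>lborel) = (\<integral>\<^sup>+x. f x \<partial>lborel)"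
    "(\<integral>\<^sup>+x. f (a - x) \<partial>lborel) = (\<integral>\<^sup>+x. f x \<partial>lborel)"
  using nn_integral_lborel_affine[of f 1 a] nn_integral_lborel_affine[of f 1 "-a"] nn_integral_lborel_affine[of f "-1" a]
  by (simp_all add: add.commute)

lemma integral_lborel_shift:
  fixes a :: "'a::euclidean_space" and f :: "'a \<Rightarrow> 'b::{banach, second_countable_topology}"
  assumes [measurable]: "f \<in> borel_measurable borel"
  shows "(\<integral>x. f (x + a) \<partial>lborel) = (\<integral>x. f x \<partial>lborel)"
    "(\<integral>x. f (x - a) \<partial>lborel) = (\<integral>x. f x \<partial>lborel)"
    "(\<integral>x. f (a - x) \<partial>lborel) = (\<integral>x. f x \<partial>lborel)"
  using integral_lborel_affine[of f 1 a] integral_lborel_affine[of f 1 "-a"] integral_lborel_affine[of f "-1" a]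
  by (simp_all add: add.commute)

lemma integrable_lborel_shift:
  fixes a :: "'a::euclidean_space" and f :: "'a \<Rightarrow> 'b::{banach, second_countable_topology}"
  assumes "integrable lborel f"
  shows "integrable lborel (\<lambda>x. f (x + a))" "integrable lborel (\<lambda>x. f (x - a))" "integrable lborel (\<lambda>x. f (a - x))"
proof -
  have [measurable]: "f \<in> borel_measurable borel" using assms borel_measurable_integrable by fastforce
  show "integrable lborel (\<lambda>x. f (x + a))" "integrable lborel (\<lambda>x. f (x - a))" "integrable lborel (\<lambda>x. f (a - x))"
    using assms nn_integral_lborel_shift[of "\<lambda>x. ennreal (norm (f x))" a] by (auto simp: integrable_iff_bounded)
qed

lemma ennreal_tendsto_0_by_approx:
  fixes u :: "nat \<Rightarrow> ennreal"
  assumes "\<And>e :: real. e > 0 \<Longrightarrow> \<forall>\<^sub>F n in sequentially. u n \<le> ennreal e"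
  shows "u \<longlonglongrightarrow> 0"
proof (rule order_tendstoI)
  fix a :: ennreal assume "0 < a"
  then obtain e where e: "0 < e" "ennreal e < a"
    using dense[of 0 a] by (metis ennreal_cases ennreal_less_zero_iff top.not_eq_extremum top_greatest leD)
  from assms[OF e(1)] show "\<forall>\<^sub>F n in sequentially. u n < a"
    by eventually_elim (use e(2) in auto)
qed simp

text \<open>Subtraction in \<open>ennreal\<close> truncates at 0, so the integrand is the indicator
  of V minus its translate. Openness makes it vanish eventually at each point: t in V forces t - X n
  in V for large n. The other half of the symmetric difference is obtained later by a
  translation.\<close>

lemma indicator_open_translation:
  fixes V :: "'a::euclidean_space set"
  assumes V: "open V" "emeasure lborel V < \<infinity>" and X: "X \<longlonglongrightarrow> 0"
  shows "(\<lambda>n. \<integral>\<^sup>+t. indicator V t - indicator V (t - X n) \<partial>lborel) \<longlonglongrightarrow> 0"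
proof -
  have [measurable]: "V \<in> sets borel" using V by auto
  have "(\<lambda>n. \<integral>\<^sup>+t. indicator V t - indicator V (t - X n) \<partial>lborel) \<longlonglongrightarrow> (\<integral>\<^sup>+t. 0 \<partial>(lborel :: 'a measure))"
  proof (rule nn_integral_dominated_convergence[where w = "indicator V"])
    show "AE t in lborel. (\<lambda>n. indicator V t - indicator V (t - X n) :: ennreal) \<longlonglongrightarrow> 0"
    proof (intro always_eventually allI)
      fix t
      show "(\<lambda>n. indicator V t - indicator V (t - X n) :: ennreal) \<longlonglongrightarrow> 0"
      proof (cases "t \<in> V")
        case True
        have "(\<lambda>n. t - X n) \<longlonglongrightarrow> t - 0" by (intro tendsto_intros X)
        then have "\<forall>\<^sub>F n in sequentially. t - X n \<in> V" using True V by (auto simp: topological_tendstoD)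
        then have "\<forall>\<^sub>F n in sequentially. indicator V t - indicator V (t - X n) = (0 :: ennreal)"
          by eventually_elim (auto simp: indicator_def)
        then show ?thesis by (rule tendsto_eventually)
      qed simp
    qed
  qed (use V in \<open>auto simp: diff_le_self_ennreal\<close>)
  then show ?thesis by simp
qed

text \<open>The \<open>L1\<close> modulus of continuity, valued in \<open>ennreal\<close> so that no
  integrability has to be carried along.\<close>

definition shift_diff :: "('a::euclidean_space \<Rightarrow> complex) \<Rightarrow> 'a \<Rightarrow> ennreal" where
  "shift_diff f x = (\<integral>\<^sup>+t. ennreal (norm (f (t - x) - f t)) \<partial>lborel)"

lemma shift_diff_approx:
  assumes [measurable]: "f \<in> borel_measurable borel" "g \<in> borel_measurable borel"
  shows "shift_diff f x \<le> shift_diff g x + 2 * (\<integral>\<^sup>+t. ennreal (norm (f t - g t)) \<partial>lborel)"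
proof -
  have "shift_diff f x \<le> (\<integral>\<^sup>+t. ennreal (norm (g (t - x) - g t)) + (ennreal (norm (f (t - x) - g (t - x))) + ennreal (norm (f t - g t))) \<partial>lborel)"
    unfolding shift_diff_def
  proof (intro nn_integral_mono)
    fix t
    have "norm (f (t - x) - f t) \<le> norm (g (t - x) - g t) + (norm (f (t - x) - g (t - x)) + norm (f t - g t))"
      by norm
    then show "ennreal (norm (f (t - x) - f t)) \<le> ennreal (norm (g (t - x) - g t)) + (ennreal (norm (f (t - x) - g (t - x))) + ennreal (norm (f t - g t)))"
      by (simp flip: ennreal_plus add: ennreal_leI)
  qed
  also have "\<dots> = shift_diff g x + ((\<integral>\<^sup>+t. ennreal (norm (f (t - x) - g (t - x))) \<partial>lborel) + (\<integral>\<^sup>+t. ennreal (norm (f t - g t)) \<partial>lborel))"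
    unfolding shift_diff_def by (subst nn_integral_add; (measurable | simp))+
  also have "(\<integral>\<^sup>+t. ennreal (norm (f (t - x) - g (t - x))) \<partial>lborel) = (\<integral>\<^sup>+t. ennreal (norm (f t - g t)) \<partial>lborel)"
    by (rule nn_integral_lborel_shift(2)) measurable
  finally show ?thesis by (simp add: mult_2)
qed

lemma shift_diff_limit:
  assumes [measurable]: "f \<in> borel_measurable borel"
    and ap: "\<And>e :: real. e > 0 \<Longrightarrow> \<exists>g \<in> borel_measurable borel. (\<integral>\<^sup>+t. ennreal (norm (f t - g t)) \<partial>lborel) \<le> ennreal e \<and>
      (\<lambda>n. shift_diff g (X n)) \<longlonglongrightarrow> 0"
  shows "(\<lambda>n. shift_diff f (X n)) \<longlonglongrightarrow> 0"
proof (rule ennreal_tendsto_0_by_approx)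
  fix e :: real assume "e > 0"
  then obtain g where g[measurable]: "g \<in> borel_measurable borel" and ge: "(\<integral>\<^sup>+t. ennreal (norm (f t - g t)) \<partial>lborel) \<le> ennreal (e/4)"
    and gl: "(\<lambda>n. shift_diff g (X n)) \<longlonglongrightarrow> 0"
    using ap[of "e/4"] by auto
  have "\<forall>\<^sub>F n in sequentially. shift_diff g (X n) < ennreal (e/2)"
    using gl \<open>e > 0\<close> by (intro order_tendstoD) auto
  then show "\<forall>\<^sub>F n in sequentially. shift_diff f (X n) \<le> ennreal e"
  proof eventually_elim
    case (elim n)
    have "shift_diff f (X n) \<le> shift_diff g (X n) + 2 * (\<integral>\<^sup>+t. ennreal (norm (f t - g t)) \<partial>lborel)"
      by (rule shift_diff_approx) auto
    also have "\<dots> \<le> ennreal (e/2) + 2 * ennreal (e/4)"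
      using elim ge by (intro add_mono mult_left_mono) auto
    also have "2 * ennreal (e/4) = ennreal (e/2)"
      using \<open>e > 0\<close> by (subst ennreal_numeral[symmetric], subst ennreal_mult[symmetric]) auto
    also have "ennreal (e/2) + ennreal (e/2) = ennreal e"
      using \<open>e > 0\<close> by (subst ennreal_plus[symmetric]) auto
    finally show ?case .
  qed
qed

text \<open>Outer regularity reduces measurable sets of finite measure to open ones, which
  \<open>indicator_open_translation\<close> handles.\<close>

lemma shift_diff_indicator_tendsto_0:
  fixes A :: "'a::euclidean_space set"
  assumes A: "A \<in> sets borel" "emeasure lborel A < \<infinity>" and X: "X \<longlonglongrightarrow> 0"
  shows "(\<lambda>n. shift_diff (\<lambda>t. indicator A t *\<^sub>R c) (X n)) \<longlonglongrightarrow> 0"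
proof (rule shift_diff_limit)
  show "(\<lambda>t. indicator A t *\<^sub>R c) \<in> borel_measurable borel" using A by measurable
  fix e :: real assume e: "e > 0"
  \<comment> \<open>\<open>+ 1\<close> because c may be 0.\<close>
  define e' where "e' = e / (norm c + 1)"
  have "e' > 0" using e by (auto simp: e'_def divide_pos_pos add_nonneg_pos)
  then obtain V where V: "open V" "A \<subseteq> V" "emeasure lborel (V - A) < ennreal e'"
    using outer_regular_lborel[OF A(1)] by blast
  have [measurable]: "V \<in> sets borel" "A \<in> sets borel" using V A by auto
  have "emeasure lborel V = emeasure lborel A + emeasure lborel (V - A)"
    using V(2) by (subst plus_emeasure) (auto simp: Un_absorb1)
  also have "\<dots> < \<infinity>" using A V(3) by (auto simp: less_top[symmetric] top_unique)
  finally have Vf: "emeasure lborel V < \<infinity>" .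
  have "(\<integral>\<^sup>+t. ennreal (norm (indicator A t *\<^sub>R c - indicator V t *\<^sub>R c)) \<partial>lborel) = (\<integral>\<^sup>+t. ennreal (norm c) * indicator (V - A) t \<partial>lborel)"
    using V(2) by (intro nn_integral_cong) (auto simp: indicator_def)
  also have "\<dots> = ennreal (norm c) * emeasure lborel (V - A)"
    by (intro nn_integral_cmult_indicator) simp
  also have "\<dots> \<le> ennreal (norm c) * ennreal e'" using V(3) by (intro mult_left_mono) auto
  also have "\<dots> = ennreal (norm c * e')" using \<open>e' > 0\<close> by (simp add: ennreal_mult)
  also have "\<dots> \<le> ennreal e" using e by (intro ennreal_leI) (simp add: e'_def pos_divide_le_eq add_nonneg_pos distrib_left mult.commute)
  finally have 1: "(\<integral>\<^sup>+t. ennreal (norm (indicator A t *\<^sub>R c - indicator V t *\<^sub>R c)) \<partial>lborel) \<le> ennreal e" .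
  \<comment> \<open>The symmetric difference of V and its translate splits into two truncated
    differences. Translating the second turns it into the first with -x in place of x.\<close>
  have eq: "shift_diff (\<lambda>t. indicator V t *\<^sub>R c) x = ennreal (norm c) *
     ((\<integral>\<^sup>+t. indicator V t - indicator V (t - x) \<partial>lborel) + (\<integral>\<^sup>+t. indicator V t - indicator V (t - (-x)) \<partial>lborel))" for x
  proof -
    have "(\<integral>\<^sup>+t. indicator V t - indicator V (t - (-x)) \<partial>lborel) = (\<integral>\<^sup>+t. indicator V (t - x) - indicator V ((t - x) - (-x)) \<partial>lborel)"
      by (rule nn_integral_lborel_shift(2)[symmetric]) measurable
    then have "ennreal (norm c) *
     ((\<integral>\<^sup>+t. indicator V t - indicator V (t - x) \<partial>lborel) + (\<integral>\<^sup>+t. indicator V t - indicator V (t - (-x)) \<partial>lborel))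
      = (\<integral>\<^sup>+t. ennreal (norm c) * ((indicator V t - indicator V (t - x)) + (indicator V (t - x) - indicator V t)) \<partial>lborel)"
      by (simp add: nn_integral_cmult nn_integral_add)
    also have "\<dots> = shift_diff (\<lambda>t. indicator V t *\<^sub>R c) x"
      unfolding shift_diff_def by (intro nn_integral_cong) (auto simp: indicator_def)
    finally show ?thesis ..
  qed
  have "(\<lambda>n. - X n) \<longlonglongrightarrow> 0" using tendsto_minus[OF X] by simp
  note lims = indicator_open_translation[OF V(1) Vf X] indicator_open_translation[OF V(1) Vf this]
  have "(\<lambda>n. shift_diff (\<lambda>t. indicator V t *\<^sub>R c) (X n)) \<longlonglongrightarrow> ennreal (norm c) * (0 + 0)"
    unfolding eq by (intro ennreal_tendsto_cmult tendsto_add lims) auto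
  then show "\<exists>g \<in> borel_measurable borel. (\<integral>\<^sup>+t. ennreal (norm (indicator A t *\<^sub>R c - g t)) \<partial>lborel) \<le> ennreal e \<and>
      (\<lambda>n. shift_diff g (X n)) \<longlonglongrightarrow> 0"
    using 1 by (intro bexI[of _ "\<lambda>t. indicator V t *\<^sub>R c"]) auto
qed

lemma shift_diff_integrable_tendsto_0:
  fixes f :: "'a::euclidean_space \<Rightarrow> complex"
  assumes "integrable lborel f" and X: "X \<longlonglongrightarrow> 0"
  shows "(\<lambda>n. shift_diff f (X n)) \<longlonglongrightarrow> 0"
  using assms(1)
proof (induction rule: integrable_induct)
  case (base A c)
  then show ?case by (intro shift_diff_indicator_tendsto_0 X) auto
next
  case (add f g)
  have [measurable]: "f \<in> borel_measurable borel" "g \<in> borel_measurable borel"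
    using add by auto
  have le: "shift_diff (\<lambda>x. f x + g x) x \<le> shift_diff f x + shift_diff g x" for x
  proof -
    have "shift_diff (\<lambda>x. f x + g x) x \<le> (\<integral>\<^sup>+t. ennreal (norm (f (t - x) - f t)) + ennreal (norm (g (t - x) - g t)) \<partial>lborel)"
      unfolding shift_diff_def
    proof (intro nn_integral_mono)
      fix t
      have "norm (f (t - x) + g (t - x) - (f t + g t)) \<le> norm (f (t - x) - f t) + norm (g (t - x) - g t)" by norm
      then show "ennreal (norm (f (t - x) + g (t - x) - (f t + g t))) \<le> ennreal (norm (f (t - x) - f t)) + ennreal (norm (g (t - x) - g t))"
        by (simp flip: ennreal_plus add: ennreal_leI)
    qed
    also have "\<dots> = shift_diff f x + shift_diff g x"
      unfolding shift_diff_def by (intro nn_integral_add) measurable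
    finally show ?thesis .
  qed
  have "(\<lambda>n. shift_diff f (X n) + shift_diff g (X n)) \<longlonglongrightarrow> 0 + 0"
    by (intro tendsto_add add.IH)
  then have l: "(\<lambda>n. shift_diff f (X n) + shift_diff g (X n)) \<longlonglongrightarrow> 0" by simp
  show ?case
    by (rule tendsto_sandwich[OF _ _ tendsto_const l]) (use le in auto)
next
  case (lim f s)
  have [measurable]: "f \<in> borel_measurable borel" "\<And>i. s i \<in> borel_measurable borel"
    using lim by auto
  show ?case
  proof (rule shift_diff_limit)
    fix e :: real assume e: "e > 0"
    have "(\<lambda>i. \<integral>\<^sup>+t. ennreal (norm (f t - s i t)) \<partial>lborel) \<longlonglongrightarrow> (\<integral>\<^sup>+t. 0 \<partial>(lborel :: 'a measure))"
    proof (rule nn_integral_dominated_convergence[where w = "\<lambda>t. 3 * ennreal (norm (f t))"])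
      show "AE t in lborel. (\<lambda>i. ennreal (norm (f t - s i t))) \<longlonglongrightarrow> 0"
      proof (intro always_eventually allI)
        fix t
        have "(\<lambda>i. ennreal (norm (f t - s i t))) \<longlonglongrightarrow> ennreal (norm (f t - f t))"
          using lim(2)[of t] by (intro tendsto_ennrealI tendsto_intros) auto
        then show "(\<lambda>i. ennreal (norm (f t - s i t))) \<longlonglongrightarrow> 0" by simp
      qed
      show "AE t in lborel. ennreal (norm (f t - s i t)) \<le> 3 * ennreal (norm (f t))" for i
      proof (intro always_eventually allI)
        fix t
        have "norm (f t - s i t) \<le> norm (f t) + norm (s i t)" by norm
        also have "\<dots> \<le> 3 * norm (f t)" using lim(3)[of t i] by simp
        finally show "ennreal (norm (f t - s i t)) \<le> 3 * ennreal (norm (f t))"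
          by (subst ennreal_numeral[symmetric], subst ennreal_mult[symmetric]) (auto intro: ennreal_leI)
      qed
      show "(\<integral>\<^sup>+t. 3 * ennreal (norm (f t)) \<partial>lborel) < \<infinity>"
        using lim(4) by (subst nn_integral_cmult) (auto simp: integrable_iff_bounded ennreal_mult_less_top)
    qed auto
    then have "(\<lambda>i. \<integral>\<^sup>+t. ennreal (norm (f t - s i t)) \<partial>lborel) \<longlonglongrightarrow> 0" by simp
    then have "\<forall>\<^sub>F i in sequentially. (\<integral>\<^sup>+t. ennreal (norm (f t - s i t)) \<partial>lborel) < ennreal e"
      using e by (intro order_tendstoD) auto
    then obtain i where "(\<integral>\<^sup>+t. ennreal (norm (f t - s i t)) \<partial>lborel) < ennreal e"
      by (auto simp: eventually_sequentially)
    then show "\<exists>g \<in> borel_measurable borel. (\<integral>\<^sup>+t. ennreal (norm (f t - g t)) \<partial>lborel) \<le> ennreal e \<and> (\<lambda>n. shift_diff g (X n)) \<longlonglongrightarrow> 0"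
      using lim by (intro bexI[of _ "s i"]) auto
  qed measurable
qed

text \<open>Reduces translation continuity in \<open>L\<^sup>2\<close> to the case of \<open>L\<^sup>1\<close>.\<close>

lemma norm_diff_square_le:
  fixes a b :: complex
  shows "(norm (a - b))\<^sup>2 \<le> 2 * norm (norm a *\<^sub>R a - norm b *\<^sub>R b)"
proof (cases "a = b")
  case False
  let ?d = "norm (a - b)"
  have d: "?d > 0" using False by simp
  \<comment> \<open>Monotonicity of a \<mapsto> |a| a: the last summand equals (|a| - |b|)^2 (|a| +
    |b|) / 2, hence is nonnegative.\<close>
  have "(norm a *\<^sub>R a - norm b *\<^sub>R b) \<bullet> (a - b) =
     1/2 * (norm a + norm b) * ?d\<^sup>2 + 1/2 * (norm a - norm b) * ((norm a)\<^sup>2 - (norm b)\<^sup>2)"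
    unfolding power2_norm_eq_inner
    by (simp add: inner_diff_left inner_diff_right inner_commute[of b a] field_simps power2_norm_eq_inner)
  moreover have "0 \<le> (norm a - norm b) * ((norm a)\<^sup>2 - (norm b)\<^sup>2)"
    by (metis mult.assoc mult_nonneg_nonneg norm_ge_zero add_nonneg_nonneg power2_eq_square square_diff_square_factored zero_le_square mult.commute)
  ultimately have "1/2 * (norm a + norm b) * ?d\<^sup>2 \<le> (norm a *\<^sub>R a - norm b *\<^sub>R b) \<bullet> (a - b)" by simp
  also have "\<dots> \<le> norm (norm a *\<^sub>R a - norm b *\<^sub>R b) * ?d" by (rule norm_cauchy_schwarz)
  finally have "1/2 * (norm a + norm b) * ?d * ?d \<le> norm (norm a *\<^sub>R a - norm b *\<^sub>R b) * ?d"
    by (simp add: power2_eq_square mult_ac)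
  then have "1/2 * (norm a + norm b) * ?d \<le> norm (norm a *\<^sub>R a - norm b *\<^sub>R b)" using d by simp
  moreover have "?d * ?d \<le> (norm a + norm b) * ?d"
    by (intro mult_right_mono norm_triangle_ineq4) auto
  ultimately show ?thesis by (simp add: power2_eq_square)
qed simp

section \<open>Square-integrable functions and time-frequency shifts\<close>

abbreviation L2 :: "('a::euclidean_space \<Rightarrow> complex) set" where "L2 \<equiv> Lp_space 2 lborel"
abbreviation L2_norm :: "('a::euclidean_space \<Rightarrow> complex) \<Rightarrow> real" where "L2_norm \<equiv> Lp_norm 2 lborel"

lemma cnj_measurable[measurable]: "cnj \<in> borel_measurable borel"
  by (intro borel_measurable_continuous_onI continuous_intros)

lemma enn2real_2: "enn2real 2 = 2"
  by (metis enn2real_ennreal ennreal_numeral zero_le_numeral)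

lemma powr_2: "0 \<le> x \<Longrightarrow> x powr 2 = (x :: real)\<^sup>2"
  using powr_numeral[of x num.One] by (cases "x = 0") (auto simp: powr_numeral)

lemma ennreal_power2_le_imp_le: "(a :: ennreal)\<^sup>2 \<le> b\<^sup>2 \<Longrightarrow> a \<le> b"
  by (cases a; cases b) (auto simp: ennreal_power power_mono_iff top_power_ennreal ennreal_le_iff top_unique)

lemma L2_iff: "f \<in> L2 \<longleftrightarrow> f \<in> borel_measurable borel \<and> integrable lborel (\<lambda>t. (norm (f t))\<^sup>2)"
  by (simp add: Lp_space_def powr_2 enn2real_2)

lemma L2_measurable[measurable_dest]: "f \<in> L2 \<Longrightarrow> f \<in> borel_measurable borel"
  by (simp add: L2_iff)

lemma L2_norm_square: "(L2_norm f)\<^sup>2 = (\<integral>t. (norm (f t))\<^sup>2 \<partial>lborel)"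
proof -
  have "0 \<le> (\<integral>t. (norm (f t))\<^sup>2 \<partial>lborel)" by (intro integral_nonneg_AE) auto
  then show ?thesis by (simp add: Lp_norm_def powr_2 enn2real_2 powr_half_sqrt)
qed

lemma L2_norm_nonneg: "0 \<le> L2_norm f"
  by (simp add: Lp_norm_def)

lemma L2_nn_integral: "f \<in> L2 \<Longrightarrow> (\<integral>\<^sup>+t. ennreal ((norm (f t))\<^sup>2) \<partial>lborel) = ennreal ((L2_norm f)\<^sup>2)"
  unfolding L2_norm_square by (intro nn_integral_eq_integral) (auto simp: L2_iff)

lemma L2_add: "f \<in> L2 \<Longrightarrow> g \<in> L2 \<Longrightarrow> (\<lambda>t. f t + g t) \<in> L2"
  and L2_norm_add: "f \<in> L2 \<Longrightarrow> g \<in> L2 \<Longrightarrow> L2_norm (\<lambda>t. f t + g t) \<le> L2_norm f + L2_norm g"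
  using Lp_bounded_spaceD[OF _ Lp_bounded_add[OF _ Lp_bounded_norm Lp_bounded_norm], of 2 f lborel g] by auto

lemma L2_scale: "f \<in> L2 \<Longrightarrow> (\<lambda>t. c * f t) \<in> L2"
  using Lp_bounded_spaceD(1)[OF _ Lp_bounded_scale[OF Lp_bounded_norm], of 2 f lborel c] by auto

lemma L2_diff: "f \<in> L2 \<Longrightarrow> g \<in> L2 \<Longrightarrow> (\<lambda>t. f t - g t) \<in> L2"
  using L2_add[of f "\<lambda>t. -1 * g t"] L2_scale[of g "-1"] by simp

lemma L2_cnj_nn_integral:
  assumes "f \<in> L2" "g \<in> L2"
  shows "(\<integral>\<^sup>+t. ennreal (norm (f t) * norm (g t)) \<partial>lborel) \<le> ennreal (L2_norm f * L2_norm g)"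
proof -
  have [measurable]: "f \<in> borel_measurable borel" "g \<in> borel_measurable borel"
    using assms by (auto simp: L2_iff)
  have "(\<integral>\<^sup>+t. ennreal (norm (f t)) * ennreal (norm (g t)) \<partial>lborel)\<^sup>2 \<le>
      (\<integral>\<^sup>+t. (ennreal (norm (f t)))\<^sup>2 \<partial>lborel) * (\<integral>\<^sup>+t. (ennreal (norm (g t)))\<^sup>2 \<partial>lborel)"
    by (rule Cauchy_Schwarz_nn_integral) auto
  also have "\<dots> = ennreal ((L2_norm f)\<^sup>2) * ennreal ((L2_norm g)\<^sup>2)"
    using L2_nn_integral[OF assms(1)] L2_nn_integral[OF assms(2)] by (simp add: ennreal_power)
  also have "\<dots> = (ennreal (L2_norm f * L2_norm g))\<^sup>2"
    by (simp add: ennreal_power[symmetric] ennreal_mult L2_norm_nonneg power_mult_distrib)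
  finally show ?thesis
    by (simp add: ennreal_mult ennreal_power2_le_imp_le L2_norm_nonneg)
qed

lemma L2_cnj_integrable:
  assumes "f \<in> L2" "g \<in> L2"
  shows "integrable lborel (\<lambda>t. f t * cnj (g t))"
proof -
  have [measurable]: "f \<in> borel_measurable borel" "g \<in> borel_measurable borel"
    using assms by (auto simp: L2_iff)
  show ?thesis using L2_cnj_nn_integral[OF assms]
    by (intro integrableI_bounded) (auto simp: norm_mult less_top[symmetric] top_unique)
qed

lemma L2_inner_bound:
  assumes "f \<in> L2" "g \<in> L2"
  shows "norm (L2_inner f g) \<le> L2_norm f * L2_norm g"
proof -
  have "ennreal (norm (L2_inner f g)) \<le> (\<integral>\<^sup>+t. ennreal (norm (f t * cnj (g t))) \<partial>lborel)"
    unfolding L2_inner_def by (rule integral_norm_bound_ennreal[OF L2_cnj_integrable[OF assms]])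
  also have "\<dots> \<le> ennreal (L2_norm f * L2_norm g)"
    using L2_cnj_nn_integral[OF assms] by (simp add: norm_mult)
  finally show ?thesis by (simp add: L2_norm_nonneg)
qed

lemma L2_inner_cnj: "L2_inner g f = cnj (L2_inner f g)"
  unfolding L2_inner_def by (subst Bochner_Integration.integral_cnj[symmetric]) (simp add: mult.commute)

lemma L2_inner_self: "L2_inner f f = of_real ((L2_norm f)\<^sup>2)"
  unfolding L2_inner_def L2_norm_square
  by (subst integral_complex_of_real[symmetric]) (simp add: complex_norm_square[symmetric])

lemma L2_inner_left_add: "f \<in> L2 \<Longrightarrow> g \<in> L2 \<Longrightarrow> h \<in> L2 \<Longrightarrow>
    L2_inner (\<lambda>t. f t + g t) h = L2_inner f h + L2_inner g h"
  unfolding L2_inner_def by (simp add: distrib_right L2_cnj_integrable)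

lemma L2_inner_left_diff: "f \<in> L2 \<Longrightarrow> g \<in> L2 \<Longrightarrow> h \<in> L2 \<Longrightarrow>
    L2_inner (\<lambda>t. f t - g t) h = L2_inner f h - L2_inner g h"
  unfolding L2_inner_def by (simp add: left_diff_distrib L2_cnj_integrable)

lemma L2_inner_left_scale: "L2_inner (\<lambda>t. c * f t) h = c * L2_inner f h"
  unfolding L2_inner_def by (simp add: mult.assoc)

lemma L2_inner_right_scale: "L2_inner h (\<lambda>t. c * f t) = cnj c * L2_inner h f"
  unfolding L2_inner_def by (simp add: mult.left_commute)

lemma L2_inner_tendsto:
  assumes "\<And>n. f n \<in> L2" "f0 \<in> L2" "g \<in> L2" and "(\<lambda>n. L2_norm (\<lambda>t. f n t - f0 t)) \<longlonglongrightarrow> 0"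
  shows "(\<lambda>n. L2_inner (f n) g) \<longlonglongrightarrow> L2_inner f0 g"
proof (rule LIM_zero_cancel, rule Lim_null_comparison)
  show "\<forall>\<^sub>F n in sequentially. norm (L2_inner (f n) g - L2_inner f0 g) \<le> L2_norm (\<lambda>t. f n t - f0 t) * L2_norm g"
    using L2_inner_bound[OF L2_diff assms(3)] assms by (auto simp flip: L2_inner_left_diff)
  show "(\<lambda>n. L2_norm (\<lambda>t. f n t - f0 t) * L2_norm g) \<longlonglongrightarrow> 0"
    using tendsto_mult_left_zero[OF assms(4)] by simp
qed

section \<open>Time-frequency shifts and their covariance\<close>

definition phase :: "real \<Rightarrow> complex" where "phase a = cis (2 * pi * a)"

lemma norm_phase[simp]: "norm (phase a) = 1"
  by (simp add: phase_def)
lemma phase_0[simp]: "phase 0 = 1"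
  by (simp add: phase_def)
lemma phase_add: "phase (a + b) = phase a * phase b"
  by (simp add: phase_def cis_mult distrib_left)
lemma phase_cnj: "cnj (phase a) = phase (- a)"
  by (simp add: phase_def cis_cnj)
lemma phase_continuous[continuous_intros]: "continuous_on A f \<Longrightarrow> continuous_on A (\<lambda>x. phase (f x))"
  unfolding phase_def cis_conv_exp by (intro continuous_intros)
lemma phase_measurable[measurable]: "phase \<in> borel_measurable borel"
  by (intro borel_measurable_continuous_onI continuous_intros)
lemma tendsto_phase[tendsto_intros]: "(f \<longlongrightarrow> a) F \<Longrightarrow> ((\<lambda>x. phase (f x)) \<longlongrightarrow> phase a) F"
  unfolding phase_def cis_conv_exp by (intro tendsto_intros) auto
lemma phase_mult_minus[simp]: "phase a * phase (- a) = 1" "phase (- a) * phase a = 1"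
  by (simp_all flip: phase_add)

definition tf_shift :: "(real^'d) \<times> (real^'d) \<Rightarrow> (real^'d \<Rightarrow> complex) \<Rightarrow> real^'d \<Rightarrow> complex" where
  "tf_shift z g = modul (snd z) (transl (fst z) g)"

lemma tf_shift_apply: "tf_shift z g t = phase (snd z \<bullet> t) * g (t - fst z)"
  by (simp add: tf_shift_def modul_def transl_def phase_def cis_conv_exp mult_ac)

lemma STFT_eq: "STFT g f z = L2_inner f (tf_shift z g)"
  by (simp add: STFT_def tf_shift_def case_prod_beta)

lemma STFT_dual_eq: "STFT_dual g \<phi> z = \<phi> (tf_shift z g)"
  by (simp add: STFT_dual_def tf_shift_def case_prod_beta)

lemma tf_shift_0[simp]: "tf_shift 0 g = g"
  by (simp add: fun_eq_iff tf_shift_apply)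

text \<open>The phase is the price for moving a translation past a modulation. It is the origin of
  the factor in \<open>step\<close>.\<close>

lemma tf_shift_comp: "tf_shift z (tf_shift u g) = (\<lambda>t. phase (- (snd u \<bullet> fst z)) * tf_shift (z + u) g t)"
proof
  fix t
  have "phase (snd z \<bullet> t) * phase (snd u \<bullet> (t - fst z)) = phase (- (snd u \<bullet> fst z)) * phase ((snd z + snd u) \<bullet> t)"
    by (simp flip: phase_add add: inner_diff_right inner_add_left algebra_simps)
  then show "tf_shift z (tf_shift u g) t = phase (- (snd u \<bullet> fst z)) * tf_shift (z + u) g t"
    by (simp add: tf_shift_apply diff_diff_eq add.commute mult.assoc[symmetric])
qed

lemma tf_shift_diff: "tf_shift z (\<lambda>t. f t - g t) = (\<lambda>t. tf_shift z f t - tf_shift z g t)"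
  by (simp add: fun_eq_iff tf_shift_apply right_diff_distrib)

lemma tf_shift_measurable[measurable]:
  assumes [measurable]: "f \<in> borel_measurable borel"
  shows "tf_shift z f \<in> borel_measurable borel"
  unfolding tf_shift_apply[abs_def] by measurable

lemma tf_shift_L2: "f \<in> L2 \<Longrightarrow> tf_shift z f \<in> L2"
  and tf_shift_L2_norm: "f \<in> L2 \<Longrightarrow> L2_norm (tf_shift z f) = L2_norm f"
proof -
  assume f: "f \<in> L2"
  then have [measurable]: "f \<in> borel_measurable borel" by measurable
  have "integrable lborel (\<lambda>t. (norm (f (t - fst z)))\<^sup>2)"
    using f integrable_lborel_shift(2)[of "\<lambda>t. (norm (f t))\<^sup>2" "fst z"] by (auto simp: L2_iff)
  then show "tf_shift z f \<in> L2"
    unfolding L2_iff by (intro conjI tf_shift_measurable) (simp_all add: tf_shift_apply norm_mult)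
  have "(L2_norm (tf_shift z f))\<^sup>2 = (L2_norm f)\<^sup>2"
    unfolding L2_norm_square using integral_lborel_shift(2)[of "\<lambda>t. (norm (f t))\<^sup>2" "fst z"]
    by (simp add: tf_shift_apply norm_mult)
  then show "L2_norm (tf_shift z f) = L2_norm f"
    by (simp add: power2_eq_iff_nonneg L2_norm_nonneg)
qed

lemma L2_inner_tf_shift_both:
  assumes "f \<in> L2" "g \<in> L2"
  shows "L2_inner (tf_shift z f) (tf_shift z g) = L2_inner f g"
proof -
  have [measurable]: "f \<in> borel_measurable borel" "g \<in> borel_measurable borel" using assms by measurable
  have "L2_inner (tf_shift z f) (tf_shift z g) = (\<integral>t. f (t - fst z) * cnj (g (t - fst z)) \<partial>lborel)"
    unfolding L2_inner_def
  proof (intro Bochner_Integration.integral_cong refl)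
    fix t
    have "tf_shift z f t * cnj (tf_shift z g t) = (phase (snd z \<bullet> t) * phase (- (snd z \<bullet> t))) * (f (t - fst z) * cnj (g (t - fst z)))"
      unfolding tf_shift_apply complex_cnj_mult phase_cnj by (simp only: mult_ac)
    then show "tf_shift z f t * cnj (tf_shift z g t) = f (t - fst z) * cnj (g (t - fst z))" by simp
  qed
  then show ?thesis
    unfolding L2_inner_def using integral_lborel_shift(2)[of "\<lambda>t. f t * cnj (g t)" "fst z"] by simp
qed

text \<open>Covariance: an inner product of two shifts is, up to a phase, the transform at the
  difference. Absolute values therefore depend on the difference only, which makes all later kernels
  convolution kernels.\<close>

lemma L2_inner_tf_shifts:
  assumes "f \<in> L2" "g \<in> L2"
  shows "L2_inner (tf_shift z f) (tf_shift y g) = phase (- (snd (y - z) \<bullet> fst z)) * STFT g f (y - z)"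
proof -
  have "tf_shift y g = (\<lambda>t. phase (snd (y - z) \<bullet> fst z) * tf_shift z (tf_shift (y - z) g) t)"
    by (simp add: tf_shift_comp fun_eq_iff mult.assoc[symmetric])
  then show ?thesis
    using assms by (simp add: L2_inner_right_scale L2_inner_tf_shift_both tf_shift_L2 STFT_eq phase_cnj)
qed

lemma norm_STFT_tf_shift:
  assumes "f \<in> L2" "g \<in> L2"
  shows "norm (STFT g (tf_shift z f) y) = norm (STFT g f (y - z))"
  unfolding STFT_eq[of _ "tf_shift z f"] L2_inner_tf_shifts[OF assms] by (simp add: norm_mult)

lemma norm_STFT_commute:
  assumes "f \<in> L2" "g \<in> L2"
  shows "norm (STFT g f z) = norm (STFT f g (- z))"
  using L2_inner_tf_shifts[OF assms(2,1), of z 0]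
  by (subst STFT_eq, subst L2_inner_cnj) (simp add: norm_mult)

lemma norm_STFT_bound: "f \<in> L2 \<Longrightarrow> g \<in> L2 \<Longrightarrow> norm (STFT g f z) \<le> L2_norm f * L2_norm g"
  using L2_inner_bound[of f "tf_shift z g"] by (simp add: STFT_eq tf_shift_L2 tf_shift_L2_norm)

lemma STFT_measurable_aux:
  assumes "f \<in> L2" "g \<in> L2"
  shows "STFT g f \<in> borel_measurable (borel \<Otimes>\<^sub>M borel)"
proof -
  have [measurable]: "f \<in> borel_measurable borel" "g \<in> borel_measurable borel" using assms by measurable
  show ?thesis
    unfolding STFT_eq[abs_def] L2_inner_def tf_shift_apply
    by measurable
qed

lemma STFT_measurable:
  assumes "f \<in> L2" "g \<in> L2"
  shows "STFT g f \<in> borel_measurable borel"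
  using STFT_measurable_aux[OF assms] by (simp add: borel_prod)

lemma L2_norm_tendsto_0:
  assumes "\<And>n. f n \<in> L2" and "(\<lambda>n. \<integral>\<^sup>+t. ennreal ((norm (f n t))\<^sup>2) \<partial>lborel) \<longlonglongrightarrow> 0"
  shows "(\<lambda>n. L2_norm (f n)) \<longlonglongrightarrow> 0"
proof -
  have "(\<lambda>n. ennreal ((L2_norm (f n))\<^sup>2)) \<longlonglongrightarrow> ennreal 0" using assms by (simp add: L2_nn_integral)
  then have "(\<lambda>n. (L2_norm (f n))\<^sup>2) \<longlonglongrightarrow> 0"
    by (subst (asm) tendsto_ennreal_iff) auto
  then have "(\<lambda>n. sqrt ((L2_norm (f n))\<^sup>2)) \<longlonglongrightarrow> sqrt 0" by (intro tendsto_real_sqrt)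
  then show ?thesis by (simp add: L2_norm_nonneg)
qed

lemma L2_translation_continuous_0:
  assumes f: "f \<in> L2" and X: "X \<longlonglongrightarrow> 0"
  shows "(\<lambda>n. L2_norm (\<lambda>t. tf_shift (X n, 0) f t - f t)) \<longlonglongrightarrow> 0"
proof (rule L2_norm_tendsto_0)
  have [measurable]: "f \<in> borel_measurable borel" using f by measurable
  \<comment> \<open>F is integrable, and \<open>norm_diff_square_le\<close> bounds the squared
    difference of f and its translate by twice the difference for F.\<close>
  define F where "F t = norm (f t) *\<^sub>R f t" for t
  have "integrable lborel F"
    using f unfolding L2_iff F_def
    by (intro integrableI_bounded) (auto simp: integrable_iff_bounded power2_eq_square)
  then have lim: "(\<lambda>n. shift_diff F (X n)) \<longlonglongrightarrow> 0" using X by (rule shift_diff_integrable_tendsto_0)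
  have lim2: "(\<lambda>n. 2 * shift_diff F (X n)) \<longlonglongrightarrow> 0"
    using ennreal_tendsto_cmult[OF _ lim, of 2] by simp
  show "(\<lambda>n. \<integral>\<^sup>+t. ennreal ((norm (tf_shift (X n, 0) f t - f t))\<^sup>2) \<partial>lborel) \<longlonglongrightarrow> 0"
  proof (rule tendsto_sandwich[OF _ _ tendsto_const lim2])
    have "(\<integral>\<^sup>+t. ennreal ((norm (tf_shift (X n, 0) f t - f t))\<^sup>2) \<partial>lborel) \<le> 2 * shift_diff F (X n)" for n
    proof -
      have "(\<integral>\<^sup>+t. ennreal ((norm (tf_shift (X n, 0) f t - f t))\<^sup>2) \<partial>lborel) \<le>
         (\<integral>\<^sup>+t. 2 * ennreal (norm (F (t - X n) - F t)) \<partial>lborel)"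
      proof (intro nn_integral_mono)
        fix t
        have "(norm (tf_shift (X n, 0) f t - f t))\<^sup>2 \<le> 2 * norm (F (t - X n) - F t)"
          unfolding F_def using norm_diff_square_le[of "f (t - X n)" "f t"] by (simp add: tf_shift_apply)
        then show "ennreal ((norm (tf_shift (X n, 0) f t - f t))\<^sup>2) \<le> 2 * ennreal (norm (F (t - X n) - F t))"
          by (subst ennreal_numeral[symmetric], subst ennreal_mult[symmetric]) (auto intro: ennreal_leI)
      qed
      also have "\<dots> = 2 * shift_diff F (X n)"
        unfolding shift_diff_def by (intro nn_integral_cmult) (auto simp: F_def[abs_def])
      finally show ?thesis .
    qed
    then show "\<forall>\<^sub>F n in sequentially. (\<integral>\<^sup>+t. ennreal ((norm (tf_shift (X n, 0) f t - f t))\<^sup>2) \<partial>lborel) \<le> 2 * shift_diff F (X n)"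
      by simp
  qed simp
qed (use f in \<open>auto intro!: L2_diff tf_shift_L2\<close>)

lemma L2_modulation_continuous_0:
  assumes f: "f \<in> L2" and X: "X \<longlonglongrightarrow> 0"
  shows "(\<lambda>n. L2_norm (\<lambda>t. tf_shift (0, X n) f t - f t)) \<longlonglongrightarrow> 0"
proof (rule L2_norm_tendsto_0)
  have [measurable]: "f \<in> borel_measurable borel" using f by measurable
  have "(\<lambda>n. \<integral>\<^sup>+t. ennreal ((norm (tf_shift (0, X n) f t - f t))\<^sup>2) \<partial>lborel) \<longlonglongrightarrow> (\<integral>\<^sup>+t. 0 \<partial>(lborel :: (real^'a) measure))"
  proof (rule nn_integral_dominated_convergence[where w = "\<lambda>t. 4 * ennreal ((norm (f t))\<^sup>2)"])
    show "AE t in lborel. (\<lambda>n. ennreal ((norm (tf_shift (0, X n) f t - f t))\<^sup>2)) \<longlonglongrightarrow> 0"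
    proof (intro always_eventually allI)
      fix t
      have "(\<lambda>n. ennreal ((norm (phase (X n \<bullet> t) * f t - f t))\<^sup>2)) \<longlonglongrightarrow> ennreal ((norm (phase (0 \<bullet> t) * f t - f t))\<^sup>2)"
        by (intro tendsto_ennrealI tendsto_intros X)
      then show "(\<lambda>n. ennreal ((norm (tf_shift (0, X n) f t - f t))\<^sup>2)) \<longlonglongrightarrow> 0" by (simp add: tf_shift_apply)
    qed
    show "AE t in lborel. ennreal ((norm (tf_shift (0, X n) f t - f t))\<^sup>2) \<le> 4 * ennreal ((norm (f t))\<^sup>2)" for n
    proof (intro always_eventually allI)
      fix t
      have "norm (tf_shift (0, X n) f t - f t) \<le> norm (tf_shift (0, X n) f t) + norm (f t)" by norm
      also have "\<dots> = 2 * norm (f t)" by (simp add: tf_shift_apply norm_mult)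
      finally have "(norm (tf_shift (0, X n) f t - f t))\<^sup>2 \<le> (2 * norm (f t))\<^sup>2" by (intro power_mono) auto
      then show "ennreal ((norm (tf_shift (0, X n) f t - f t))\<^sup>2) \<le> 4 * ennreal ((norm (f t))\<^sup>2)"
        by (subst ennreal_numeral[symmetric], subst ennreal_mult[symmetric]) (auto intro!: ennreal_leI simp: power_mult_distrib)
    qed
    show "(\<integral>\<^sup>+t. 4 * ennreal ((norm (f t))\<^sup>2) \<partial>lborel) < \<infinity>"
      using f by (subst nn_integral_cmult) (auto simp: L2_nn_integral ennreal_mult_less_top)
  qed auto
  then show "(\<lambda>n. \<integral>\<^sup>+t. ennreal ((norm (tf_shift (0, X n) f t - f t))\<^sup>2) \<partial>lborel) \<longlonglongrightarrow> 0" by simp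
qed (use f in \<open>auto intro!: L2_diff tf_shift_L2\<close>)

lemma L2_norm_diff_commute: "L2_norm (\<lambda>t. f t - g t) = L2_norm (\<lambda>t. g t - f t)"
  by (simp add: Lp_norm_def norm_minus_commute)

lemma tf_shift_continuous_0:
  assumes f: "f \<in> L2" and X: "X \<longlonglongrightarrow> 0"
  shows "(\<lambda>n. L2_norm (\<lambda>t. tf_shift (X n) f t - f t)) \<longlonglongrightarrow> 0"
proof -
  have X1: "(\<lambda>n. fst (X n)) \<longlonglongrightarrow> 0" and X2: "(\<lambda>n. snd (X n)) \<longlonglongrightarrow> 0"
    using tendsto_fst[OF X] tendsto_snd[OF X] by auto
  have le: "L2_norm (\<lambda>t. tf_shift (X n) f t - f t) \<le>
     L2_norm (\<lambda>t. tf_shift (fst (X n), 0) f t - f t) + L2_norm (\<lambda>t. tf_shift (0, snd (X n)) f t - f t)" for n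
  proof -
    have e: "(\<lambda>t. tf_shift (X n) f t - f t) =
       (\<lambda>t. tf_shift (0, snd (X n)) (\<lambda>t. tf_shift (fst (X n), 0) f t - f t) t + (tf_shift (0, snd (X n)) f t - f t))"
      by (simp add: fun_eq_iff tf_shift_apply algebra_simps)
    show ?thesis unfolding e
      using L2_norm_add[of "tf_shift (0, snd (X n)) (\<lambda>t. tf_shift (fst (X n), 0) f t - f t)" "\<lambda>t. tf_shift (0, snd (X n)) f t - f t"] f
      by (simp add: tf_shift_L2 tf_shift_L2_norm L2_diff)
  qed
  show ?thesis
  proof (rule tendsto_sandwich[OF _ _ tendsto_const])
    show "(\<lambda>n. L2_norm (\<lambda>t. tf_shift (fst (X n), 0) f t - f t) + L2_norm (\<lambda>t. tf_shift (0, snd (X n)) f t - f t)) \<longlonglongrightarrow> 0"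
      using tendsto_add[OF L2_translation_continuous_0[OF f X1] L2_modulation_continuous_0[OF f X2]] by simp
  qed (auto simp: le L2_norm_nonneg)
qed

text \<open>Continuity of shifts is known at the origin, so g is shifted by X n - z and tested
  against \<open>tf_shift (- z) f\<close>. Covariance makes the value
  \<open>STFT f g (- X n)\<close> up to a phase that converges to 1, and exchanging the roles of f
  and g gives the claim.\<close>

lemma STFT_continuous:
  assumes f: "f \<in> L2" and g: "g \<in> L2"
  shows "continuous_on UNIV (STFT g f)"
  unfolding continuous_on_sequentially comp_def
proof (intro allI ballI impI)
  fix X :: "nat \<Rightarrow> (real^'a) \<times> (real^'a)" and z assume "(\<forall>n. X n \<in> UNIV) \<and> X \<longlonglongrightarrow> z"
  then have X: "X \<longlonglongrightarrow> z" by simp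
  then have "(\<lambda>n. X n - z) \<longlonglongrightarrow> 0" by (simp add: LIM_zero)
  note l = tf_shift_continuous_0[OF g this]
  have "(\<lambda>n. L2_inner (tf_shift (X n - z) g) (tf_shift (- z) f)) \<longlonglongrightarrow> L2_inner g (tf_shift (- z) f)"
    by (rule L2_inner_tendsto[OF _ g _ l]) (auto intro: tf_shift_L2 f g)
  then have l2: "(\<lambda>n. phase (snd (X n) \<bullet> fst (X n - z)) * STFT f g (- X n)) \<longlonglongrightarrow> phase 0 * STFT f g (- z)"
    unfolding L2_inner_tf_shifts[OF g f] by (simp add: STFT_eq[of f g "- z"] algebra_simps)
  have "(\<lambda>n. phase (- (snd (X n) \<bullet> fst (X n - z))) * (phase (snd (X n) \<bullet> fst (X n - z)) * STFT f g (- X n))) \<longlonglongrightarrow> phase (- (snd z \<bullet> fst (z - z))) * (phase 0 * STFT f g (- z))"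
    by (intro tendsto_mult l2 tendsto_phase tendsto_minus tendsto_inner tendsto_snd tendsto_fst tendsto_diff X tendsto_const)
  then have l3: "(\<lambda>n. STFT f g (- X n)) \<longlonglongrightarrow> STFT f g (- z)" by (simp add: mult.assoc[symmetric])
  have eq: "STFT g f y = cnj (phase (snd y \<bullet> fst y) * STFT f g (- y))" for y
  proof -
    have "cnj (STFT g f y) = phase (snd y \<bullet> fst y) * STFT f g (- y)"
      using L2_inner_tf_shifts[OF g f, of y 0] by (simp add: STFT_eq[of g f] L2_inner_cnj[of _ f])
    then show ?thesis by (metis complex_cnj_cnj)
  qed
  show "(\<lambda>n. STFT g f (X n)) \<longlonglongrightarrow> STFT g f z"
    unfolding eq by (intro tendsto_intros l3 X)
qed

section \<open>Gaussian summability\<close>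

text \<open>The factor pi matches the convention of \<open>phase\<close>: this Gaussian is its own
  Fourier transform and has integral 1.\<close>

definition gauss :: "'a::euclidean_space \<Rightarrow> real" where
  "gauss t = exp (- pi * (norm t)\<^sup>2)"

lemma gauss_measurable[measurable]: "gauss \<in> borel_measurable borel"
  unfolding gauss_def[abs_def] by measurable

lemma gauss_pos: "0 < gauss t" and gauss_nonneg[simp]: "0 \<le> gauss t" and gauss_0[simp]: "gauss 0 = 1"
  and gauss_le_1: "gauss t \<le> 1"
  by (auto simp: gauss_def)

text \<open>The characteristic function of the standard normal law, rescaled by the square root of 2
  pi.\<close>

lemma gauss_1d:
  fixes a :: real
  shows "(\<integral>s. of_real (exp (- pi * s\<^sup>2)) * phase (- (a * s)) \<partial>lborel) = of_real (exp (- pi * a\<^sup>2))" (is "?I = _")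
    and "integrable lborel (\<lambda>s. of_real (exp (- pi * s\<^sup>2)) * phase (- (a * s)))"
proof -
  define c where "c = sqrt (2 * pi)"
  have c: "c > 0" "c\<^sup>2 = 2 * pi" by (auto simp: c_def)
  define t where "t = - (2 * pi * a) / c"
  let ?g = "\<lambda>x. std_normal_density x *\<^sub>R iexp (t * x)"
  have iexp[measurable]: "(\<lambda>x. iexp (t * x)) \<in> borel_measurable borel"
    by (intro borel_measurable_continuous_onI continuous_intros)
  have g: "\<bar>c\<bar> *\<^sub>R ?g (0 + c * s) = of_real (exp (- pi * s\<^sup>2)) * phase (- (a * s))" for s
  proof -
    have "c * std_normal_density (c * s) = exp (- pi * s\<^sup>2)"
      using c by (simp add: std_normal_density_def power_mult_distrib c_def)
    moreover have "iexp (t * (c * s)) = phase (- (a * s))"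
      using c by (simp add: t_def phase_def cis_conv_exp algebra_simps)
    ultimately show ?thesis using c by (simp add: scaleR_conv_of_real mult.assoc[symmetric] flip: of_real_mult)
  qed
  have "complex_of_real (exp (- (t^2) / 2)) = (\<integral>x. iexp (t * x) \<partial>std_normal_distribution)"
    using char_std_normal_distribution by (auto simp: fun_eq_iff char_def)
  also have "\<dots> = (\<integral>x. ?g x \<partial>lborel)"
    by (subst integral_density) auto
  also have "\<dots> = \<bar>c\<bar> *\<^sub>R (\<integral>s. ?g (0 + c * s) \<partial>lborel)"
    using c by (intro lborel_integral_real_affine) auto
  also have "\<dots> = ?I"
    by (subst integral_scaleR_right[symmetric]) (simp only: g)
  also have "- (t\<^sup>2) / 2 = - pi * a\<^sup>2"
    using c by (simp add: t_def power_divide power_mult_distrib power2_eq_square[of pi])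
  finally show "?I = of_real (exp (- pi * a\<^sup>2))" by simp
  have "integrable lborel std_normal_density" by simp
  then have "integrable lborel ?g"
    by (rule Bochner_Integration.integrable_bound) (auto simp: norm_mult)
  then have "integrable lborel (\<lambda>s. ?g (0 + c * s))"
    using c by (intro lborel_integrable_real_affine) auto
  then have "integrable lborel (\<lambda>s. \<bar>c\<bar> *\<^sub>R ?g (0 + c * s))" by (rule integrable_scaleR_right)
  then show "integrable lborel (\<lambda>s. of_real (exp (- pi * s\<^sup>2)) * phase (- (a * s)))" by (simp only: g)
qed

lemma phase_sum: "phase (\<Sum>i\<in>A. f i) = (\<Prod>i\<in>A. phase (f i))"
  by (induction A rule: infinite_finite_induct) (auto simp: phase_add)

lemma gauss_eq_prod: "gauss (t :: 'a::euclidean_space) = (\<Prod>b\<in>Basis. exp (- pi * (t \<bullet> b)\<^sup>2))"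
proof -
  have "(norm t)\<^sup>2 = (\<Sum>b\<in>Basis. (t \<bullet> b)\<^sup>2)"
    by (subst power2_norm_eq_inner, subst euclidean_inner) (simp add: power2_eq_square)
  then show ?thesis by (simp add: gauss_def exp_sum[symmetric] sum_negf sum_distrib_left)
qed

text \<open>Lebesgue measure is the image of the product measure over \<open>Basis\<close>, on which
  the integrand is a product of one-dimensional ones.\<close>

lemma gauss_Fourier:
  fixes a :: "'a::euclidean_space"
  shows "(\<integral>t. of_real (gauss t) * phase (- (a \<bullet> t)) \<partial>lborel) = of_real (gauss a)"
    and "integrable lborel (\<lambda>t. of_real (gauss t) * phase (- (a \<bullet> t)))"
proof -
  interpret product_sigma_finite "\<lambda>_::'a. lborel :: real measure" by standard
  let ?h = "\<lambda>b s. of_real (exp (- pi * s\<^sup>2)) * phase (- ((a \<bullet> b) * s))"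
  let ?T = "\<lambda>f. (\<Sum>b\<in>Basis. f b *\<^sub>R b) :: 'a"
  let ?P = "\<Pi>\<^sub>M b\<in>(Basis::'a set). (lborel :: real measure)"
  have split: "of_real (gauss t) * phase (- (a \<bullet> t)) = (\<Prod>b\<in>Basis. ?h b (t \<bullet> b))" for t
  proof -
    have "gauss t = (\<Prod>b\<in>Basis. exp (- pi * (t \<bullet> b)\<^sup>2))"
      by (rule gauss_eq_prod)
    moreover have "phase (- (a \<bullet> t)) = (\<Prod>b\<in>Basis. phase (- ((a \<bullet> b) * (t \<bullet> b))))"
      by (simp add: euclidean_inner[of a t] phase_sum[symmetric] sum_negf)
    ultimately show ?thesis by (simp add: prod.distrib)
  qed
  have T[measurable]: "?T \<in> ?P \<rightarrow>\<^sub>M borel" by measurable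
  have eq: "of_real (gauss (?T f)) * phase (- (a \<bullet> ?T f)) = (\<Prod>b\<in>Basis. ?h b (f b))" for f
    unfolding split by (intro prod.cong) (auto simp: inner_sum_left_Basis)
  have meas: "(\<lambda>t. of_real (gauss t) * phase (- (a \<bullet> t))) \<in> borel_measurable borel" by measurable
  have "(\<integral>t. of_real (gauss t) * phase (- (a \<bullet> t)) \<partial>lborel) = (\<integral>f. (\<Prod>b\<in>Basis. ?h b (f b)) \<partial>?P)"
    by (subst lborel_eq, subst integral_distr[OF T meas]) (simp only: eq)
  also have "\<dots> = (\<Prod>b\<in>Basis. (\<integral>s. ?h b s \<partial>lborel))"
    by (intro product_integral_prod gauss_1d(2)) simp
  also have "\<dots> = (\<Prod>b\<in>Basis. of_real (exp (- pi * (a \<bullet> b)\<^sup>2)))"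
    by (simp only: gauss_1d(1))
  also have "\<dots> = of_real (gauss a)"
    by (simp only: gauss_eq_prod[of a] of_real_prod)
  finally show "(\<integral>t. of_real (gauss t) * phase (- (a \<bullet> t)) \<partial>lborel) = of_real (gauss a)" .
  show "integrable lborel (\<lambda>t. of_real (gauss t) * phase (- (a \<bullet> t)))"
    by (subst lborel_eq, subst integrable_distr_eq[OF T meas])
      (simp only: eq, intro product_integrable_prod gauss_1d(2), simp)
qed

lemma gauss_integrable: "integrable lborel (gauss :: 'a::euclidean_space \<Rightarrow> real)"
proof -
  have "integrable lborel (\<lambda>t::'a. complex_of_real (gauss t))"
    using gauss_Fourier(2)[of "0::'a"] by simp
  from integrable_Re[OF this] show ?thesis by simp
qed

lemma gauss_integral: "(\<integral>t. gauss t \<partial>(lborel :: 'a::euclidean_space measure)) = 1"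
proof -
  have "complex_of_real (\<integral>t. gauss t \<partial>(lborel :: 'a measure)) = 1"
    using gauss_Fourier(1)[of "0::'a"] by (subst integral_complex_of_real[symmetric]) simp
  then show ?thesis by simp
qed

lemma gauss_scale_integrable:
  assumes e: "e \<noteq> 0"
  shows "integrable lborel (\<lambda>t::'a::euclidean_space. gauss (e *\<^sub>R t))"
proof -
  have "(\<integral>\<^sup>+t. ennreal (gauss t) \<partial>(lborel :: 'a measure)) < \<infinity>"
    using gauss_integrable[where 'a='a] by (simp add: integrable_iff_bounded)
  then have "(\<integral>\<^sup>+t. ennreal (gauss (e *\<^sub>R t)) \<partial>(lborel :: 'a measure)) < \<infinity>"
    using nn_integral_lborel_affine[of "\<lambda>t::'a. ennreal (gauss t)" e 0] e
    by (auto simp: ennreal_mult_less_top ennreal_eq_0_iff ennreal_mult_eq_top_iff less_top[symmetric] not_le zero_less_power)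
  then show ?thesis by (simp add: integrable_iff_bounded)
qed

lemma gauss_scale_Fourier:
  fixes a :: "'a::euclidean_space"
  assumes e: "0 < e"
  shows "(\<integral>t. of_real (gauss (e *\<^sub>R t)) * phase (- (t \<bullet> a)) \<partial>lborel) = of_real (gauss (a /\<^sub>R e) / e ^ DIM('a))"
proof -
  have "complex_of_real (gauss (a /\<^sub>R e)) = (\<integral>t. of_real (gauss t) * phase (- ((a /\<^sub>R e) \<bullet> t)) \<partial>lborel)"
    by (rule gauss_Fourier(1)[symmetric])
  also have "\<dots> = \<bar>e\<bar> ^ DIM('a) *\<^sub>R (\<integral>t. of_real (gauss (0 + e *\<^sub>R t)) * phase (- ((a /\<^sub>R e) \<bullet> (0 + e *\<^sub>R t))) \<partial>lborel)"
    using e by (intro integral_lborel_affine) auto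
  finally show ?thesis
    using e by (simp add: inner_commute field_simps scaleR_conv_of_real)
qed

text \<open>Rescaling moves e n from the kernel into the argument of F; boundedness of F and
  continuity at 0 then give dominated convergence with respect to a fixed Gaussian.\<close>

lemma gauss_approximate_identity:
  fixes F :: "'a::euclidean_space \<Rightarrow> complex"
  assumes [measurable]: "F \<in> borel_measurable borel" and B: "\<And>x. norm (F x) \<le> B"
    and cont: "\<And>X. X \<longlonglongrightarrow> 0 \<Longrightarrow> (\<lambda>n. F (X n)) \<longlonglongrightarrow> F 0"
    and e: "\<And>n. 0 < e n" "e \<longlonglongrightarrow> 0"
  shows "(\<lambda>n. \<integral>t. of_real (gauss (t /\<^sub>R e n) / e n ^ DIM('a)) * F t \<partial>lborel) \<longlonglongrightarrow> F 0"
proof -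
  have eq: "(\<integral>t. of_real (gauss (t /\<^sub>R e n) / e n ^ DIM('a)) * F t \<partial>lborel) = (\<integral>t. of_real (gauss t) * F (e n *\<^sub>R t) \<partial>lborel)" for n
  proof -
    have "(\<integral>t. of_real (gauss (t /\<^sub>R e n) / e n ^ DIM('a)) * F t \<partial>lborel) =
      \<bar>e n\<bar> ^ DIM('a) *\<^sub>R (\<integral>t. of_real (gauss ((0 + e n *\<^sub>R t) /\<^sub>R e n) / e n ^ DIM('a)) * F (0 + e n *\<^sub>R t) \<partial>lborel)"
      using e(1)[of n] by (intro integral_lborel_affine) auto
    also have "\<dots> = (\<integral>t. \<bar>e n\<bar> ^ DIM('a) *\<^sub>R (of_real (gauss ((0 + e n *\<^sub>R t) /\<^sub>R e n) / e n ^ DIM('a)) * F (0 + e n *\<^sub>R t)) \<partial>lborel)"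
      by simp
    also have "\<dots> = (\<integral>t. of_real (gauss t) * F (e n *\<^sub>R t) \<partial>lborel)"
      using e(1)[of n] by (intro Bochner_Integration.integral_cong) (auto simp: scaleR_conv_of_real field_simps)
    finally show ?thesis .
  qed
  have "(\<lambda>n. \<integral>t. of_real (gauss t) * F (e n *\<^sub>R t) \<partial>lborel) \<longlonglongrightarrow> (\<integral>t. of_real (gauss t) * F 0 \<partial>(lborel::'a measure))"
  proof (rule integral_dominated_convergence[where w = "\<lambda>t. gauss t * B"])
    show "integrable lborel (\<lambda>t::'a. gauss t * B)" by (intro integrable_mult_left gauss_integrable)
    show "AE t in lborel. (\<lambda>n. complex_of_real (gauss t) * F (e n *\<^sub>R t)) \<longlonglongrightarrow> complex_of_real (gauss t) * F 0"
    proof (intro always_eventually allI tendsto_mult tendsto_const cont)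
      show "(\<lambda>n. e n *\<^sub>R t) \<longlonglongrightarrow> 0" for t :: 'a using tendsto_scaleR[OF e(2) tendsto_const[of t]] by simp
    qed
  qed (auto simp: norm_mult intro!: mult_left_mono B)
  also have "(\<integral>t. of_real (gauss t) * F 0 \<partial>(lborel::'a measure)) = F 0"
    using gauss_integrable[where 'a='a] gauss_integral[where 'a='a] by (simp add: integral_complex_of_real)
  finally show ?thesis unfolding eq .
qed

lemma integrable_pair_mult:
  fixes f :: "'a::euclidean_space \<Rightarrow> complex" and g :: "'b::euclidean_space \<Rightarrow> complex"
  assumes f: "integrable lborel f" and g: "integrable lborel g"
  shows "integrable (lborel \<Otimes>\<^sub>M lborel) (\<lambda>(x, y). f x * g y)"
proof (rule integrableI_bounded)
  have [measurable]: "f \<in> borel_measurable borel" "g \<in> borel_measurable borel"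
    using f g borel_measurable_integrable by fastforce+
  show "(\<lambda>(x, y). f x * g y) \<in> borel_measurable (lborel \<Otimes>\<^sub>M lborel)" by measurable
  have "(\<integral>\<^sup>+z. ennreal (norm (case z of (x, y) \<Rightarrow> f x * g y)) \<partial>(lborel \<Otimes>\<^sub>M lborel)) =
     (\<integral>\<^sup>+x. (\<integral>\<^sup>+y. ennreal (norm (f x)) * ennreal (norm (g y)) \<partial>lborel) \<partial>lborel)"
    by (subst lborel.nn_integral_fst[symmetric]) (auto simp: norm_mult ennreal_mult)
  also have "\<dots> = (\<integral>\<^sup>+x. ennreal (norm (f x)) \<partial>lborel) * (\<integral>\<^sup>+y. ennreal (norm (g y)) \<partial>lborel)"
    by (simp add: nn_integral_cmult nn_integral_multc)
  also have "\<dots> < \<infinity>" using f g by (simp add: integrable_iff_bounded ennreal_mult_less_top)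
  finally show "(\<integral>\<^sup>+z. ennreal (norm (case z of (x, y) \<Rightarrow> f x * g y)) \<partial>(lborel \<Otimes>\<^sub>M lborel)) < \<infinity>" .
qed

text \<open>Tonelli, integrating in x first, where translation invariance separates the two
  factors.\<close>

lemma convolution_pair_integrable:
  fixes \<phi> \<psi> :: "'a::euclidean_space \<Rightarrow> complex"
  assumes \<phi>: "integrable lborel \<phi>" and \<psi>: "integrable lborel \<psi>"
  shows "integrable (lborel \<Otimes>\<^sub>M lborel) (\<lambda>(x, t). \<phi> t * \<psi> (t - x))"
    "integrable (lborel \<Otimes>\<^sub>M lborel) (\<lambda>(x, t). \<phi> t * \<psi> (t + x))"
    "(\<integral>x. (\<integral>t. \<phi> t * \<psi> (t - x) \<partial>lborel) \<partial>lborel) = (\<integral>t. \<phi> t \<partial>lborel) * (\<integral>t. \<psi> t \<partial>lborel)"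
    "(\<integral>\<^sup>+x. (\<integral>\<^sup>+t. ennreal (norm (\<phi> t * \<psi> (t - x))) \<partial>lborel) \<partial>lborel) =
       (\<integral>\<^sup>+t. ennreal (norm (\<phi> t)) \<partial>lborel) * (\<integral>\<^sup>+t. ennreal (norm (\<psi> t)) \<partial>lborel)"
proof -
  have [measurable]: "\<phi> \<in> borel_measurable borel" "\<psi> \<in> borel_measurable borel"
    using \<phi> \<psi> borel_measurable_integrable by fastforce+
  have fin: "(\<integral>\<^sup>+t. ennreal (norm (\<phi> t)) \<partial>lborel) * (\<integral>\<^sup>+t. ennreal (norm (\<psi> t)) \<partial>lborel) < \<infinity>"
    using \<phi> \<psi> by (simp add: integrable_iff_bounded ennreal_mult_less_top)
  have a: "(\<integral>\<^sup>+t. (\<integral>\<^sup>+x. ennreal (norm (\<phi> t * \<psi> (t - x))) \<partial>lborel) \<partial>lborel) =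
       (\<integral>\<^sup>+t. ennreal (norm (\<phi> t)) \<partial>lborel) * (\<integral>\<^sup>+t. ennreal (norm (\<psi> t)) \<partial>lborel)"
    using nn_integral_lborel_shift(3)[of "\<lambda>t. ennreal (norm (\<psi> t))"]
    by (simp add: norm_mult ennreal_mult nn_integral_cmult nn_integral_multc)
  have b: "(\<integral>\<^sup>+t. (\<integral>\<^sup>+x. ennreal (norm (\<phi> t * \<psi> (t + x))) \<partial>lborel) \<partial>lborel) =
       (\<integral>\<^sup>+t. ennreal (norm (\<phi> t)) \<partial>lborel) * (\<integral>\<^sup>+t. ennreal (norm (\<psi> t)) \<partial>lborel)"
    using nn_integral_lborel_shift(1)[of "\<lambda>t. ennreal (norm (\<psi> t))"]
    by (simp add: norm_mult ennreal_mult nn_integral_cmult nn_integral_multc add.commute)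
  show i1: "integrable (lborel \<Otimes>\<^sub>M lborel) (\<lambda>(x, t). \<phi> t * \<psi> (t - x))"
  proof (rule integrableI_bounded)
    have "(\<integral>\<^sup>+z. ennreal (norm (case z of (x, t) \<Rightarrow> \<phi> t * \<psi> (t - x))) \<partial>(lborel \<Otimes>\<^sub>M lborel)) =
       (\<integral>\<^sup>+t. (\<integral>\<^sup>+x. ennreal (norm (\<phi> t * \<psi> (t - x))) \<partial>lborel) \<partial>lborel)"
      by (subst lborel_pair.nn_integral_snd[symmetric]) auto
    then show "(\<integral>\<^sup>+z. ennreal (norm (case z of (x, t) \<Rightarrow> \<phi> t * \<psi> (t - x))) \<partial>(lborel \<Otimes>\<^sub>M lborel)) < \<infinity>"
      using a fin by simp
  qed measurable
  show "integrable (lborel \<Otimes>\<^sub>M lborel) (\<lambda>(x, t). \<phi> t * \<psi> (t + x))"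
  proof (rule integrableI_bounded)
    have "(\<integral>\<^sup>+z. ennreal (norm (case z of (x, t) \<Rightarrow> \<phi> t * \<psi> (t + x))) \<partial>(lborel \<Otimes>\<^sub>M lborel)) =
       (\<integral>\<^sup>+t. (\<integral>\<^sup>+x. ennreal (norm (\<phi> t * \<psi> (t + x))) \<partial>lborel) \<partial>lborel)"
      by (subst lborel_pair.nn_integral_snd[symmetric]) auto
    then show "(\<integral>\<^sup>+z. ennreal (norm (case z of (x, t) \<Rightarrow> \<phi> t * \<psi> (t + x))) \<partial>(lborel \<Otimes>\<^sub>M lborel)) < \<infinity>"
      using b fin by simp
  qed measurable
  have "(\<integral>x. (\<integral>t. \<phi> t * \<psi> (t - x) \<partial>lborel) \<partial>lborel) = (\<integral>t. (\<integral>x. \<phi> t * \<psi> (t - x) \<partial>lborel) \<partial>lborel)"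
    by (rule lborel_pair.Fubini_integral[symmetric]) (rule i1)
  also have "\<dots> = (\<integral>t. \<phi> t \<partial>lborel) * (\<integral>t. \<psi> t \<partial>lborel)"
    by (simp add: integral_lborel_shift(3))
  finally show "(\<integral>x. (\<integral>t. \<phi> t * \<psi> (t - x) \<partial>lborel) \<partial>lborel) = (\<integral>t. \<phi> t \<partial>lborel) * (\<integral>t. \<psi> t \<partial>lborel)" .
  show "(\<integral>\<^sup>+x. (\<integral>\<^sup>+t. ennreal (norm (\<phi> t * \<psi> (t - x))) \<partial>lborel) \<partial>lborel) =
       (\<integral>\<^sup>+t. ennreal (norm (\<phi> t)) \<partial>lborel) * (\<integral>\<^sup>+t. ennreal (norm (\<psi> t)) \<partial>lborel)"
    unfolding a[symmetric] by (rule lborel_pair.Fubini'[symmetric]) measurable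
qed

text \<open>The transform of p times the conjugate transform of q is the transform of the
  cross-correlation r; Fubini then moves the transform onto G. For merely integrable p and q this
  takes the place of Plancherel's theorem, G providing the integrability in \<omega>.\<close>

lemma Fourier_product_correlation:
  fixes p q G :: "'a::euclidean_space \<Rightarrow> complex"
  assumes p: "integrable lborel p" and q: "integrable lborel q" and G: "integrable lborel G"
  defines "r \<equiv> \<lambda>\<tau>. \<integral>t. p (t + \<tau>) * cnj (q t) \<partial>lborel"
  shows "(\<integral>\<omega>. G \<omega> * ((\<integral>t. p t * phase (- (\<omega> \<bullet> t)) \<partial>lborel) * cnj (\<integral>t. q t * phase (- (\<omega> \<bullet> t)) \<partial>lborel)) \<partial>lborel) =
     (\<integral>\<tau>. (\<integral>\<omega>. G \<omega> * phase (- (\<omega> \<bullet> \<tau>)) \<partial>lborel) * r \<tau> \<partial>lborel)"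
proof -
  have [measurable]: "p \<in> borel_measurable borel" "q \<in> borel_measurable borel" "G \<in> borel_measurable borel"
    using p q G borel_measurable_integrable by fastforce+
  have cq: "integrable lborel (\<lambda>t. cnj (q t))" using q by simp
  note pair = convolution_pair_integrable(2)[OF cq p]
  have r: "integrable lborel r"
    using lborel_pair.integrable_fst[OF pair] by (simp add: r_def mult.commute)
  then have [measurable]: "r \<in> borel_measurable borel" using borel_measurable_integrable by fastforce
  have r_hat: "(\<integral>t. p t * phase (- (\<omega> \<bullet> t)) \<partial>lborel) * cnj (\<integral>t. q t * phase (- (\<omega> \<bullet> t)) \<partial>lborel) =
     (\<integral>\<tau>. phase (- (\<omega> \<bullet> \<tau>)) * r \<tau> \<partial>lborel)" for \<omega>
  proof -
    have int: "integrable (lborel \<Otimes>\<^sub>M lborel) (\<lambda>(\<tau>, t). phase (- (\<omega> \<bullet> \<tau>)) * (p (t + \<tau>) * cnj (q t)))"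
      by (rule Bochner_Integration.integrable_bound[OF pair]) (auto simp: norm_mult mult.commute split_beta')
    have "(\<integral>\<tau>. phase (- (\<omega> \<bullet> \<tau>)) * r \<tau> \<partial>lborel) = (\<integral>\<tau>. (\<integral>t. phase (- (\<omega> \<bullet> \<tau>)) * (p (t + \<tau>) * cnj (q t)) \<partial>lborel) \<partial>lborel)"
      by (simp add: r_def)
    also have "\<dots> = (\<integral>t. (\<integral>\<tau>. phase (- (\<omega> \<bullet> \<tau>)) * (p (t + \<tau>) * cnj (q t)) \<partial>lborel) \<partial>lborel)"
      by (rule lborel_pair.Fubini_integral[symmetric]) (rule int)
    also have "\<dots> = (\<integral>t. cnj (q t * phase (- (\<omega> \<bullet> t))) * (\<integral>t. p t * phase (- (\<omega> \<bullet> t)) \<partial>lborel) \<partial>lborel)"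
    proof (intro Bochner_Integration.integral_cong refl)
      fix t
      have ph: "phase (- (\<omega> \<bullet> \<tau>)) = phase (\<omega> \<bullet> t) * phase (- (\<omega> \<bullet> (\<tau> + t)))" for \<tau>
        by (simp flip: phase_add add: inner_add_right)
      have "(\<integral>\<tau>. phase (- (\<omega> \<bullet> \<tau>)) * (p (t + \<tau>) * cnj (q t)) \<partial>lborel) =
         (\<integral>\<tau>. cnj (q t) * phase (\<omega> \<bullet> t) * (p (\<tau> + t) * phase (- (\<omega> \<bullet> (\<tau> + t)))) \<partial>lborel)"
      proof (intro Bochner_Integration.integral_cong refl)
        show "phase (- (\<omega> \<bullet> \<tau>)) * (p (t + \<tau>) * cnj (q t)) = cnj (q t) * phase (\<omega> \<bullet> t) * (p (\<tau> + t) * phase (- (\<omega> \<bullet> (\<tau> + t))))" for \<tau>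
          by (subst ph[of \<tau>]) (simp only: add.commute[of t \<tau>] mult_ac)
      qed
      also have "\<dots> = cnj (q t) * phase (\<omega> \<bullet> t) * (\<integral>\<tau>. p (\<tau> + t) * phase (- (\<omega> \<bullet> (\<tau> + t))) \<partial>lborel)"
        by simp
      also have "(\<integral>\<tau>. p (\<tau> + t) * phase (- (\<omega> \<bullet> (\<tau> + t))) \<partial>lborel) = (\<integral>t. p t * phase (- (\<omega> \<bullet> t)) \<partial>lborel)"
        by (rule integral_lborel_shift(1)) measurable
      finally show "(\<integral>\<tau>. phase (- (\<omega> \<bullet> \<tau>)) * (p (t + \<tau>) * cnj (q t)) \<partial>lborel) =
         cnj (q t * phase (- (\<omega> \<bullet> t))) * (\<integral>t. p t * phase (- (\<omega> \<bullet> t)) \<partial>lborel)"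
        by (simp add: phase_cnj)
    qed
    also have "\<dots> = (\<integral>t. cnj (q t * phase (- (\<omega> \<bullet> t))) \<partial>lborel) * (\<integral>t. p t * phase (- (\<omega> \<bullet> t)) \<partial>lborel)"
      by (rule integral_mult_left_zero)
    also have "(\<integral>t. cnj (q t * phase (- (\<omega> \<bullet> t))) \<partial>lborel) = cnj (\<integral>t. q t * phase (- (\<omega> \<bullet> t)) \<partial>lborel)"
      by (rule Bochner_Integration.integral_cnj)
    finally show ?thesis by (simp add: mult.commute)
  qed
  have int2: "integrable (lborel \<Otimes>\<^sub>M lborel) (\<lambda>(\<omega>, \<tau>). G \<omega> * (phase (- (\<omega> \<bullet> \<tau>)) * r \<tau>))"
  proof (rule Bochner_Integration.integrable_bound)
    show "integrable (lborel \<Otimes>\<^sub>M lborel) (\<lambda>(\<omega>, \<tau>). G \<omega> * r \<tau>)"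
      by (rule integrable_pair_mult[OF G r])
  qed (auto simp: norm_mult)
  have "(\<integral>\<omega>. G \<omega> * (\<integral>\<tau>. phase (- (\<omega> \<bullet> \<tau>)) * r \<tau> \<partial>lborel) \<partial>lborel) = (\<integral>\<omega>. (\<integral>\<tau>. G \<omega> * (phase (- (\<omega> \<bullet> \<tau>)) * r \<tau>) \<partial>lborel) \<partial>lborel)"
    by simp
  also have "\<dots> = (\<integral>\<tau>. (\<integral>\<omega>. G \<omega> * (phase (- (\<omega> \<bullet> \<tau>)) * r \<tau>) \<partial>lborel) \<partial>lborel)"
    by (rule lborel_pair.Fubini_integral[symmetric]) (rule int2)
  also have "\<dots> = (\<integral>\<tau>. (\<integral>\<omega>. G \<omega> * phase (- (\<omega> \<bullet> \<tau>)) \<partial>lborel) * r \<tau> \<partial>lborel)"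
    by (simp add: mult.assoc[symmetric])
  finally show ?thesis by (simp add: r_hat)
qed

section \<open>Moyal's identity\<close>

lemma tf_shift_minus_fst: "tf_shift (- \<tau>, 0) f t = f (t + \<tau>)"
  by (simp add: tf_shift_apply)

lemma gauss_snd_measurable[measurable]: "(\<lambda>z. gauss (e *\<^sub>R snd z)) \<in> borel_measurable borel"
  unfolding gauss_def by (intro borel_measurable_continuous_onI continuous_intros)

lemma STFT_Fourier: "STFT g f (x, \<omega>) = (\<integral>t. (f t * cnj (g (t - x))) * phase (- (\<omega> \<bullet> t)) \<partial>lborel)"
  by (simp add: STFT_eq L2_inner_def tf_shift_apply phase_cnj mult_ac)

lemma L2_cross_correlation_tendsto:
  assumes "f \<in> L2" "g \<in> L2" "X \<longlonglongrightarrow> 0"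
  shows "(\<lambda>n. L2_inner (tf_shift (- X n, 0) f) g) \<longlonglongrightarrow> L2_inner f g"
proof (rule L2_inner_tendsto)
  have "(\<lambda>n. (- X n, 0 :: real^'a)) \<longlonglongrightarrow> (- 0, 0)" by (intro tendsto_intros assms)
  then show "(\<lambda>n. L2_norm (\<lambda>t. tf_shift (- X n, 0) f t - f t)) \<longlonglongrightarrow> 0"
    by (intro tf_shift_continuous_0 assms) (simp add: zero_prod_def)
qed (auto intro: assms tf_shift_L2)

text \<open>For fixed x both transforms are Fourier transforms in \<omega> of integrable products of
  f and a conjugated translate of g. The Gaussian in \<omega> turns the inner integral into a
  Gaussian average over the lag \<tau> of a correlation r x \<tau>, and the integral of r over x
  factors into a correlation of f1, f2 times one of g1, g2.\<close>

lemma STFT_product_regularised: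
  fixes f1 g1 f2 g2 :: "real^'d \<Rightarrow> complex"
  assumes f1: "f1 \<in> L2" and g1: "g1 \<in> L2" and f2: "f2 \<in> L2" and g2: "g2 \<in> L2"
    and V1: "integrable lborel (STFT g1 f1)" and e: "0 < e"
  shows "(\<integral>z. of_real (gauss (e *\<^sub>R snd z)) * (STFT g1 f1 z * cnj (STFT g2 f2 z)) \<partial>lborel) =
    (\<integral>\<tau>. of_real (gauss (\<tau> /\<^sub>R e) / e ^ DIM(real^'d)) *
       (L2_inner (tf_shift (- \<tau>, 0) f1) f2 * cnj (L2_inner (tf_shift (- \<tau>, 0) g1) g2)) \<partial>(lborel :: (real^'d) measure))"
proof -
  have [measurable]: "f1 \<in> borel_measurable borel" "g1 \<in> borel_measurable borel" "f2 \<in> borel_measurable borel" "g2 \<in> borel_measurable borel"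
    using assms by measurable
  have [measurable]: "STFT g1 f1 \<in> borel_measurable borel" "STFT g2 f2 \<in> borel_measurable borel"
    using assms by (auto intro: STFT_measurable)
  define k where "k \<tau> = complex_of_real (gauss (\<tau> /\<^sub>R e) / e ^ DIM(real^'d))" for \<tau> :: "real^'d"
  have [measurable]: "k \<in> borel_measurable borel" unfolding k_def by measurable
  have k: "(\<integral>\<omega>. of_real (gauss (e *\<^sub>R \<omega>)) * phase (- (\<omega> \<bullet> \<tau>)) \<partial>lborel) = k \<tau>" for \<tau>
    using gauss_scale_Fourier[OF e, of \<tau>] by (simp add: k_def)
  have k_int: "integrable lborel k"
    using gauss_scale_integrable[of "inverse e", where 'a="real^'d"] e
    unfolding k_def by (intro integrable_of_real integrable_divide) auto
  have G: "integrable lborel (\<lambda>\<omega>::real^'d. complex_of_real (gauss (e *\<^sub>R \<omega>)))"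
    using e by (intro integrable_of_real gauss_scale_integrable) auto
  \<comment> \<open>Regrouping the four factors of the correlation into f1, f2 at t and g1, g2 at t
    - x makes the x-integral of r a product.\<close>
  define \<phi> where "\<phi> \<tau> t = f1 (t + \<tau>) * cnj (f2 t)" for \<tau> t
  define \<psi> where "\<psi> \<tau> y = cnj (g1 (y + \<tau>)) * g2 y" for \<tau> y
  define r where "r x \<tau> = (\<integral>t. \<phi> \<tau> t * \<psi> \<tau> (t - x) \<partial>lborel)" for x \<tau>
  have \<phi>_int: "integrable lborel (\<phi> \<tau>)" for \<tau>
    using L2_cnj_integrable[OF tf_shift_L2[OF f1, of "(- \<tau>, 0)"] f2] by (simp add: \<phi>_def[abs_def] tf_shift_minus_fst)
  have \<psi>_int: "integrable lborel (\<psi> \<tau>)" for \<tau>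
    using L2_cnj_integrable[OF g2 tf_shift_L2[OF g1, of "(- \<tau>, 0)"]] by (simp add: \<psi>_def[abs_def] tf_shift_minus_fst mult.commute)
  have B: "(\<integral>t. \<phi> \<tau> t \<partial>lborel) = L2_inner (tf_shift (- \<tau>, 0) f1) f2" for \<tau>
    by (simp add: \<phi>_def[abs_def] L2_inner_def tf_shift_minus_fst)
  have A: "(\<integral>t. \<psi> \<tau> t \<partial>lborel) = cnj (L2_inner (tf_shift (- \<tau>, 0) g1) g2)" for \<tau>
    unfolding L2_inner_def by (subst Bochner_Integration.integral_cnj[symmetric]) (simp add: \<psi>_def[abs_def] tf_shift_minus_fst)
  have r_meas[measurable]: "(\<lambda>(x, \<tau>). r x \<tau>) \<in> borel_measurable (borel \<Otimes>\<^sub>M borel)"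
    unfolding r_def \<phi>_def \<psi>_def by measurable
  let ?c = "L2_norm f1 * L2_norm f2 * (L2_norm g1 * L2_norm g2)"
  \<comment> \<open>Uniform in \<tau>: together with the integrable Gaussian k this licenses the
    exchange of x and \<tau>.\<close>
  have r_bound: "(\<integral>\<^sup>+x. ennreal (norm (r x \<tau>)) \<partial>lborel) \<le> ennreal ?c" for \<tau>
  proof -
    have [measurable]: "\<phi> \<tau> \<in> borel_measurable borel" "\<psi> \<tau> \<in> borel_measurable borel" unfolding \<phi>_def \<psi>_def by measurable
    have "(\<integral>\<^sup>+x. ennreal (norm (r x \<tau>)) \<partial>lborel) \<le> (\<integral>\<^sup>+x. (\<integral>\<^sup>+t. ennreal (norm (\<phi> \<tau> t * \<psi> \<tau> (t - x))) \<partial>lborel) \<partial>lborel)"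
      unfolding r_def
    proof (intro nn_integral_mono)
      fix x
      show "ennreal (norm (\<integral>t. \<phi> \<tau> t * \<psi> \<tau> (t - x) \<partial>lborel)) \<le> (\<integral>\<^sup>+t. ennreal (norm (\<phi> \<tau> t * \<psi> \<tau> (t - x))) \<partial>lborel)"
        by (cases "integrable lborel (\<lambda>t. \<phi> \<tau> t * \<psi> \<tau> (t - x))") (auto intro: integral_norm_bound_ennreal simp: not_integrable_integral_eq)
    qed
    also have "\<dots> = (\<integral>\<^sup>+t. ennreal (norm (\<phi> \<tau> t)) \<partial>lborel) * (\<integral>\<^sup>+t. ennreal (norm (\<psi> \<tau> t)) \<partial>lborel)"
      by (rule convolution_pair_integrable(4)[OF \<phi>_int \<psi>_int])
    also have "\<dots> \<le> ennreal (L2_norm f1 * L2_norm f2) * ennreal (L2_norm g1 * L2_norm g2)"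
    proof (rule mult_mono)
      show "(\<integral>\<^sup>+t. ennreal (norm (\<phi> \<tau> t)) \<partial>lborel) \<le> ennreal (L2_norm f1 * L2_norm f2)"
        using L2_cnj_nn_integral[OF tf_shift_L2[OF f1, of "(- \<tau>, 0)"] f2]
        by (simp add: \<phi>_def tf_shift_minus_fst norm_mult tf_shift_L2_norm f1)
      show "(\<integral>\<^sup>+t. ennreal (norm (\<psi> \<tau> t)) \<partial>lborel) \<le> ennreal (L2_norm g1 * L2_norm g2)"
        using L2_cnj_nn_integral[OF tf_shift_L2[OF g1, of "(- \<tau>, 0)"] g2]
        by (simp add: \<psi>_def tf_shift_minus_fst norm_mult tf_shift_L2_norm g1)
    qed auto
    finally show ?thesis by (simp add: ennreal_mult L2_norm_nonneg)
  qed
  have int1: "integrable (lborel \<Otimes>\<^sub>M lborel) (\<lambda>(x, \<omega>). of_real (gauss (e *\<^sub>R \<omega>)) * (STFT g1 f1 (x, \<omega>) * cnj (STFT g2 f2 (x, \<omega>))))"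
    unfolding lborel_prod
  proof (rule Bochner_Integration.integrable_bound)
    show "integrable lborel (\<lambda>z. STFT g1 f1 z * of_real (L2_norm f2 * L2_norm g2))" using V1 by simp
    show "(\<lambda>(x, \<omega>). of_real (gauss (e *\<^sub>R \<omega>)) * (STFT g1 f1 (x, \<omega>) * cnj (STFT g2 f2 (x, \<omega>)))) \<in> borel_measurable lborel"
      unfolding split_beta' prod.collapse by measurable
    have "gauss (e *\<^sub>R \<omega>) * (norm (STFT g1 f1 (x, \<omega>)) * norm (STFT g2 f2 (x, \<omega>))) \<le> 1 * (norm (STFT g1 f1 (x, \<omega>)) * (L2_norm f2 * L2_norm g2))" for x \<omega>
      by (intro mult_mono gauss_le_1 mult_left_mono norm_STFT_bound f2 g2) auto
    then show "AE z in lborel. norm (case z of (x, \<omega>) \<Rightarrow> of_real (gauss (e *\<^sub>R \<omega>)) * (STFT g1 f1 (x, \<omega>) * cnj (STFT g2 f2 (x, \<omega>))))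
         \<le> norm (STFT g1 f1 z * of_real (L2_norm f2 * L2_norm g2))"
      by (auto simp: norm_mult L2_norm_nonneg)
  qed
  have "(\<integral>z. of_real (gauss (e *\<^sub>R snd z)) * (STFT g1 f1 z * cnj (STFT g2 f2 z)) \<partial>lborel) =
     (\<integral>x. (\<integral>\<omega>. of_real (gauss (e *\<^sub>R \<omega>)) * (STFT g1 f1 (x, \<omega>) * cnj (STFT g2 f2 (x, \<omega>))) \<partial>lborel) \<partial>lborel)"
    using lborel_pair.integral_fst'[OF int1] by (simp add: lborel_prod split_beta')
  also have "\<dots> = (\<integral>x. (\<integral>\<tau>. k \<tau> * r x \<tau> \<partial>lborel) \<partial>lborel)"
  proof (rule Bochner_Integration.integral_cong[OF refl])
    fix x
    have p: "integrable lborel (\<lambda>t. f1 t * cnj (g1 (t - x)))"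
      using L2_cnj_integrable[OF f1 tf_shift_L2[OF g1, of "(x, 0)"]] by (simp add: tf_shift_apply)
    have q: "integrable lborel (\<lambda>t. f2 t * cnj (g2 (t - x)))"
      using L2_cnj_integrable[OF f2 tf_shift_L2[OF g2, of "(x, 0)"]] by (simp add: tf_shift_apply)
    have "(\<integral>t. f1 (t + \<tau>) * cnj (g1 (t + \<tau> - x)) * cnj (f2 t * cnj (g2 (t - x))) \<partial>lborel) = r x \<tau>" for \<tau>
      unfolding r_def \<phi>_def \<psi>_def by (intro Bochner_Integration.integral_cong) (simp_all add: algebra_simps)
    then show "(\<integral>\<omega>. of_real (gauss (e *\<^sub>R \<omega>)) * (STFT g1 f1 (x, \<omega>) * cnj (STFT g2 f2 (x, \<omega>))) \<partial>lborel) = (\<integral>\<tau>. k \<tau> * r x \<tau> \<partial>lborel)"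
      unfolding STFT_Fourier Fourier_product_correlation[OF p q G] k by simp
  qed
  also have "\<dots> = (\<integral>\<tau>. (\<integral>x. k \<tau> * r x \<tau> \<partial>lborel) \<partial>lborel)"
  proof (rule lborel_pair.Fubini_integral[symmetric], rule integrableI_bounded)
    have "(\<integral>\<^sup>+z. ennreal (norm (case z of (x, \<tau>) \<Rightarrow> k \<tau> * r x \<tau>)) \<partial>(lborel \<Otimes>\<^sub>M lborel)) =
      (\<integral>\<^sup>+\<tau>. (\<integral>\<^sup>+x. ennreal (norm (k \<tau>)) * ennreal (norm (r x \<tau>)) \<partial>lborel) \<partial>lborel)"
      by (subst lborel_pair.nn_integral_snd[symmetric]) (auto simp: norm_mult ennreal_mult)
    also have "\<dots> = (\<integral>\<^sup>+\<tau>. ennreal (norm (k \<tau>)) * (\<integral>\<^sup>+x. ennreal (norm (r x \<tau>)) \<partial>lborel) \<partial>lborel)"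
      by (intro nn_integral_cong nn_integral_cmult) measurable
    also have "\<dots> \<le> (\<integral>\<^sup>+\<tau>. ennreal (norm (k \<tau>)) * ennreal ?c \<partial>lborel)"
      by (intro nn_integral_mono mult_left_mono r_bound) auto
    also have "\<dots> = (\<integral>\<^sup>+\<tau>. ennreal (norm (k \<tau>)) \<partial>lborel) * ennreal ?c"
      by (rule nn_integral_multc) measurable
    also have "\<dots> < \<infinity>" using k_int by (simp add: integrable_iff_bounded ennreal_mult_less_top)
    finally show "(\<integral>\<^sup>+z. ennreal (norm (case z of (x, \<tau>) \<Rightarrow> k \<tau> * r x \<tau>)) \<partial>(lborel \<Otimes>\<^sub>M lborel)) < \<infinity>" .
  qed measurable
  also have "\<dots> = (\<integral>\<tau>. k \<tau> * (L2_inner (tf_shift (- \<tau>, 0) f1) f2 * cnj (L2_inner (tf_shift (- \<tau>, 0) g1) g2)) \<partial>lborel)"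
    using convolution_pair_integrable(3)[OF \<phi>_int \<psi>_int] by (simp add: r_def A B)
  finally show ?thesis by (simp add: k_def)
qed

text \<open>The Gaussian regularisation is removed by letting e n tend to 0. On the transform side,
  the integrable first transform times a bound for the second dominates. On the other side the
  Gaussian in the lag concentrates at 0, where the correlations become the two inner products.
  Integrability is asked of the first transform, so the second pair ranges over all of
  \<open>L2\<close>; later any shifted window is inserted there.\<close>

theorem Moyal:
  fixes f1 g1 f2 g2 :: "real^'d \<Rightarrow> complex"
  assumes f1: "f1 \<in> L2" and g1: "g1 \<in> L2" and f2: "f2 \<in> L2" and g2: "g2 \<in> L2"
    and V1: "integrable lborel (STFT g1 f1)"
  shows "(\<integral>z. STFT g1 f1 z * cnj (STFT g2 f2 z) \<partial>lborel) = L2_inner f1 f2 * cnj (L2_inner g1 g2)"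
    "integrable lborel (\<lambda>z. STFT g1 f1 z * cnj (STFT g2 f2 z))"
proof -
  have [measurable]: "f1 \<in> borel_measurable borel" "g1 \<in> borel_measurable borel" "f2 \<in> borel_measurable borel" "g2 \<in> borel_measurable borel"
    using assms by measurable
  have [measurable]: "STFT g1 f1 \<in> borel_measurable borel" "STFT g2 f2 \<in> borel_measurable borel"
    using assms by (auto intro: STFT_measurable)
  show "integrable lborel (\<lambda>z. STFT g1 f1 z * cnj (STFT g2 f2 z))"
  proof (rule Bochner_Integration.integrable_bound)
    show "integrable lborel (\<lambda>z. STFT g1 f1 z * of_real (L2_norm f2 * L2_norm g2))" using V1 by simp
    show "AE z in lborel. norm (STFT g1 f1 z * cnj (STFT g2 f2 z)) \<le> norm (STFT g1 f1 z * of_real (L2_norm f2 * L2_norm g2))"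
      by (auto simp: norm_mult L2_norm_nonneg intro!: mult_left_mono norm_STFT_bound f2 g2)
  qed measurable
  define e :: "nat \<Rightarrow> real" where "e n = 1 / (real n + 1)" for n
  have e: "0 < e n" "e \<longlonglongrightarrow> 0" for n
    using LIMSEQ_inverse_real_of_nat by (auto simp: e_def[abs_def] inverse_eq_divide add.commute)
  define F where "F \<tau> = L2_inner (tf_shift (- \<tau>, 0) f1) f2 * cnj (L2_inner (tf_shift (- \<tau>, 0) g1) g2)" for \<tau>
  have "(\<lambda>n. \<integral>z. of_real (gauss (e n *\<^sub>R snd z)) * (STFT g1 f1 z * cnj (STFT g2 f2 z)) \<partial>lborel) \<longlonglongrightarrow>
      (\<integral>z. STFT g1 f1 z * cnj (STFT g2 f2 z) \<partial>lborel)"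
  proof (rule integral_dominated_convergence[where w = "\<lambda>z. norm (STFT g1 f1 z) * (L2_norm f2 * L2_norm g2)"])
    show "integrable lborel (\<lambda>z. norm (STFT g1 f1 z) * (L2_norm f2 * L2_norm g2))"
      using V1 by simp
    show "AE z in lborel. (\<lambda>n. of_real (gauss (e n *\<^sub>R snd z)) * (STFT g1 f1 z * cnj (STFT g2 f2 z))) \<longlonglongrightarrow> STFT g1 f1 z * cnj (STFT g2 f2 z)"
    proof (intro always_eventually allI)
      fix z :: "(real^'d) \<times> (real^'d)"
      have "(\<lambda>n. gauss (e n *\<^sub>R snd z)) \<longlonglongrightarrow> gauss (0 *\<^sub>R snd z)"
        unfolding gauss_def by (intro tendsto_intros e)
      then have "(\<lambda>n. complex_of_real (gauss (e n *\<^sub>R snd z)) * (STFT g1 f1 z * cnj (STFT g2 f2 z))) \<longlonglongrightarrow> of_real (gauss (0 *\<^sub>R snd z)) * (STFT g1 f1 z * cnj (STFT g2 f2 z))"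
        by (intro tendsto_mult tendsto_of_real tendsto_const)
      then show "(\<lambda>n. of_real (gauss (e n *\<^sub>R snd z)) * (STFT g1 f1 z * cnj (STFT g2 f2 z))) \<longlonglongrightarrow> STFT g1 f1 z * cnj (STFT g2 f2 z)" by simp
    qed
    have "gauss (e n *\<^sub>R snd z) * (norm (STFT g1 f1 z) * norm (STFT g2 f2 z)) \<le> 1 * (norm (STFT g1 f1 z) * (L2_norm f2 * L2_norm g2))" for n and z :: "(real^'d) \<times> (real^'d)"
      by (intro mult_mono gauss_le_1 mult_left_mono norm_STFT_bound f2 g2) auto
    then show "AE z in lborel. norm (of_real (gauss (e n *\<^sub>R snd z)) * (STFT g1 f1 z * cnj (STFT g2 f2 z))) \<le> norm (STFT g1 f1 z) * (L2_norm f2 * L2_norm g2)" for n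
      by (auto simp: norm_mult)
  qed measurable
  moreover have "(\<lambda>n. \<integral>z. of_real (gauss (e n *\<^sub>R snd z)) * (STFT g1 f1 z * cnj (STFT g2 f2 z)) \<partial>lborel) \<longlonglongrightarrow> F 0"
    unfolding STFT_product_regularised[OF f1 g1 f2 g2 V1 e(1)] F_def[symmetric]
  proof (rule gauss_approximate_identity[OF _ _ _ e])
    show "F \<in> borel_measurable borel"
      unfolding F_def L2_inner_def tf_shift_minus_fst by measurable
    show "norm (F x) \<le> (L2_norm f1 * L2_norm f2) * (L2_norm g1 * L2_norm g2)" for x
      unfolding F_def norm_mult complex_mod_cnj
      using L2_inner_bound[OF tf_shift_L2[OF f1] f2, of "(-x, 0)"] L2_inner_bound[OF tf_shift_L2[OF g1] g2, of "(-x, 0)"]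
      by (intro mult_mono) (auto simp: tf_shift_L2_norm f1 g1 L2_norm_nonneg)
    show "(\<lambda>n. F (X n)) \<longlonglongrightarrow> F 0" if "X \<longlonglongrightarrow> 0" for X
      using tendsto_mult[OF L2_cross_correlation_tendsto[OF f1 f2 that] tendsto_cnj[OF L2_cross_correlation_tendsto[OF g1 g2 that]]]
      by (simp add: F_def flip: zero_prod_def)
  qed
  ultimately have "(\<integral>z. STFT g1 f1 z * cnj (STFT g2 f2 z) \<partial>lborel) = F 0"
    by (rule LIMSEQ_unique)
  then show "(\<integral>z. STFT g1 f1 z * cnj (STFT g2 f2 z) \<partial>lborel) = L2_inner f1 f2 * cnj (L2_inner g1 g2)"
    by (simp add: F_def flip: zero_prod_def)
qed

section \<open>Polynomial weights and convolution\<close>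

lemma one_plus_norm_submult: "1 + norm (a + b) \<le> (1 + norm a) * (1 + norm (b :: 'a::real_normed_vector))"
  using norm_triangle_ineq[of a b] mult_nonneg_nonneg[OF norm_ge_zero[of a] norm_ge_zero[of b]]
  by (simp only: distrib_left distrib_right mult_1 mult_1_right)

lemma tf_weight_eq: "tf_weight r s z = (1 + norm (fst z)) powr r * (1 + norm (snd z)) powr s"
  by (simp add: tf_weight_def case_prod_beta)

lemma tf_weight_minus[simp]: "tf_weight r s (- z) = tf_weight r s z"
  by (simp add: tf_weight_eq)

lemma tf_weight_pos[simp]: "0 < tf_weight r s z"
  unfolding tf_weight_eq by (intro mult_pos_pos) (auto simp: add_pos_nonneg less_imp_neq[symmetric])

lemma tf_weight_nonneg[simp]: "0 \<le> tf_weight r s z"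
  by (simp add: less_imp_le)

lemma tf_weight_measurable[measurable]: "tf_weight r s \<in> borel_measurable borel"
proof -
  have "1 + norm a \<noteq> 0" for a :: "real^'a" using norm_ge_zero[of a] by linarith
  then show ?thesis
    unfolding tf_weight_eq[abs_def] by (intro borel_measurable_continuous_onI continuous_intros) auto
qed

lemma tf_weight_ge_1: "0 \<le> r \<Longrightarrow> 0 \<le> s \<Longrightarrow> 1 \<le> tf_weight r s z"
  unfolding tf_weight_eq using mult_mono[of 1 "(1 + norm (fst z)) powr r" 1 "(1 + norm (snd z)) powr s"]
  by (simp add: ge_one_powr_ge_zero)

lemma tf_weight_submult:
  assumes "0 \<le> r" "0 \<le> s"
  shows "tf_weight r s (y + z) \<le> tf_weight r s y * tf_weight r s z"
proof -
  have "(1 + norm (a + b)) powr q \<le> (1 + norm a) powr q * (1 + norm b) powr q" if "0 \<le> q" for a b :: "real^'b" and q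
    using powr_mono2[OF that _ one_plus_norm_submult[of a b]] by (simp add: powr_mult)
  from mult_mono[OF this[OF assms(1), of "fst y" "fst z"] this[OF assms(2), of "snd y" "snd z"]] show ?thesis
    unfolding tf_weight_eq fst_add snd_add by (simp add: mult_ac)
qed

lemma tf_weight_near_0:
  assumes "0 \<le> r" "0 \<le> s" "norm u \<le> 1"
  shows "tf_weight r s u \<le> 2 powr r * 2 powr s"
proof -
  have "norm (fst u) \<le> 1" "norm (snd u) \<le> 1"
    using assms(3) norm_fst_le[of "fst u" "snd u"] norm_snd_le[of "snd u" "fst u"] by auto
  then show ?thesis
    unfolding tf_weight_eq using assms by (intro mult_mono powr_mono2) auto
qed

lemma norm_prod_square: "(norm z)\<^sup>2 = (norm (fst z))\<^sup>2 + (norm (snd z))\<^sup>2"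
  by (simp add: norm_prod_def)

text \<open>From ln (1 + a) \<le> a and (4 q - pi a)^2 \<ge> 0. The rate pi / 8 lies below the rate
  pi / 4 of \<open>gauss_majorant\<close>, so that their product still decays.\<close>

lemma tf_weight_Gaussian_bound:
  assumes "0 \<le> r" "0 \<le> s"
  shows "tf_weight r s z \<le> exp (2 * r\<^sup>2 / pi + 2 * s\<^sup>2 / pi) * exp (pi / 8 * (norm z)\<^sup>2)"
proof -
  have *: "(1 + a) powr q \<le> exp (2 * q\<^sup>2 / pi + pi / 8 * a\<^sup>2)" if "0 \<le> a" "0 \<le> q" for a q :: real
  proof -
    have "ln (1 + a) \<le> a" using that by (intro ln_add_one_self_le_self) auto
    then have "(1 + a) powr q \<le> exp (q * a)"
      using that by (simp add: powr_def mult_left_mono)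
    also have "q * a \<le> 2 * q\<^sup>2 / pi + pi / 8 * a\<^sup>2"
    proof -
      have "0 \<le> (4 * q - pi * a)\<^sup>2" by simp
      then have "8 * pi * (q * a) \<le> 16 * q\<^sup>2 + pi\<^sup>2 * a\<^sup>2"
        by (simp add: power2_eq_square algebra_simps)
      also have "\<dots> = 8 * pi * (2 * q\<^sup>2 / pi + pi / 8 * a\<^sup>2)"
        by (simp add: power2_eq_square field_simps)
      finally show ?thesis by simp
    qed
    finally show ?thesis by simp
  qed
  have "tf_weight r s z \<le> exp (2 * r\<^sup>2 / pi + pi / 8 * (norm (fst z))\<^sup>2) * exp (2 * s\<^sup>2 / pi + pi / 8 * (norm (snd z))\<^sup>2)"
    unfolding tf_weight_eq using assms by (intro mult_mono *) auto
  also have "\<dots> = exp (2 * r\<^sup>2 / pi + 2 * s\<^sup>2 / pi) * exp (pi / 8 * (norm z)\<^sup>2)"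
    unfolding norm_prod_square by (simp add: mult_exp_exp algebra_simps)
  finally show ?thesis .
qed

section \<open>Weighted convolution inequalities\<close>

definition conv :: "('a::euclidean_space \<Rightarrow> ennreal) \<Rightarrow> ('a \<Rightarrow> ennreal) \<Rightarrow> 'a \<Rightarrow> ennreal" where
  "conv A B z = (\<integral>\<^sup>+y. A y * B (z - y) \<partial>lborel)"

lemma conv_measurable[measurable]:
  assumes [measurable]: "A \<in> borel_measurable borel" "B \<in> borel_measurable borel"
  shows "conv A B \<in> borel_measurable borel"
  unfolding conv_def[abs_def] by measurable

lemma conv_mono_right: "(\<And>z. B z \<le> B' z) \<Longrightarrow> conv A B z \<le> conv A B' z"
  unfolding conv_def by (intro nn_integral_mono mult_left_mono) auto

lemma conv_mono_left: "(\<And>z. A z \<le> A' z) \<Longrightarrow> conv A B z \<le> conv A' B z"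
  unfolding conv_def by (intro nn_integral_mono mult_right_mono) auto

lemma conv_shift:
  assumes [measurable]: "A \<in> borel_measurable borel" "B \<in> borel_measurable borel"
  shows "conv A B (z + u) = conv (\<lambda>y. A (y + u)) B z" "conv A B (z + u) = conv A (\<lambda>y. B (y + u)) z"
proof -
  have "conv A B (z + u) = (\<integral>\<^sup>+y. A (y + u) * B (z + u - (y + u)) \<partial>lborel)"
    unfolding conv_def by (rule nn_integral_lborel_shift(1)[symmetric]) measurable
  then show "conv A B (z + u) = conv (\<lambda>y. A (y + u)) B z" by (simp add: conv_def)
  show "conv A B (z + u) = conv A (\<lambda>y. B (y + u)) z" by (simp add: conv_def algebra_simps)
qed

text \<open>The weighted \<open>L1\<close> norm of a nonnegative function, infinite values
  allowed.\<close>

definition weighted_integral :: "('a::euclidean_space \<Rightarrow> real) \<Rightarrow> ('a \<Rightarrow> ennreal) \<Rightarrow> ennreal" where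
  "weighted_integral w A = (\<integral>\<^sup>+z. A z * ennreal (w z) \<partial>lborel)"

lemma weighted_integral_mono: "(\<And>z. A z \<le> B z) \<Longrightarrow> weighted_integral w A \<le> weighted_integral w B"
  unfolding weighted_integral_def by (intro nn_integral_mono mult_right_mono) auto

lemma weighted_integral_cmult:
  "A \<in> borel_measurable borel \<Longrightarrow> w \<in> borel_measurable borel \<Longrightarrow> weighted_integral w (\<lambda>z. c * A z) = c * weighted_integral w A"
  unfolding weighted_integral_def by (simp add: mult.assoc nn_integral_cmult)

text \<open>Submultiplicativity bounds w z by w y * w (z - y) under the integral: weighted
  \<open>L1\<close> is a convolution algebra.\<close>

lemma weighted_integral_conv:
  assumes w: "\<And>y z. w (y + z) \<le> w y * w z" "\<And>z. 0 \<le> w z" and [measurable]: "w \<in> borel_measurable borel"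
    and [measurable]: "A \<in> borel_measurable borel" "B \<in> borel_measurable borel"
  shows "weighted_integral w (conv A B) \<le> weighted_integral w A * weighted_integral w B"
proof -
  have "weighted_integral w (conv A B) = (\<integral>\<^sup>+z. (\<integral>\<^sup>+y. A y * B (z - y) * ennreal (w z) \<partial>lborel) \<partial>lborel)"
    unfolding weighted_integral_def conv_def by (simp add: nn_integral_multc)
  also have "\<dots> \<le> (\<integral>\<^sup>+z. (\<integral>\<^sup>+y. (A y * ennreal (w y)) * (B (z - y) * ennreal (w (z - y))) \<partial>lborel) \<partial>lborel)"
  proof (intro nn_integral_mono)
    fix z y
    have "ennreal (w z) \<le> ennreal (w y) * ennreal (w (z - y))"
      using w(1)[of y "z - y"] w(2) by (simp add: ennreal_mult[symmetric] ennreal_leI)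
    then have "A y * B (z - y) * ennreal (w z) \<le> A y * B (z - y) * (ennreal (w y) * ennreal (w (z - y)))"
      by (intro mult_left_mono) auto
    then show "A y * B (z - y) * ennreal (w z) \<le> (A y * ennreal (w y)) * (B (z - y) * ennreal (w (z - y)))"
      by (simp add: mult_ac)
  qed
  also have "\<dots> = (\<integral>\<^sup>+y. (\<integral>\<^sup>+z. (A y * ennreal (w y)) * (B (z - y) * ennreal (w (z - y))) \<partial>lborel) \<partial>lborel)"
    by (rule lborel_pair.Fubini') measurable
  also have "\<dots> = (\<integral>\<^sup>+y. (A y * ennreal (w y)) * weighted_integral w B \<partial>lborel)"
    unfolding weighted_integral_def
    by (simp add: nn_integral_cmult nn_integral_lborel_shift(2)[of "\<lambda>z. B z * ennreal (w z)"])
  also have "\<dots> = weighted_integral w A * weighted_integral w B"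
    unfolding weighted_integral_def by (rule nn_integral_multc) measurable
  finally show ?thesis .
qed

lemma weighted_integral_reflect:
  assumes [measurable]: "A \<in> borel_measurable borel" "w \<in> borel_measurable borel" and "\<And>z. w (- z) = w z"
  shows "weighted_integral w (\<lambda>z. A (- z)) = weighted_integral w A"
  using nn_integral_lborel_shift(3)[of "\<lambda>z. A z * ennreal (w z)" 0] assms(3) by (simp add: weighted_integral_def)

lemma weighted_integral_shift:
  assumes w: "\<And>y z. w (y + z) \<le> w y * w z" "\<And>z. 0 \<le> w z" and [measurable]: "w \<in> borel_measurable borel"
    "A \<in> borel_measurable borel"
  shows "weighted_integral w (\<lambda>y. A (y - z)) \<le> ennreal (w z) * weighted_integral w A"
proof -
  have "weighted_integral w (\<lambda>y. A (y - z)) \<le> (\<integral>\<^sup>+y. ennreal (w z) * (A (y - z) * ennreal (w (y - z))) \<partial>lborel)"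
    unfolding weighted_integral_def
  proof (intro nn_integral_mono)
    fix y
    have "ennreal (w y) \<le> ennreal (w z) * ennreal (w (y - z))"
      using w(1)[of z "y - z"] w(2) by (simp add: ennreal_mult[symmetric] ennreal_leI)
    then show "A (y - z) * ennreal (w y) \<le> ennreal (w z) * (A (y - z) * ennreal (w (y - z)))"
      by (metis mult.commute mult.left_commute mult_left_mono zero_le)
  qed
  also have "\<dots> = ennreal (w z) * weighted_integral w A"
    unfolding weighted_integral_def
    by (simp add: nn_integral_cmult nn_integral_lborel_shift(2)[of "\<lambda>z. A z * ennreal (w z)"])
  finally show ?thesis .
qed

section \<open>Change of window and the Gaussian window\<close>

abbreviation abs_STFT :: "(real^'d \<Rightarrow> complex) \<Rightarrow> (real^'d \<Rightarrow> complex) \<Rightarrow> (real^'d) \<times> (real^'d) \<Rightarrow> ennreal" where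
  "abs_STFT g f z \<equiv> ennreal (norm (STFT g f z))"

text \<open>Moyal's identity with second pair \<open>tf_shift z b\<close> and c writes the transform
  with window b as an integral of the transform with window a. The auxiliary c is useful whenever it
  is not orthogonal to a.\<close>

lemma STFT_domination:
  assumes f: "f \<in> L2" and a: "a \<in> L2" and b: "b \<in> L2" and c: "c \<in> L2" and V: "integrable lborel (STFT a f)"
  shows "ennreal (norm (L2_inner a c)) * abs_STFT b f z \<le> conv (abs_STFT a f) (abs_STFT b c) z"
proof -
  note M = Moyal[OF f a tf_shift_L2[OF b, of z] c V]
  have "ennreal (norm (L2_inner a c)) * abs_STFT b f z = ennreal (norm (\<integral>y. STFT a f y * cnj (STFT c (tf_shift z b) y) \<partial>lborel))"
    unfolding M(1) by (simp add: norm_mult STFT_eq[of b f] ennreal_mult mult.commute)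
  also have "\<dots> \<le> (\<integral>\<^sup>+y. ennreal (norm (STFT a f y * cnj (STFT c (tf_shift z b) y))) \<partial>lborel)"
    by (rule integral_norm_bound_ennreal[OF M(2)])
  also have "\<dots> = conv (abs_STFT a f) (abs_STFT b c) z"
    unfolding conv_def using norm_STFT_commute[OF b c]
    by (intro nn_integral_cong) (simp add: norm_mult ennreal_mult norm_STFT_tf_shift[OF b c])
  finally show ?thesis .
qed

lemma L2_norm_eq_0_iff:
  assumes "f \<in> L2"
  shows "L2_norm f = 0 \<longleftrightarrow> (AE t in lborel. f t = 0)"
proof
  assume "L2_norm f = 0"
  then show "AE t in lborel. f t = 0" using Lp_bounded_0[of 2 lborel f] Lp_bounded_norm[of 2 f lborel] assms by simp
next
  assume "AE t in lborel. f t = 0"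
  then have "(L2_norm f)\<^sup>2 = 0"
    unfolding L2_norm_square using assms by (subst integral_nonneg_eq_0_iff_AE) (auto simp: L2_iff)
  then show "L2_norm f = 0" by simp
qed

lemma gauss_L2: "(\<lambda>t. complex_of_real (gauss t)) \<in> L2"
proof -
  have "integrable lborel (\<lambda>t::'a. (gauss t)\<^sup>2)"
  proof (rule Bochner_Integration.integrable_bound[OF gauss_integrable])
    show "AE t in lborel. norm ((gauss (t::'a))\<^sup>2) \<le> norm (gauss t)"
      by (auto simp: power2_eq_square mult_left_le gauss_le_1)
  qed measurable
  then show ?thesis unfolding L2_iff by simp
qed

text \<open>Completing the square: the product of two Gaussians is a Gaussian centred at x / 2 times
  e^(-pi |x|^2 / 2), so the integral is the Fourier transform of a scaled Gaussian. The bound drops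
  the factor 2^(-d/2).\<close>

lemma norm_STFT_gauss:
  "norm (STFT (\<lambda>t. of_real (gauss t)) (\<lambda>t. of_real (gauss t)) z) \<le> exp (- (pi / 2) * (norm (z :: (real^'d) \<times> (real^'d)))\<^sup>2)"
proof -
  obtain x \<omega> where z: "z = (x, \<omega>)" by (cases z)
  define h where "h t = complex_of_real (gauss (sqrt 2 *\<^sub>R t)) * phase (- (t \<bullet> \<omega>))" for t
  have [measurable]: "h \<in> borel_measurable borel" unfolding h_def by measurable
  have split: "gauss t * gauss (t - x) = exp (- (pi / 2) * (norm x)\<^sup>2) * gauss (sqrt 2 *\<^sub>R (t - x /\<^sub>R 2))" for t
  proof -
    have "(norm t)\<^sup>2 + (norm (t - x))\<^sup>2 = (norm x)\<^sup>2 / 2 + 2 * (norm (t - x /\<^sub>R 2))\<^sup>2"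
      by (simp add: power2_norm_eq_inner inner_diff_left inner_diff_right inner_commute[of x t] algebra_simps)
    then have "- pi * (norm t)\<^sup>2 + - pi * (norm (t - x))\<^sup>2 = - (pi / 2) * (norm x)\<^sup>2 + - pi * (2 * (norm (t - x /\<^sub>R 2))\<^sup>2)"
      by (simp only: distrib_left[symmetric]) (simp add: distrib_left)
    then show ?thesis
      by (simp only: gauss_def mult_exp_exp norm_scaleR power_mult_distrib) simp
  qed
  have "STFT (\<lambda>t. of_real (gauss t)) (\<lambda>t. of_real (gauss t)) z =
     (\<integral>t. (of_real (exp (- (pi / 2) * (norm x)\<^sup>2)) * phase (- ((x /\<^sub>R 2) \<bullet> \<omega>))) * h (t - x /\<^sub>R 2) \<partial>lborel)"
    unfolding z STFT_Fourier
  proof (rule Bochner_Integration.integral_cong[OF refl])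
    fix t
    have ph: "phase (- (\<omega> \<bullet> t)) = phase (- ((x /\<^sub>R 2) \<bullet> \<omega>)) * phase (- ((t - x /\<^sub>R 2) \<bullet> \<omega>))"
      by (simp flip: phase_add add: inner_diff_left inner_diff_right inner_commute)
    have "complex_of_real (gauss t) * cnj (of_real (gauss (t - x))) = of_real (exp (- (pi / 2) * (norm x)\<^sup>2) * gauss (sqrt 2 *\<^sub>R (t - x /\<^sub>R 2)))"
      unfolding split[symmetric] by simp
    then show "complex_of_real (gauss t) * cnj (of_real (gauss (t - x))) * phase (- (\<omega> \<bullet> t)) =
       (of_real (exp (- (pi / 2) * (norm x)\<^sup>2)) * phase (- ((x /\<^sub>R 2) \<bullet> \<omega>))) * h (t - x /\<^sub>R 2)"
      unfolding h_def ph by (simp only: of_real_mult mult_ac)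
  qed
  also have "\<dots> = (of_real (exp (- (pi / 2) * (norm x)\<^sup>2)) * phase (- ((x /\<^sub>R 2) \<bullet> \<omega>))) * (\<integral>t. h t \<partial>lborel)"
    by (simp add: integral_lborel_shift(2))
  also have "(\<integral>t. h t \<partial>lborel) = of_real (gauss (\<omega> /\<^sub>R sqrt 2) / sqrt 2 ^ DIM(real^'d))"
    unfolding h_def by (rule gauss_scale_Fourier) simp
  finally have "norm (STFT (\<lambda>t. of_real (gauss t)) (\<lambda>t. of_real (gauss t)) z) =
     exp (- (pi / 2) * (norm x)\<^sup>2) * (gauss (\<omega> /\<^sub>R sqrt 2) / sqrt 2 ^ DIM(real^'d))"
    by (simp add: norm_mult norm_divide norm_power)
  also have "\<dots> \<le> exp (- (pi / 2) * (norm x)\<^sup>2) * (gauss (\<omega> /\<^sub>R sqrt 2) / 1)"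
    by (intro mult_left_mono divide_left_mono) (auto intro: one_le_power)
  also have "\<dots> = exp (- (pi / 2) * (norm z)\<^sup>2)"
    unfolding norm_prod_square by (simp add: z gauss_def mult_exp_exp power_divide power_mult_distrib field_simps)
  finally show ?thesis .
qed

text \<open>Dominates e^(-pi |y|^2 / 2) for all y in the unit ball around z: |z|^2 \<le> 2 |z + u|^2
  + 2 halves the rate and costs the constant e^(pi / 2).\<close>

definition gauss_majorant :: "'a::euclidean_space \<Rightarrow> real" where
  "gauss_majorant z = exp (pi / 2) * exp (- (pi / 4) * (norm z)\<^sup>2)"

lemma gauss_majorant_measurable[measurable]: "gauss_majorant \<in> borel_measurable borel"
  unfolding gauss_majorant_def[abs_def] by measurable

lemma gauss_majorant_local:
  fixes z u :: "'a::euclidean_space"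
  assumes "norm u \<le> 1"
  shows "exp (- (pi / 2) * (norm (z + u))\<^sup>2) \<le> gauss_majorant z"
proof -
  have "norm z \<le> norm (z + u) + norm u" using norm_triangle_ineq4[of "z + u" u] by simp
  then have "(norm z)\<^sup>2 \<le> (norm (z + u) + norm u)\<^sup>2" by (intro power_mono) auto
  also have "\<dots> \<le> 2 * (norm (z + u))\<^sup>2 + 2 * (norm u)\<^sup>2"
    using zero_le_power2[of "norm (z + u) - norm u"] unfolding power2_diff power2_sum by linarith
  also have "(norm u)\<^sup>2 \<le> 1" using assms by (simp add: power_le_one)
  finally have "(norm z)\<^sup>2 \<le> 2 * (norm (z + u))\<^sup>2 + 2" by simp
  then have "pi / 4 * (norm z)\<^sup>2 \<le> pi / 4 * (2 * (norm (z + u))\<^sup>2 + 2)"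
    by (intro mult_left_mono) auto
  then show ?thesis by (simp add: gauss_majorant_def mult_exp_exp algebra_simps)
qed

lemma gauss_majorant_weighted_integral:
  assumes "0 \<le> r" "0 \<le> s"
  shows "weighted_integral (tf_weight r s) (\<lambda>z. ennreal (gauss_majorant (z :: (real^'d) \<times> (real^'d)))) < \<infinity>"
proof -
  let ?c = "exp (pi / 2) * exp (2 * r\<^sup>2 / pi + 2 * s\<^sup>2 / pi)"
  have "weighted_integral (tf_weight r s) (\<lambda>z. ennreal (gauss_majorant (z :: (real^'d) \<times> (real^'d)))) \<le> (\<integral>\<^sup>+z. ennreal ?c * ennreal (gauss (sqrt (1/8) *\<^sub>R z)) \<partial>(lborel :: ((real^'d) \<times> (real^'d)) measure))"
    unfolding weighted_integral_def
  proof (intro nn_integral_mono)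
    fix z :: "(real^'d) \<times> (real^'d)"
    have "gauss_majorant z * tf_weight r s z \<le> gauss_majorant z * (exp (2 * r\<^sup>2 / pi + 2 * s\<^sup>2 / pi) * exp (pi / 8 * (norm z)\<^sup>2))"
      by (intro mult_left_mono tf_weight_Gaussian_bound assms) (auto simp: gauss_majorant_def)
    also have "\<dots> = ?c * gauss (sqrt (1/8) *\<^sub>R z)"
      by (simp add: gauss_majorant_def gauss_def mult_exp_exp power_mult_distrib real_sqrt_divide power_divide)
    finally show "ennreal (gauss_majorant z) * ennreal (tf_weight r s z) \<le> ennreal ?c * ennreal (gauss (sqrt (1/8) *\<^sub>R z))"
      by (simp add: ennreal_mult[symmetric] gauss_majorant_def ennreal_leI)
  qed
  also have "\<dots> = ennreal ?c * (\<integral>\<^sup>+z. ennreal (gauss (sqrt (1/8) *\<^sub>R z)) \<partial>(lborel :: ((real^'d) \<times> (real^'d)) measure))"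
    by (intro nn_integral_cmult) measurable
  also have "\<dots> < \<infinity>"
    using gauss_scale_integrable[of "sqrt (1/8)", where 'a = "(real^'d) \<times> (real^'d)"]
    by (auto simp: integrable_iff_bounded ennreal_mult_less_top)
  finally show ?thesis .
qed

section \<open>Windows with integrable short-time Fourier transform\<close>

lemma ennreal_cmult_le_imp:
  assumes "0 < c" "ennreal c * X \<le> Y"
  shows "X \<le> ennreal (1 / c) * Y"
proof -
  have "X = ennreal (1 / c) * (ennreal c * X)"
    using assms(1) by (simp add: mult.assoc[symmetric] ennreal_mult[symmetric])
  also have "\<dots> \<le> ennreal (1 / c) * Y" by (intro mult_left_mono assms) auto
  finally show ?thesis .
qed

lemma weighted_L1_bounded_iff:
  assumes [measurable]: "F \<in> borel_measurable borel" "w \<in> borel_measurable borel" and w: "\<And>z. 0 \<le> w z"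
  shows "weighted_Lp_bounded 1 w lborel F a \<longleftrightarrow> 0 \<le> a \<and> weighted_integral w (\<lambda>z. ennreal (norm (F z))) \<le> ennreal a"
proof -
  have "(\<integral>\<^sup>+z. ennreal (norm (F z * of_real (w z)) powr enn2real 1) \<partial>lborel) = weighted_integral w (\<lambda>z. ennreal (norm (F z)))"
    unfolding weighted_integral_def using w by (intro nn_integral_cong) (simp add: norm_mult ennreal_mult)
  then show ?thesis
    by (auto simp: Lp_bounded_def)
qed

text \<open>Links the real-valued norm of the definitions to the extended integral in which the
  convolution estimates are carried out.\<close>

lemma weighted_L1_norm_eq:
  assumes [measurable]: "F \<in> borel_measurable borel" "w \<in> borel_measurable borel" and w: "\<And>z. 0 \<le> w z"
  shows "F \<in> weighted_Lp_space 1 w lborel \<longleftrightarrow> weighted_integral w (\<lambda>z. ennreal (norm (F z))) < \<infinity>"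
    and "F \<in> weighted_Lp_space 1 w lborel \<Longrightarrow>
      weighted_integral w (\<lambda>z. ennreal (norm (F z))) = ennreal (weighted_Lp_norm 1 w lborel F)"
proof -
  let ?W = "weighted_integral w (\<lambda>z. ennreal (norm (F z)))"
  note iff = weighted_L1_bounded_iff[OF assms]
  have 1: "?W < \<infinity> \<and> ?W \<le> ennreal (weighted_Lp_norm 1 w lborel F)" if "F \<in> weighted_Lp_space 1 w lborel"
    using weighted_Lp_bounded_norm[OF _ that] unfolding iff by (auto simp: less_top[symmetric] top_unique)
  have 2: "F \<in> weighted_Lp_space 1 w lborel \<and> ennreal (weighted_Lp_norm 1 w lborel F) \<le> ?W" if "?W < \<infinity>"
  proof -
    have "weighted_Lp_bounded 1 w lborel F (enn2real ?W)" using that unfolding iff by auto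
    from weighted_Lp_boundedD[OF _ this] show ?thesis using that
      by (metis ennreal_enn2real ennreal_leI infinity_ennreal_def order_refl)
  qed
  show "F \<in> weighted_Lp_space 1 w lborel \<longleftrightarrow> ?W < \<infinity>" using 1 2 by blast
  show "F \<in> weighted_Lp_space 1 w lborel \<Longrightarrow> ?W = ennreal (weighted_Lp_norm 1 w lborel F)"
    using 1 2 by (auto intro: antisym)
qed

locale tf_window =
  fixes r s :: real and g0 :: "real^'d \<Rightarrow> complex"
  assumes r: "0 \<le> r" and s: "0 \<le> s" and window: "g0 \<in> window_class r s" and nonzero: "\<not> (AE t in lborel. g0 t = 0)"
begin

abbreviation w :: "(real^'d) \<times> (real^'d) \<Rightarrow> real" where "w \<equiv> tf_weight r s"
abbreviation wint :: "((real^'d) \<times> (real^'d) \<Rightarrow> ennreal) \<Rightarrow> ennreal" where "wint \<equiv> weighted_integral w"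
abbreviation M1 :: "(real^'d \<Rightarrow> complex) set" where "M1 \<equiv> M1_space r s g0"
abbreviation M1n :: "(real^'d \<Rightarrow> complex) \<Rightarrow> real" where "M1n \<equiv> M1_norm r s g0"

lemmas w_ge_1 = tf_weight_ge_1[OF r s]
lemmas w_submult = tf_weight_submult[OF r s]
lemmas wint_conv = weighted_integral_conv[OF w_submult tf_weight_nonneg tf_weight_measurable]
lemmas wint_shift = weighted_integral_shift[OF w_submult tf_weight_nonneg tf_weight_measurable]
lemmas wint_reflect = weighted_integral_reflect[OF _ tf_weight_measurable tf_weight_minus]

lemma g0_L2: "g0 \<in> L2"
  using window by (simp add: window_class_def)

lemma abs_STFT_measurable:
  assumes "f \<in> L2" "g \<in> L2"
  shows "abs_STFT g f \<in> borel_measurable borel"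
  using STFT_measurable[OF assms] by measurable

lemma M1_L2: "h \<in> M1 \<Longrightarrow> h \<in> L2"
  by (simp add: M1_space_def)

lemma wint_M1: "h \<in> M1 \<Longrightarrow> wint (abs_STFT g0 h) = ennreal (M1n h)"
  unfolding M1_norm_def
  by (rule weighted_L1_norm_eq(2)) (auto simp: M1_space_def intro: STFT_measurable g0_L2)

lemma M1_iff: "h \<in> M1 \<longleftrightarrow> h \<in> L2 \<and> wint (abs_STFT g0 h) < \<infinity>"
  using weighted_L1_norm_eq(1)[OF STFT_measurable tf_weight_measurable tf_weight_nonneg, of h g0 r s] g0_L2
  by (auto simp: M1_space_def)

lemma M1n_nonneg: "0 \<le> M1n h"
  by (simp add: M1_norm_def weighted_Lp_norm_def Lp_norm_def)

lemma M1n_le: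
  assumes "h \<in> M1" "wint (abs_STFT g0 h) \<le> ennreal a" "0 \<le> a"
  shows "M1n h \<le> a"
  using assms wint_M1[OF assms(1)] by simp

lemma g0_M1: "g0 \<in> M1"
  using window by (simp add: window_class_def M1_space_def)

lemma wint_ge_integral: "(\<integral>\<^sup>+z. A z \<partial>lborel) \<le> wint A"
  unfolding weighted_integral_def
proof (intro nn_integral_mono)
  fix z :: "(real^'d) \<times> (real^'d)"
  have "A z * 1 \<le> A z * ennreal (w z)" using w_ge_1[of z] by (intro mult_left_mono) (auto simp flip: ennreal_1)
  then show "A z \<le> A z * ennreal (w z)" by simp
qed

lemma STFT_integrable:
  assumes "f \<in> L2" "g \<in> L2" "wint (abs_STFT g f) < \<infinity>"
  shows "integrable lborel (STFT g f)"
  using STFT_measurable[OF assms(1,2)] order_le_less_trans[OF wint_ge_integral assms(3)]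
  by (auto simp: integrable_iff_bounded)

lemma wint_add:
  assumes [measurable]: "A \<in> borel_measurable borel" "B \<in> borel_measurable borel"
  shows "wint (\<lambda>z. A z + B z) = wint A + wint B"
  unfolding weighted_integral_def by (simp add: distrib_right nn_integral_add)

lemma M1_add:
  assumes h: "h \<in> M1" and k: "k \<in> M1"
  shows "(\<lambda>t. h t + k t) \<in> M1" and "M1n (\<lambda>t. h t + k t) \<le> M1n h + M1n k"
proof -
  have L2: "h \<in> L2" "k \<in> L2" using h k by (auto dest: M1_L2)
  have "wint (abs_STFT g0 (\<lambda>t. h t + k t)) \<le> wint (\<lambda>z. abs_STFT g0 h z + abs_STFT g0 k z)"
    using L2 by (intro weighted_integral_mono)
      (simp add: STFT_eq L2_inner_left_add tf_shift_L2 g0_L2 norm_triangle_ineq ennreal_leI flip: ennreal_plus)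
  also have "\<dots> = ennreal (M1n h + M1n k)"
    using wint_add[OF abs_STFT_measurable[OF L2(1) g0_L2] abs_STFT_measurable[OF L2(2) g0_L2]] wint_M1[OF h] wint_M1[OF k]
    by (simp add: M1n_nonneg)
  finally have le: "wint (abs_STFT g0 (\<lambda>t. h t + k t)) \<le> ennreal (M1n h + M1n k)" .
  then show "(\<lambda>t. h t + k t) \<in> M1" using L2 by (auto simp: M1_iff L2_add less_top[symmetric] top_unique)
  from M1n_le[OF this le] show "M1n (\<lambda>t. h t + k t) \<le> M1n h + M1n k" by (simp add: M1n_nonneg)
qed

lemma M1_scale:
  assumes h: "h \<in> M1"
  shows "(\<lambda>t. c * h t) \<in> M1" and "M1n (\<lambda>t. c * h t) \<le> norm c * M1n h"
proof -
  have L2: "h \<in> L2" using h by (auto dest: M1_L2)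
  have "wint (abs_STFT g0 (\<lambda>t. c * h t)) = wint (\<lambda>z. ennreal (norm c) * abs_STFT g0 h z)"
    by (simp add: STFT_eq L2_inner_left_scale norm_mult ennreal_mult)
  also have "\<dots> = ennreal (norm c * M1n h)"
    by (subst weighted_integral_cmult[OF abs_STFT_measurable[OF L2 g0_L2] tf_weight_measurable])
      (simp add: wint_M1[OF h] ennreal_mult M1n_nonneg)
  finally have le: "wint (abs_STFT g0 (\<lambda>t. c * h t)) = ennreal (norm c * M1n h)" .
  then show "(\<lambda>t. c * h t) \<in> M1" using L2 by (auto simp: M1_iff L2_scale less_top[symmetric] top_unique)
  from M1n_le[OF this] le show "M1n (\<lambda>t. c * h t) \<le> norm c * M1n h" by (simp add: M1n_nonneg)
qed

lemma M1_diff: "h \<in> M1 \<Longrightarrow> k \<in> M1 \<Longrightarrow> (\<lambda>t. h t - k t) \<in> M1"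
  using M1_add(1)[of h "\<lambda>t. -1 * k t"] M1_scale(1)[of k "-1"] by simp

lemma M1_tf_shift:
  assumes h: "h \<in> M1"
  shows "tf_shift z h \<in> M1" and "M1n (tf_shift z h) \<le> w z * M1n h"
proof -
  have L2: "h \<in> L2" using h by (auto dest: M1_L2)
  have "wint (abs_STFT g0 (tf_shift z h)) = wint (\<lambda>y. abs_STFT g0 h (y - z))"
    by (simp add: norm_STFT_tf_shift[OF L2 g0_L2])
  also have "\<dots> \<le> ennreal (w z) * wint (abs_STFT g0 h)"
    by (intro wint_shift abs_STFT_measurable L2 g0_L2)
  finally have le: "wint (abs_STFT g0 (tf_shift z h)) \<le> ennreal (w z * M1n h)"
    by (simp add: wint_M1[OF h] ennreal_mult M1n_nonneg)
  then show "tf_shift z h \<in> M1" using L2 by (auto simp: M1_iff tf_shift_L2 less_top[symmetric] top_unique)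
  from M1n_le[OF this le] show "M1n (tf_shift z h) \<le> w z * M1n h" by (simp add: M1n_nonneg)
qed

lemma norm_g0_pos: "0 < L2_norm g0"
  using nonzero L2_norm_eq_0_iff[OF g0_L2] L2_norm_nonneg[of g0] by (auto simp: less_le)

lemma norm_inner_g0: "norm (L2_inner g0 g0) = (L2_norm g0)\<^sup>2"
  by (simp add: L2_inner_self norm_power)

lemma M1_STFT_integrable: "h \<in> M1 \<Longrightarrow> integrable lborel (STFT g0 h)"
  by (intro STFT_integrable) (auto simp: M1_iff g0_L2)

text \<open>\<open>STFT_domination\<close> with a = c = g0, where the division is possible because
  g0 is not null: the transform of h with any window is controlled by the one with g0.\<close>

lemma M1_domination:
  assumes h: "h \<in> M1" and k: "k \<in> L2"
  shows "abs_STFT k h z \<le> ennreal (1 / (L2_norm g0)\<^sup>2) * conv (abs_STFT g0 h) (abs_STFT k g0) z"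
  using STFT_domination[OF M1_L2[OF h] g0_L2 k g0_L2 M1_STFT_integrable[OF h], of z] norm_g0_pos
  unfolding norm_inner_g0 by (intro ennreal_cmult_le_imp) auto

lemma wint_STFT_g0: "k \<in> M1 \<Longrightarrow> wint (abs_STFT k g0) = ennreal (M1n k)"
  using wint_reflect[of "abs_STFT g0 k"] abs_STFT_measurable[OF M1_L2 g0_L2] wint_M1[of k]
  by (simp add: norm_STFT_commute[OF g0_L2 M1_L2])

lemma wint_STFT_le:
  assumes h: "h \<in> M1" and k: "k \<in> M1"
  shows "wint (abs_STFT k h) \<le> ennreal (1 / (L2_norm g0)\<^sup>2 * (M1n h * M1n k))"
proof -
  have m: "abs_STFT g0 h \<in> borel_measurable borel" "abs_STFT k g0 \<in> borel_measurable borel"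
    by (rule abs_STFT_measurable[OF M1_L2[OF h] g0_L2], rule abs_STFT_measurable[OF g0_L2 M1_L2[OF k]])
  have "wint (abs_STFT k h) \<le> wint (\<lambda>z. ennreal (1 / (L2_norm g0)\<^sup>2) * conv (abs_STFT g0 h) (abs_STFT k g0) z)"
    by (intro weighted_integral_mono M1_domination h M1_L2 k)
  also have "\<dots> = ennreal (1 / (L2_norm g0)\<^sup>2) * wint (conv (abs_STFT g0 h) (abs_STFT k g0))"
    by (intro weighted_integral_cmult conv_measurable m tf_weight_measurable)
  also have "\<dots> \<le> ennreal (1 / (L2_norm g0)\<^sup>2) * (wint (abs_STFT g0 h) * wint (abs_STFT k g0))"
    by (intro mult_left_mono wint_conv m) auto
  also have "\<dots> = ennreal (1 / (L2_norm g0)\<^sup>2 * (M1n h * M1n k))"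
    by (simp add: wint_M1[OF h] wint_STFT_g0[OF k] ennreal_mult[symmetric] M1n_nonneg)
  finally show ?thesis .
qed

text \<open>The \<open>L\<infinity>\<close> companion of the \<open>L1\<close> estimate
  \<open>wint_STFT_le\<close>. The two together allow pairing the transform with a function bounded
  in an arbitrary Lebesgue space.\<close>

lemma STFT_sup_le:
  assumes h: "h \<in> M1" and k: "k \<in> L2"
  shows "norm (STFT k h z) \<le> L2_norm k / L2_norm g0 * M1n h"
proof -
  have "conv (abs_STFT g0 h) (abs_STFT k g0) z \<le> (\<integral>\<^sup>+y. ennreal (L2_norm g0 * L2_norm k) * abs_STFT g0 h y \<partial>lborel)"
    unfolding conv_def by (intro nn_integral_mono) (subst mult.commute, intro mult_right_mono ennreal_leI norm_STFT_bound g0_L2 k, auto)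
  also have "\<dots> = ennreal (L2_norm g0 * L2_norm k) * (\<integral>\<^sup>+y. abs_STFT g0 h y \<partial>lborel)"
    using abs_STFT_measurable[OF M1_L2[OF h] g0_L2] by (subst nn_integral_cmult) (simp_all only: measurable_lborel2)
  also have "\<dots> \<le> ennreal (L2_norm g0 * L2_norm k) * ennreal (M1n h)"
    using wint_ge_integral[of "abs_STFT g0 h"] wint_M1[OF h] by (intro mult_left_mono) auto
  finally have "abs_STFT k h z \<le> ennreal (1 / (L2_norm g0)\<^sup>2) * (ennreal (L2_norm g0 * L2_norm k) * ennreal (M1n h))"
    using M1_domination[OF h k, of z] by (meson mult_left_mono order_trans zero_le)
  also have "\<dots> = ennreal (1 / (L2_norm g0)\<^sup>2 * (L2_norm g0 * L2_norm k * M1n h))"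
    by (simp add: ennreal_mult[symmetric] L2_norm_nonneg M1n_nonneg)
  also have "1 / (L2_norm g0)\<^sup>2 * (L2_norm g0 * L2_norm k * M1n h) = L2_norm k / L2_norm g0 * M1n h"
    using norm_g0_pos by (simp add: power2_eq_square)
  finally show ?thesis by (simp add: L2_norm_nonneg M1n_nonneg)
qed

text \<open>g0 may be orthogonal to the Gaussian G itself, but not to all its shifts, since Moyal's
  identity would then give |g0|^2 |G|^2 = 0. Replacing G by a shift changes \<open>STFT G G\<close>
  only by phases, so the decay is kept.\<close>

lemma exists_Gaussian_window:
  "\<exists>\<gamma>\<in>L2. L2_inner g0 \<gamma> \<noteq> 0 \<and> (\<forall>z. norm (STFT \<gamma> \<gamma> z) \<le> exp (- (pi / 2) * (norm z)\<^sup>2))"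
proof -
  define G where "G = (\<lambda>t :: real^'d. complex_of_real (gauss t))"
  have G: "G \<in> L2" unfolding G_def by (rule gauss_L2)
  have "\<exists>z. STFT G g0 z \<noteq> 0"
  proof (rule ccontr)
    assume "\<nexists>z. STFT G g0 z \<noteq> 0"
    then have "STFT G g0 = (\<lambda>_. 0)" by auto
    then have "L2_inner g0 g0 * cnj (L2_inner G G) = 0"
      using Moyal(1)[OF g0_L2 G g0_L2 G] by simp
    then have "L2_norm G = 0" using norm_g0_pos by (simp add: L2_inner_self)
    then have "AE t in lborel. G t = 0" using L2_norm_eq_0_iff[OF G] by blast
    then have "AE t in (lborel :: (real^'d) measure). False"
      unfolding G_def by (simp add: gauss_pos[THEN less_imp_neq, symmetric])
    then show False by (simp add: ae_filter_eq_bot_iff eventually_False)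
  qed
  then obtain z0 where z0: "STFT G g0 z0 \<noteq> 0" by blast
  have "norm (STFT (tf_shift z0 G) (tf_shift z0 G) z) = norm (STFT G G z)" for z
  proof -
    have "tf_shift z (tf_shift z0 G) = (\<lambda>t. phase (- (snd z0 \<bullet> fst z)) * tf_shift (z0 + z) G t)"
      by (simp add: tf_shift_comp add.commute)
    then have "norm (STFT (tf_shift z0 G) (tf_shift z0 G) z) = norm (STFT G (tf_shift z0 G) (z0 + z))"
      by (simp add: STFT_eq L2_inner_right_scale norm_mult)
    also have "\<dots> = norm (STFT G G z)" by (simp add: norm_STFT_tf_shift[OF G G])
    finally show ?thesis .
  qed
  then have "norm (STFT (tf_shift z0 G) (tf_shift z0 G) z) \<le> exp (- (pi / 2) * (norm z)\<^sup>2)" for z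
    using norm_STFT_gauss[of z] by (simp add: G_def)
  then show ?thesis
    using z0 tf_shift_L2[OF G, of z0] by (intro bexI[of _ "tf_shift z0 G"]) (auto simp: STFT_eq)
qed

text \<open>Membership in the Wiener amalgam space with local component \<open>L\<infinity>\<close>
  and global component weighted \<open>L1\<close>. A measurable majorant replaces the local
  supremum, whose own measurability would otherwise be at issue.\<close>

definition local_majorant :: "((real^'d) \<times> (real^'d) \<Rightarrow> ennreal) \<Rightarrow> ((real^'d) \<times> (real^'d) \<Rightarrow> ennreal) \<Rightarrow> bool" where
  "local_majorant A H \<longleftrightarrow> H \<in> borel_measurable borel \<and> wint H < \<infinity> \<and> (\<forall>z u. norm u \<le> 1 \<longrightarrow> A (z + u) \<le> H z)"

text \<open>A translation of a convolution can be placed on either factor. Hence it suffices that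
  one factor has a local majorant and the other is integrable against the weight.\<close>

lemma local_majorant_conv:
  assumes A[measurable]: "A \<in> borel_measurable borel" and B[measurable]: "B \<in> borel_measurable borel"
    and D: "\<And>z. D z \<le> ennreal c * conv A B z"
  shows "wint A < \<infinity> \<Longrightarrow> local_majorant B H \<Longrightarrow> local_majorant D (\<lambda>z. ennreal c * conv A H z)"
    and "wint B < \<infinity> \<Longrightarrow> local_majorant A H \<Longrightarrow> local_majorant D (\<lambda>z. ennreal c * conv H B z)"
proof -
  assume fin: "wint A < \<infinity>" and H: "local_majorant B H"
  then have [measurable]: "H \<in> borel_measurable borel" by (simp add: local_majorant_def)
  have "D (z + u) \<le> ennreal c * conv A H z" if "norm u \<le> 1" for z u
  proof -
    have "D (z + u) \<le> ennreal c * conv A (\<lambda>y. B (y + u)) z" using D[of "z + u"] by (simp add: conv_shift(2))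
    also have "\<dots> \<le> ennreal c * conv A H z"
      using H that unfolding local_majorant_def by (intro mult_left_mono conv_mono_right zero_le) blast
    finally show ?thesis .
  qed
  moreover have "wint (\<lambda>z. ennreal c * conv A H z) < \<infinity>"
    using order_le_less_trans[OF wint_conv[of A H]] fin H
    by (subst weighted_integral_cmult) (auto simp: local_majorant_def ennreal_mult_less_top)
  ultimately show "local_majorant D (\<lambda>z. ennreal c * conv A H z)" unfolding local_majorant_def by auto
next
  assume fin: "wint B < \<infinity>" and H: "local_majorant A H"
  then have [measurable]: "H \<in> borel_measurable borel" by (simp add: local_majorant_def)
  have "D (z + u) \<le> ennreal c * conv H B z" if "norm u \<le> 1" for z u
  proof -
    have "D (z + u) \<le> ennreal c * conv (\<lambda>y. A (y + u)) B z" using D[of "z + u"] by (simp add: conv_shift(1))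
    also have "\<dots> \<le> ennreal c * conv H B z"
      using H that unfolding local_majorant_def by (intro mult_left_mono conv_mono_left zero_le) blast
    finally show ?thesis .
  qed
  moreover have "wint (\<lambda>z. ennreal c * conv H B z) < \<infinity>"
    using order_le_less_trans[OF wint_conv[of H B]] fin H
    by (subst weighted_integral_cmult) (auto simp: local_majorant_def ennreal_mult_less_top)
  ultimately show "local_majorant D (\<lambda>z. ennreal c * conv H B z)" unfolding local_majorant_def by auto
qed

text \<open>
  Passing through a Gaussian window turns weighted integrability into weighted integrability of
  the local supremum.
\<close>

lemma STFT_local_majorant:
  assumes h: "h \<in> M1" and k: "k \<in> M1"
  shows "\<exists>H. local_majorant (abs_STFT k h) H"
proof -
  obtain \<gamma> where \<gamma>: "\<gamma> \<in> L2" and nz: "L2_inner g0 \<gamma> \<noteq> 0"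
    and dec: "\<And>z. norm (STFT \<gamma> \<gamma> z) \<le> exp (- (pi / 2) * (norm z)\<^sup>2)"
    using exists_Gaussian_window by auto
  define c where "c = 1 / norm (L2_inner g0 \<gamma>)"
  have 1: "local_majorant (abs_STFT \<gamma> \<gamma>) (\<lambda>z. ennreal (gauss_majorant z))"
    using gauss_majorant_weighted_integral[OF r s] order_trans[OF dec gauss_majorant_local]
    by (auto simp: local_majorant_def intro!: ennreal_leI)
  \<comment> \<open>The majorant is passed along \<open>STFT \<gamma> \<gamma>\<close>,
    \<open>STFT \<gamma> g0\<close>, \<open>STFT g0 \<gamma>\<close>, \<open>STFT g0 h\<close>,
    \<open>STFT k h\<close>. Each passage is a change of window, except the second, which is the
    reflection z \<mapsto> -z.\<close>
  have "abs_STFT \<gamma> g0 z \<le> ennreal c * conv (abs_STFT g0 g0) (abs_STFT \<gamma> \<gamma>) z" for z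
    unfolding c_def using nz STFT_domination[OF g0_L2 g0_L2 \<gamma> \<gamma> M1_STFT_integrable[OF g0_M1], of z]
    by (intro ennreal_cmult_le_imp) auto
  from local_majorant_conv(1)[OF abs_STFT_measurable[OF g0_L2 g0_L2] abs_STFT_measurable[OF \<gamma> \<gamma>] this _ 1]
  obtain L where L: "local_majorant (abs_STFT \<gamma> g0) L" using g0_M1 by (auto simp: M1_iff)
  have "abs_STFT g0 \<gamma> (z + u) \<le> L (- z)" if "norm u \<le> 1" for z u
  proof -
    have "abs_STFT g0 \<gamma> (z + u) = abs_STFT \<gamma> g0 (- z + - u)"
      by (simp add: norm_STFT_commute[OF \<gamma> g0_L2, of "z + u"])
    also have "\<dots> \<le> L (- z)" using L that unfolding local_majorant_def by (metis norm_minus_cancel)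
    finally show ?thesis .
  qed
  then have L': "local_majorant (abs_STFT g0 \<gamma>) (\<lambda>z. L (- z))"
    using L by (auto simp: local_majorant_def wint_reflect)
  have "abs_STFT g0 h z \<le> ennreal c * conv (abs_STFT g0 h) (abs_STFT g0 \<gamma>) z" for z
    unfolding c_def using nz STFT_domination[OF M1_L2[OF h] g0_L2 g0_L2 \<gamma> M1_STFT_integrable[OF h], of z]
    by (intro ennreal_cmult_le_imp) auto
  from local_majorant_conv(1)[OF abs_STFT_measurable[OF M1_L2[OF h] g0_L2] abs_STFT_measurable[OF \<gamma> g0_L2] this _ L']
  obtain L2 where L2: "local_majorant (abs_STFT g0 h) L2" using h by (auto simp: M1_iff)
  have "wint (abs_STFT k g0) < \<infinity>" by (simp add: wint_STFT_g0[OF k])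
  from local_majorant_conv(2)[OF abs_STFT_measurable[OF M1_L2[OF h] g0_L2] abs_STFT_measurable[OF g0_L2 M1_L2[OF k]]
      M1_domination[OF h M1_L2[OF k]] this L2]
  show ?thesis by blast
qed

end

section \<open>The reproducing formula for functionals\<close>

text \<open>Built in each component separately: the weight is a product, so comparing its values at
  \<sigma> n z and at z needs bounds on both components, not just on the norm of the pair.\<close>

lemma componentwise_simple_approximation:
  obtains \<sigma> :: "nat \<Rightarrow> (real^'d) \<times> (real^'d) \<Rightarrow> (real^'d) \<times> (real^'d)"
  where "\<And>n. \<sigma> n \<in> borel_measurable borel" "\<And>n. finite (range (\<sigma> n))" "\<And>z. (\<lambda>n. \<sigma> n z) \<longlonglongrightarrow> z"
    "\<And>n z. norm (fst (\<sigma> n z)) \<le> 2 * norm (fst z)" "\<And>n z. norm (snd (\<sigma> n z)) \<le> 2 * norm (snd z)"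
proof -
  have "(\<lambda>x::real^'d. x) \<in> borel_measurable lborel" by simp
  from borel_measurable_implies_sequence_metric[OF this, of 0]
  obtain S where S: "\<And>n. simple_function lborel (S n)" "\<And>x. (\<lambda>n. S n x) \<longlonglongrightarrow> x"
    "\<And>n x. norm (S n x) \<le> 2 * norm (x :: real^'d)" by auto
  have [measurable]: "S n \<in> borel_measurable borel" for n
    using borel_measurable_simple_function[OF S(1)[of n]] by simp
  have fin: "finite (range (S n))" for n using simple_functionD(1)[OF S(1)[of n]] by simp
  define \<sigma> where "\<sigma> n z = (S n (fst z), S n (snd z))" for n z
  show thesis
  proof (rule that[of \<sigma>])
    have "(\<lambda>z. (S n (fst z), S n (snd z))) \<in> borel \<Otimes>\<^sub>M borel \<rightarrow>\<^sub>M borel \<Otimes>\<^sub>M borel" for n by measurable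
    then show "\<sigma> n \<in> borel_measurable borel" for n
      unfolding \<sigma>_def[abs_def] borel_prod by simp
    have "range (\<sigma> n) \<subseteq> range (S n) \<times> range (S n)" for n by (auto simp: \<sigma>_def)
    then show "finite (range (\<sigma> n))" for n by (rule finite_subset) (simp add: fin)
    show "(\<lambda>n. \<sigma> n z) \<longlonglongrightarrow> z" for z
      unfolding \<sigma>_def using tendsto_Pair[OF S(2)[of "fst z"] S(2)[of "snd z"]] by simp
  qed (auto simp: \<sigma>_def S(3))
qed

text \<open>Sampling X at finitely many points makes the integral a finite sum, through which an
  antilinear functional can be moved.\<close>

lemma integral_finite_range:
  fixes V :: "'a::euclidean_space \<Rightarrow> complex" and X :: "'b::euclidean_space \<Rightarrow> complex"
  assumes V: "integrable lborel V" and [measurable]: "\<sigma> \<in> borel_measurable borel" and fin: "finite (range \<sigma>)"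
  shows "(\<integral>u. V u * X (\<sigma> u) \<partial>lborel) = (\<Sum>v\<in>range \<sigma>. (\<integral>u. V u * indicator (\<sigma> -` {v}) u \<partial>lborel) * X v)"
proof -
  have vim: "\<sigma> -` {v} \<in> sets borel" for v using measurable_sets[of \<sigma> borel borel "{v}"] by simp
  have int: "integrable lborel (\<lambda>u. V u * indicator (\<sigma> -` {v}) u)" for v
    using vim[of v] V borel_measurable_integrable[OF V]
    by (intro Bochner_Integration.integrable_bound[OF V]) (auto simp: indicator_def)
  have "V u * X (\<sigma> u) = (\<Sum>v\<in>range \<sigma>. V u * indicator (\<sigma> -` {v}) u * X v)" for u
  proof -
    have "(\<Sum>v\<in>range \<sigma>. V u * indicator (\<sigma> -` {v}) u * X v) = (\<Sum>v\<in>range \<sigma>. if v = \<sigma> u then V u * X v else 0)"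
      by (intro sum.cong) (auto simp: indicator_def)
    then show ?thesis using fin by (simp add: sum.delta)
  qed
  then have "(\<integral>u. V u * X (\<sigma> u) \<partial>lborel) = (\<integral>u. (\<Sum>v\<in>range \<sigma>. V u * indicator (\<sigma> -` {v}) u * X v) \<partial>lborel)" by simp
  also have "\<dots> = (\<Sum>v\<in>range \<sigma>. (\<integral>u. V u * indicator (\<sigma> -` {v}) u * X v \<partial>lborel))"
    using int by (intro Bochner_Integration.integral_sum) auto
  finally show ?thesis by simp
qed

lemma L2_sum:
  assumes "finite A" "\<And>v. v \<in> A \<Longrightarrow> f v \<in> L2"
  shows "(\<lambda>t. \<Sum>v\<in>A. c v * f v t) \<in> L2"
    and "k \<in> L2 \<Longrightarrow> L2_inner (\<lambda>t. \<Sum>v\<in>A. c v * f v t) k = (\<Sum>v\<in>A. c v * L2_inner (f v) k)"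
proof -
  have "(\<lambda>t. \<Sum>v\<in>A. c v * f v t) \<in> L2 \<and> (k \<in> L2 \<longrightarrow> L2_inner (\<lambda>t. \<Sum>v\<in>A. c v * f v t) k = (\<Sum>v\<in>A. c v * L2_inner (f v) k))"
    using assms
  proof (induction A rule: finite_induct)
    case empty
    have "(\<lambda>t. 0) \<in> L2" by (simp add: L2_iff)
    then show ?case by (simp add: L2_inner_def)
  next
    case (insert v A)
    then show ?case by (auto simp: L2_add L2_scale L2_inner_left_add L2_inner_left_scale)
  qed
  then show "(\<lambda>t. \<Sum>v\<in>A. c v * f v t) \<in> L2"
    "k \<in> L2 \<Longrightarrow> L2_inner (\<lambda>t. \<Sum>v\<in>A. c v * f v t) k = (\<Sum>v\<in>A. c v * L2_inner (f v) k)" by auto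
qed

context tf_window
begin

abbreviation dual :: "((real^'d \<Rightarrow> complex) \<Rightarrow> complex) set" where "dual \<equiv> antidual r s g0"

lemma M1_zero: "(\<lambda>_. 0) \<in> M1"
  using M1_scale(1)[OF g0_M1, of 0] by simp

lemma M1_sum:
  assumes "finite A" "\<And>v. v \<in> A \<Longrightarrow> f v \<in> M1"
  shows "(\<lambda>t. \<Sum>v\<in>A. c v * f v t) \<in> M1"
  using assms by (induction A rule: finite_induct) (auto intro!: M1_zero M1_add M1_scale)

lemma dual_add: "\<phi> \<in> dual \<Longrightarrow> h \<in> M1 \<Longrightarrow> k \<in> M1 \<Longrightarrow> \<phi> (\<lambda>t. h t + k t) = \<phi> h + \<phi> k"
  and dual_scale: "\<phi> \<in> dual \<Longrightarrow> h \<in> M1 \<Longrightarrow> \<phi> (\<lambda>t. a * h t) = cnj a * \<phi> h"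
  and dual_off: "\<phi> \<in> dual \<Longrightarrow> h \<notin> M1 \<Longrightarrow> \<phi> h = 0"
  by (auto simp: antidual_def)

lemma dual_zero: "\<phi> \<in> dual \<Longrightarrow> \<phi> (\<lambda>_. 0) = 0"
  using dual_scale[of \<phi> g0 0] g0_M1 by simp

lemma dual_diff: "\<phi> \<in> dual \<Longrightarrow> h \<in> M1 \<Longrightarrow> k \<in> M1 \<Longrightarrow> \<phi> (\<lambda>t. h t - k t) = \<phi> h - \<phi> k"
  using dual_add[of \<phi> h "\<lambda>t. -1 * k t"] dual_scale[of \<phi> k "-1"] M1_scale[of k "-1"] by simp

lemma dual_sum:
  assumes "\<phi> \<in> dual" "finite A" "\<And>v. v \<in> A \<Longrightarrow> f v \<in> M1"
  shows "\<phi> (\<lambda>t. \<Sum>v\<in>A. c v * f v t) = (\<Sum>v\<in>A. cnj (c v) * \<phi> (f v))"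
  using assms(2,3)
proof (induction A rule: finite_induct)
  case empty
  then show ?case by (simp add: dual_zero assms(1))
next
  case (insert v A)
  have "\<phi> (\<lambda>t. c v * f v t + (\<Sum>v\<in>A. c v * f v t)) = \<phi> (\<lambda>t. c v * f v t) + \<phi> (\<lambda>t. \<Sum>v\<in>A. c v * f v t)"
    using insert by (intro dual_add assms(1) M1_scale M1_sum) auto
  also have "\<dots> = cnj (c v) * \<phi> (f v) + (\<Sum>v\<in>A. cnj (c v) * \<phi> (f v))"
    using insert by (simp add: dual_scale assms(1))
  finally show ?case using insert by simp
qed

lemma dual_bound:
  assumes "\<phi> \<in> dual"
  obtains C where "0 \<le> C" "\<And>h. h \<in> M1 \<Longrightarrow> norm (\<phi> h) \<le> C * M1n h"
proof -
  obtain C where C: "\<And>h. h \<in> M1 \<Longrightarrow> norm (\<phi> h) \<le> C * M1n h"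
    using assms unfolding antidual_def by blast
  have "norm (\<phi> h) \<le> \<bar>C\<bar> * M1n h" if "h \<in> M1" for h
    using C[OF that] mult_right_mono[OF abs_ge_self[of C] M1n_nonneg[of h]] by linarith
  then show ?thesis by (intro that[of "\<bar>C\<bar>"]) auto
qed

lemma dual_tendsto_0:
  assumes \<phi>: "\<phi> \<in> dual" and h: "\<And>n. h n \<in> M1" and l: "(\<lambda>n. M1n (h n)) \<longlonglongrightarrow> 0"
  shows "(\<lambda>n. \<phi> (h n)) \<longlonglongrightarrow> 0"
proof -
  obtain C where C: "0 \<le> C" "\<And>h. h \<in> M1 \<Longrightarrow> norm (\<phi> h) \<le> C * M1n h" using dual_bound[OF \<phi>] by blast
  show ?thesis
  proof (rule Lim_null_comparison)
    show "\<forall>\<^sub>F n in sequentially. norm (\<phi> (h n)) \<le> C * M1n (h n)" using C h by simp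
    show "(\<lambda>n. C * M1n (h n)) \<longlonglongrightarrow> 0" using tendsto_mult_right_zero[OF l] by simp
  qed
qed

lemma M1n_tendsto_0:
  assumes "\<And>n. h n \<in> M1" "(\<lambda>n. wint (abs_STFT g0 (h n))) \<longlonglongrightarrow> 0"
  shows "(\<lambda>n. M1n (h n)) \<longlonglongrightarrow> 0"
proof -
  have "(\<lambda>n. ennreal (M1n (h n))) \<longlonglongrightarrow> ennreal 0" using assms wint_M1 by simp
  then show ?thesis by (subst (asm) tendsto_ennreal_iff) (auto simp: M1n_nonneg)
qed

lemma STFT_tf_shift_continuous:
  assumes "a \<in> L2" "k \<in> L2"
  shows "continuous_on UNIV (\<lambda>(u, y). STFT k (tf_shift u a) y)"
proof -
  have e: "(\<lambda>(u, y). STFT k (tf_shift u a) y) =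
     (\<lambda>p. phase (- (snd (snd p - fst p) \<bullet> fst (fst p))) * STFT k a (snd p - fst p))"
    using L2_inner_tf_shifts[OF assms] by (auto simp: fun_eq_iff STFT_eq[of k "tf_shift _ a"])
  show ?thesis unfolding e
    by (intro continuous_intros continuous_on_compose2[OF STFT_continuous[OF assms]]) auto
qed

text \<open>Dominated convergence against the weight. It needs one majorant for the transforms of
  all \<open>tf_shift (Z n) k\<close> at once, and \<open>local_majorant\<close> provides it: as
  soon as Z n is near z, all of them lie below H (y - z).\<close>

lemma M1_tf_shift_continuous:
  assumes k: "k \<in> M1" and Z: "Z \<longlonglongrightarrow> z"
  shows "(\<lambda>n. M1n (\<lambda>t. tf_shift (Z n) k t - tf_shift z k t)) \<longlonglongrightarrow> 0"
proof -
  have L2: "k \<in> L2" using k by (rule M1_L2)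
  obtain H where H: "local_majorant (abs_STFT g0 k) H" using STFT_local_majorant[OF k g0_M1] by blast
  then have [measurable]: "H \<in> borel_measurable borel" and Hf: "wint H < \<infinity>" and Hm: "\<And>z u. norm u \<le> 1 \<Longrightarrow> abs_STFT g0 k (z + u) \<le> H z"
    unfolding local_majorant_def by blast+
  have "\<forall>\<^sub>F n in sequentially. dist (Z n) z < 1" using Z by (intro tendstoD) auto
  then obtain N where N: "\<And>n. n \<ge> N \<Longrightarrow> dist (Z n) z < 1" by (auto simp: eventually_sequentially)
  \<comment> \<open>The first N terms are dropped so that Z stays within distance 1 of z, the radius
    of the local majorant.\<close>
  define D where "D n = (\<lambda>t. tf_shift (Z (n + N)) k t - tf_shift z k t)" for n
  have D: "D n \<in> M1" for n unfolding D_def by (intro M1_diff M1_tf_shift k)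
  have VD: "STFT g0 (D n) y = STFT g0 (tf_shift (Z (n + N)) k) y - STFT g0 (tf_shift z k) y" for n y
    unfolding D_def STFT_eq by (intro L2_inner_left_diff tf_shift_L2 L2 g0_L2)
  have "(\<lambda>n. wint (abs_STFT g0 (D n))) \<longlonglongrightarrow> (\<integral>\<^sup>+y. 0 \<partial>(lborel :: ((real^'d) \<times> (real^'d)) measure))"
    unfolding weighted_integral_def
  proof (rule nn_integral_dominated_convergence[where w = "\<lambda>y. 2 * (H (y - z) * ennreal (w y))"])
    show "(\<lambda>y. abs_STFT g0 (D n) y * ennreal (w y)) \<in> borel_measurable lborel" for n
      using abs_STFT_measurable[OF M1_L2[OF D] g0_L2] by measurable
    show "AE y in lborel. abs_STFT g0 (D n) y * ennreal (w y) \<le> 2 * (H (y - z) * ennreal (w y))" for n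
    proof (intro always_eventually allI)
      fix y
      have 1: "abs_STFT g0 (tf_shift z k) y \<le> H (y - z)"
        using Hm[of 0 "y - z"] by (simp add: norm_STFT_tf_shift[OF L2 g0_L2])
      have "norm (z - Z (n + N)) \<le> 1" using N[of "n + N"] by (simp add: dist_norm norm_minus_commute)
      from Hm[OF this, of "y - z"] have 2: "abs_STFT g0 (tf_shift (Z (n + N)) k) y \<le> H (y - z)"
        by (simp add: norm_STFT_tf_shift[OF L2 g0_L2])
      have "abs_STFT g0 (D n) y \<le> abs_STFT g0 (tf_shift (Z (n + N)) k) y + abs_STFT g0 (tf_shift z k) y"
        unfolding VD by (simp add: norm_triangle_ineq4 ennreal_leI flip: ennreal_plus)
      also have "\<dots> \<le> 2 * H (y - z)" using add_mono[OF 2 1] by (simp add: mult_2)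
      finally have "abs_STFT g0 (D n) y * ennreal (w y) \<le> 2 * H (y - z) * ennreal (w y)" by (intro mult_right_mono) auto
      then show "abs_STFT g0 (D n) y * ennreal (w y) \<le> 2 * (H (y - z) * ennreal (w y))" by (simp add: mult.assoc)
    qed
    have "(\<integral>\<^sup>+y. H (y - z) * ennreal (w y) \<partial>lborel) < \<infinity>"
      using order_le_less_trans[OF wint_shift[of H z]] Hf by (simp add: weighted_integral_def ennreal_mult_less_top)
    then show "(\<integral>\<^sup>+y. 2 * (H (y - z) * ennreal (w y)) \<partial>lborel) < \<infinity>"
      by (subst nn_integral_cmult) (auto simp: ennreal_mult_less_top)
    show "AE y in lborel. (\<lambda>n. abs_STFT g0 (D n) y * ennreal (w y)) \<longlonglongrightarrow> 0"
    proof (intro always_eventually allI)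
      fix y :: "(real^'d) \<times> (real^'d)"
      have "(\<lambda>n. (Z (n + N), y)) \<longlonglongrightarrow> (z, y)"
        by (intro tendsto_intros LIMSEQ_ignore_initial_segment Z)
      then have "(\<lambda>n. STFT g0 (tf_shift (Z (n + N)) k) y) \<longlonglongrightarrow> STFT g0 (tf_shift z k) y"
        using continuous_on_tendsto_compose[OF STFT_tf_shift_continuous[OF L2 g0_L2], of "\<lambda>n. (Z (n + N), y)" "(z, y)" sequentially] by simp
      then have "(\<lambda>n. STFT g0 (tf_shift (Z (n + N)) k) y - STFT g0 (tf_shift z k) y) \<longlonglongrightarrow> 0"
        by (simp add: LIM_zero)
      then have "(\<lambda>n. norm (STFT g0 (D n) y) * w y) \<longlonglongrightarrow> norm (0 :: complex) * w y"
        unfolding VD by (intro tendsto_intros)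
      then have "(\<lambda>n. ennreal (norm (STFT g0 (D n) y) * w y)) \<longlonglongrightarrow> ennreal (norm (0 :: complex) * w y)" by (rule tendsto_ennrealI)
      then show "(\<lambda>n. abs_STFT g0 (D n) y * ennreal (w y)) \<longlonglongrightarrow> 0" by (simp add: ennreal_mult)
    qed
  qed auto
  then have "(\<lambda>n. M1n (D n)) \<longlonglongrightarrow> 0" by (intro M1n_tendsto_0 D) simp
  then show ?thesis unfolding D_def by (rule LIMSEQ_offset)
qed

text \<open>The transform of a functional is not given by an integral; its continuity is what
  supplies measurability.\<close>

lemma STFT_dual_continuous:
  assumes \<phi>: "\<phi> \<in> dual" and k: "k \<in> M1"
  shows "continuous_on UNIV (STFT_dual k \<phi>)"
  unfolding continuous_on_sequentially comp_def
proof (intro allI ballI impI)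
  fix Z :: "nat \<Rightarrow> (real^'d) \<times> (real^'d)" and z assume "(\<forall>n. Z n \<in> UNIV) \<and> Z \<longlonglongrightarrow> z"
  then have "(\<lambda>n. M1n (\<lambda>t. tf_shift (Z n) k t - tf_shift z k t)) \<longlonglongrightarrow> 0"
    using M1_tf_shift_continuous[OF k] by blast
  then have "(\<lambda>n. \<phi> (\<lambda>t. tf_shift (Z n) k t - tf_shift z k t)) \<longlonglongrightarrow> 0"
    by (intro dual_tendsto_0 \<phi> M1_diff M1_tf_shift k)
  then show "(\<lambda>n. STFT_dual k \<phi> (Z n)) \<longlonglongrightarrow> STFT_dual k \<phi> z"
    by (simp add: dual_diff[OF \<phi> M1_tf_shift(1)[OF k] M1_tf_shift(1)[OF k]] STFT_dual_eq LIM_zero_iff)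
qed

lemma STFT_dual_measurable:
  assumes "\<phi> \<in> dual" "k \<in> M1"
  shows "STFT_dual k \<phi> \<in> borel_measurable borel"
  by (rule borel_measurable_continuous_onI[OF STFT_dual_continuous[OF assms]])

text \<open>The transform of a functional may grow, but no faster than the weight. This makes the
  reproducing integral converge against transforms integrable with the weight.\<close>

lemma STFT_dual_bound:
  assumes \<phi>: "\<phi> \<in> dual" and k: "k \<in> M1"
  obtains C where "0 \<le> C" "\<And>z. norm (STFT_dual k \<phi> z) \<le> C * w z"
proof -
  obtain C where C: "0 \<le> C" "\<And>h. h \<in> M1 \<Longrightarrow> norm (\<phi> h) \<le> C * M1n h" using dual_bound[OF \<phi>] by blast
  have "norm (STFT_dual k \<phi> z) \<le> (C * M1n k) * w z" for z
    using C(2)[OF M1_tf_shift(1)[OF k, of z]] mult_left_mono[OF M1_tf_shift(2)[OF k, of z] C(1)]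
    by (simp add: STFT_dual_eq mult_ac)
  then show ?thesis using C M1n_nonneg by (intro that[of "C * M1n k"]) auto
qed

text \<open>A vector-valued integral of V u times \<open>tf_shift u a\<close> is avoided: the finite
  sums \<open>hn n\<close> of shifts approximate |a|^2 h in M^1, \<phi> passes through these sums,
  and the limit is taken among scalars. Moyal's identity computes the transform of |a|^2 h. The
  error in M^1 is at most the integral of |V u| times the M^1 distance between the shifts of a by
  \<sigma> n u and by u, which tends to 0.\<close>

theorem dual_reproducing:
  assumes \<phi>: "\<phi> \<in> dual" and a: "a \<in> M1" and h: "h \<in> M1"
  shows "of_real ((L2_norm a)\<^sup>2) * \<phi> h = (\<integral>y. STFT_dual a \<phi> y * cnj (STFT a h y) \<partial>lborel)"
proof -
  have aL: "a \<in> L2" and hL: "h \<in> L2" using a h by (auto intro: M1_L2)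
  define V where "V = STFT a h"
  have Vfin: "wint (\<lambda>z. ennreal (norm (V z))) < \<infinity>"
    using order_le_less_trans[OF wint_STFT_le[OF h a]] by (simp add: V_def)
  have V: "integrable lborel V" unfolding V_def by (intro STFT_integrable hL aL Vfin[unfolded V_def])
  have Vm[measurable]: "V \<in> borel_measurable borel" unfolding V_def by (intro STFT_measurable hL aL)
  have Vw: "integrable lborel (\<lambda>u. norm (V u) * w u)"
    using Vfin by (simp add: integrable_iff_bounded weighted_integral_def abs_mult ennreal_mult)
  obtain \<sigma> :: "nat \<Rightarrow> (real^'d) \<times> (real^'d) \<Rightarrow> (real^'d) \<times> (real^'d)"
    where \<sigma>m[measurable]: "\<And>n. \<sigma> n \<in> borel_measurable borel" and fin: "\<And>n. finite (range (\<sigma> n))" and \<sigma>: "\<And>z. (\<lambda>n. \<sigma> n z) \<longlonglongrightarrow> z"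
    and \<sigma>b: "\<And>n z. norm (fst (\<sigma> n z)) \<le> 2 * norm (fst z)" "\<And>n z. norm (snd (\<sigma> n z)) \<le> 2 * norm (snd z)"
    using componentwise_simple_approximation by blast
  \<comment> \<open>The factor 2 in the component bounds of \<sigma>, raised to the exponents of the
    weight.\<close>
  define K where "K = 2 powr r * 2 powr s"
  have K: "0 \<le> K" by (simp add: K_def)
  have w\<sigma>: "w (\<sigma> n u) \<le> K * w u" for n u
  proof -
    have *: "(1 + norm x) powr q \<le> 2 powr q * (1 + norm y) powr q" if "norm x \<le> 2 * norm y" "0 \<le> q" for x y :: "real^'d" and q
    proof -
      have "1 + norm x \<le> 2 * (1 + norm y)" using that by simp
      then have "(1 + norm x) powr q \<le> (2 * (1 + norm y)) powr q" using that by (intro powr_mono2) auto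
      also have "\<dots> = 2 powr q * (1 + norm y) powr q" by (rule powr_mult)
      finally show ?thesis .
    qed
    show ?thesis unfolding tf_weight_eq K_def using mult_mono[OF *[OF \<sigma>b(1) r] *[OF \<sigma>b(2) s]] by (simp add: mult_ac)
  qed
  define c where "c n v = (\<integral>u. V u * indicator (\<sigma> n -` {v}) u \<partial>lborel)" for n v
  define hn where "hn n = (\<lambda>t. \<Sum>v\<in>range (\<sigma> n). c n v * tf_shift v a t)" for n
  have hnM: "hn n \<in> M1" for n unfolding hn_def by (intro M1_sum fin M1_tf_shift a)
  let ?N = "complex_of_real ((L2_norm a)\<^sup>2)"
  define D where "D n = (\<lambda>t. ?N * h t - hn n t)" for n
  have DM: "D n \<in> M1" for n unfolding D_def by (intro M1_diff M1_scale h hnM)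
  \<comment> \<open>By Moyal's identity, integrating V u * X u y over u gives |a|^2 times
    \<open>STFT g0 h y\<close>; sampling u through \<sigma> n gives the transform of
    \<open>hn n\<close> instead.\<close>
  define X where "X u y = STFT g0 (tf_shift u a) y" for u y
  have Xm: "(\<lambda>(u, y). X u y) \<in> borel_measurable (borel \<Otimes>\<^sub>M borel)"
    unfolding X_def borel_prod by (rule borel_measurable_continuous_onI[OF STFT_tf_shift_continuous[OF aL g0_L2]])
  have X1[measurable]: "(\<lambda>p. X (fst p) (snd p)) \<in> borel_measurable (borel \<Otimes>\<^sub>M borel)"
    using Xm by (simp add: split_beta')
  have X2[measurable]: "(\<lambda>p. X (\<sigma> n (fst p)) (snd p)) \<in> borel_measurable (borel \<Otimes>\<^sub>M borel)" for n
    using measurable_compose[OF _ Xm, of "\<lambda>p. (\<sigma> n (fst p), snd p)" "borel \<Otimes>\<^sub>M borel"] by simp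
  have X3[measurable]: "(\<lambda>p. X (snd p) (fst p)) \<in> borel_measurable (borel \<Otimes>\<^sub>M borel)"
    using measurable_compose[OF _ Xm, of "\<lambda>p. (snd p, fst p)" "borel \<Otimes>\<^sub>M borel"] by simp
  have X4[measurable]: "(\<lambda>p. X (\<sigma> n (snd p)) (fst p)) \<in> borel_measurable (borel \<Otimes>\<^sub>M borel)" for n
    using measurable_compose[OF _ Xm, of "\<lambda>p. (\<sigma> n (snd p), fst p)" "borel \<Otimes>\<^sub>M borel"] by simp
  define E where "E n u = wint (\<lambda>y. ennreal (norm (X u y - X (\<sigma> n u) y)))" for n u
  have E: "E n u = ennreal (M1n (\<lambda>t. tf_shift (\<sigma> n u) a t - tf_shift u a t))" for n u
  proof -
    have "STFT g0 (\<lambda>t. tf_shift (\<sigma> n u) a t - tf_shift u a t) y = X (\<sigma> n u) y - X u y" for y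
      unfolding X_def STFT_eq by (intro L2_inner_left_diff tf_shift_L2 aL g0_L2)
    then show ?thesis
      using wint_M1[OF M1_diff[OF M1_tf_shift(1)[OF a, of "\<sigma> n u"] M1_tf_shift(1)[OF a, of u]]]
      by (simp add: E_def norm_minus_commute)
  qed
  have Em[measurable]: "E n \<in> borel_measurable borel" for n
    unfolding E_def[abs_def] weighted_integral_def by measurable
  \<comment> \<open>Minkowski's integral inequality for the weighted \<open>L1\<close> norm, that
    is, Tonelli.\<close>
  have wD: "wint (abs_STFT g0 (D n)) \<le> (\<integral>\<^sup>+u. ennreal (norm (V u)) * E n u \<partial>lborel)" for n
  proof -
    have "abs_STFT g0 (D n) y \<le> (\<integral>\<^sup>+u. ennreal (norm (V u)) * ennreal (norm (X u y - X (\<sigma> n u) y)) \<partial>lborel)" for y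
    proof -
      have k: "tf_shift y g0 \<in> L2" by (intro tf_shift_L2 g0_L2)
      have cX: "cnj (STFT a (tf_shift y g0) u) = X u y" for u
        by (simp add: STFT_eq X_def L2_inner_cnj[of "tf_shift y g0"])
      note M = Moyal[OF hL aL k aL V[unfolded V_def]]
      have "STFT g0 (\<lambda>t. ?N * h t) y = (\<integral>u. V u * X u y \<partial>lborel)"
      proof -
        have "(\<integral>u. V u * X u y \<partial>lborel) = L2_inner h (tf_shift y g0) * cnj (L2_inner a a)"
          using M(1) by (simp only: cX V_def)
        then show ?thesis
          unfolding STFT_eq L2_inner_left_scale by (simp add: L2_inner_self mult.commute)
      qed
      moreover have "STFT g0 (hn n) y = (\<integral>u. V u * X (\<sigma> n u) y \<partial>lborel)"
        unfolding hn_def STFT_eq[of g0] X_def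
        by (subst L2_sum(2)) (auto intro: fin tf_shift_L2 aL g0_L2 simp: integral_finite_range[OF V \<sigma>m[of n] fin[of n], of "\<lambda>v. L2_inner (tf_shift v a) (tf_shift y g0)"] c_def)
      ultimately have eq: "STFT g0 (D n) y = (\<integral>u. V u * X u y \<partial>lborel) - (\<integral>u. V u * X (\<sigma> n u) y \<partial>lborel)"
        unfolding D_def using L2_inner_left_diff[of "\<lambda>t. ?N * h t" "hn n" "tf_shift y g0"] hL hnM[of n] k
        by (simp add: STFT_eq L2_scale M1_L2)
      have i1: "integrable lborel (\<lambda>u. V u * X u y)"
        using M(2) by (simp add: cX V_def)
      have i2: "integrable lborel (\<lambda>u. V u * X (\<sigma> n u) y)"
      proof (rule Bochner_Integration.integrable_bound)
        show "integrable lborel (\<lambda>u. V u * of_real (L2_norm a * L2_norm g0))" using V by simp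
        show "(\<lambda>u. V u * X (\<sigma> n u) y) \<in> borel_measurable lborel"
          using measurable_compose[OF _ Xm, of "\<lambda>u. (\<sigma> n u, y)" borel] by simp
        have "norm (X v y) \<le> L2_norm a * L2_norm g0" for v
          unfolding X_def using norm_STFT_bound[OF tf_shift_L2[OF aL, of v] g0_L2, of y] by (simp add: tf_shift_L2_norm aL)
        then show "AE u in lborel. norm (V u * X (\<sigma> n u) y) \<le> norm (V u * of_real (L2_norm a * L2_norm g0))"
          by (auto simp: norm_mult L2_norm_nonneg mult_left_mono)
      qed
      have "STFT g0 (D n) y = (\<integral>u. V u * X u y - V u * X (\<sigma> n u) y \<partial>lborel)"
        unfolding eq using i1 i2 by simp
      then have "abs_STFT g0 (D n) y \<le> (\<integral>\<^sup>+u. ennreal (norm (V u * X u y - V u * X (\<sigma> n u) y)) \<partial>lborel)"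
        using integral_norm_bound_ennreal[OF Bochner_Integration.integrable_diff[OF i1 i2]] by simp
      also have "\<dots> = (\<integral>\<^sup>+u. ennreal (norm (V u)) * ennreal (norm (X u y - X (\<sigma> n u) y)) \<partial>lborel)"
        by (intro nn_integral_cong) (simp add: norm_mult ennreal_mult flip: right_diff_distrib)
      finally show ?thesis .
    qed
    then have "wint (abs_STFT g0 (D n)) \<le> wint (\<lambda>y. \<integral>\<^sup>+u. ennreal (norm (V u)) * ennreal (norm (X u y - X (\<sigma> n u) y)) \<partial>lborel)"
      by (intro weighted_integral_mono)
    also have "\<dots> = (\<integral>\<^sup>+y. (\<integral>\<^sup>+u. ennreal (norm (V u)) * (ennreal (norm (X u y - X (\<sigma> n u) y)) * ennreal (w y)) \<partial>lborel) \<partial>lborel)"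
      unfolding weighted_integral_def
    proof (intro nn_integral_cong)
      fix y
      have [measurable]: "(\<lambda>u. X u y) \<in> borel_measurable borel" "(\<lambda>u. X (\<sigma> n u) y) \<in> borel_measurable borel"
        using measurable_compose[OF _ Xm, of "\<lambda>u. (\<sigma> n u, y)" borel] measurable_compose[OF _ Xm, of "\<lambda>u. (u, y)" borel] by simp_all
      show "(\<integral>\<^sup>+u. ennreal (norm (V u)) * ennreal (norm (X u y - X (\<sigma> n u) y)) \<partial>lborel) * ennreal (w y) =
        (\<integral>\<^sup>+u. ennreal (norm (V u)) * (ennreal (norm (X u y - X (\<sigma> n u) y)) * ennreal (w y)) \<partial>lborel)"
        by (subst nn_integral_multc[symmetric]) (measurable, simp add: mult.assoc)
    qed
    also have "\<dots> = (\<integral>\<^sup>+u. (\<integral>\<^sup>+y. ennreal (norm (V u)) * (ennreal (norm (X u y - X (\<sigma> n u) y)) * ennreal (w y)) \<partial>lborel) \<partial>lborel)"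
      by (rule lborel_pair.Fubini'[symmetric]) measurable
    also have "\<dots> = (\<integral>\<^sup>+u. ennreal (norm (V u)) * E n u \<partial>lborel)"
      unfolding E_def weighted_integral_def
    proof (intro nn_integral_cong nn_integral_cmult)
      fix u
      have [measurable]: "X v \<in> borel_measurable borel" for v
        using measurable_compose[OF _ Xm, of "\<lambda>y. (v, y)" borel] by simp
      show "(\<lambda>y. ennreal (norm (X u y - X (\<sigma> n u) y)) * ennreal (w y)) \<in> borel_measurable lborel" by measurable
    qed
    finally show ?thesis .
  qed
  have "(\<lambda>n. \<integral>\<^sup>+u. ennreal (norm (V u)) * E n u \<partial>lborel) \<longlonglongrightarrow> (\<integral>\<^sup>+u. 0 \<partial>(lborel :: ((real^'d) \<times> (real^'d)) measure))"
  proof (rule nn_integral_dominated_convergence[where w = "\<lambda>u. ennreal ((K + 1) * M1n a) * ennreal (norm (V u) * w u)"])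
    \<comment> \<open>Each of the two shifts is bounded in M^1 by its weight, and w (\<sigma> n u)
      \<le> K * w u; hence the constant K + 1.\<close>
    have Eb: "E n u \<le> ennreal ((K + 1) * M1n a * w u)" for n u
    proof -
      have "M1n (\<lambda>t. tf_shift (\<sigma> n u) a t + (-1) * tf_shift u a t) \<le> M1n (tf_shift (\<sigma> n u) a) + M1n (\<lambda>t. (-1) * tf_shift u a t)"
        by (intro M1_add(2) M1_tf_shift M1_scale a)
      also have "\<dots> \<le> w (\<sigma> n u) * M1n a + norm (-1::complex) * M1n (tf_shift u a)"
        by (intro add_mono M1_tf_shift M1_scale a)
      also have "\<dots> \<le> K * w u * M1n a + w u * M1n a"
        using M1_tf_shift(2)[OF a, of u] w\<sigma>[of n u] by (intro add_mono mult_right_mono M1n_nonneg) auto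
      finally show ?thesis unfolding E by (intro ennreal_leI) (simp add: algebra_simps)
    qed
    show "AE u in lborel. ennreal (norm (V u)) * E n u \<le> ennreal ((K + 1) * M1n a) * ennreal (norm (V u) * w u)" for n
    proof (intro always_eventually allI)
      fix u
      have "ennreal (norm (V u)) * E n u \<le> ennreal (norm (V u)) * ennreal ((K + 1) * M1n a * w u)" by (intro mult_left_mono Eb) auto
      also have "\<dots> = ennreal ((K + 1) * M1n a) * ennreal (norm (V u) * w u)"
        using K by (simp add: ennreal_mult[symmetric] M1n_nonneg mult_ac)
      finally show "ennreal (norm (V u)) * E n u \<le> ennreal ((K + 1) * M1n a) * ennreal (norm (V u) * w u)" .
    qed
    show "(\<integral>\<^sup>+u. ennreal ((K + 1) * M1n a) * ennreal (norm (V u) * w u) \<partial>lborel) < \<infinity>"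
      using Vw by (subst nn_integral_cmult) (auto simp: integrable_iff_bounded ennreal_mult_less_top abs_mult)
    show "AE u in lborel. (\<lambda>n. ennreal (norm (V u)) * E n u) \<longlonglongrightarrow> 0"
    proof (intro always_eventually allI)
      fix u
      have "(\<lambda>n. ennreal (norm (V u) * M1n (\<lambda>t. tf_shift (\<sigma> n u) a t - tf_shift u a t))) \<longlonglongrightarrow> ennreal (norm (V u) * 0)"
        by (intro tendsto_ennrealI tendsto_mult tendsto_const M1_tf_shift_continuous a \<sigma>)
      then show "(\<lambda>n. ennreal (norm (V u)) * E n u) \<longlonglongrightarrow> 0" by (simp add: E ennreal_mult M1n_nonneg)
    qed
  qed auto
  then have lim0: "(\<lambda>n. \<integral>\<^sup>+u. ennreal (norm (V u)) * E n u \<partial>lborel) \<longlonglongrightarrow> 0" by simp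
  have "(\<lambda>n. wint (abs_STFT g0 (D n))) \<longlonglongrightarrow> 0"
    by (rule tendsto_sandwich[OF _ _ tendsto_const lim0]) (use wD in \<open>simp_all\<close>)
  then have "(\<lambda>n. \<phi> (D n)) \<longlonglongrightarrow> 0"
    by (intro dual_tendsto_0[OF \<phi> DM] M1n_tendsto_0 DM)
  moreover have "\<phi> (D n) = ?N * \<phi> h - (\<integral>u. cnj (V u) * STFT_dual a \<phi> (\<sigma> n u) \<partial>lborel)" for n
  proof -
    have "integrable lborel (\<lambda>u. cnj (V u))" using V by simp
    from integral_finite_range[OF this \<sigma>m[of n] fin[of n], of "STFT_dual a \<phi>"]
    have "(\<integral>u. cnj (V u) * STFT_dual a \<phi> (\<sigma> n u) \<partial>lborel) = (\<Sum>v\<in>range (\<sigma> n). (\<integral>u. cnj (V u) * indicator (\<sigma> n -` {v}) u \<partial>lborel) * \<phi> (tf_shift v a))"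
      by (simp add: STFT_dual_eq)
    also have "\<dots> = (\<Sum>v\<in>range (\<sigma> n). cnj (c n v) * \<phi> (tf_shift v a))"
    proof (rule sum.cong[OF refl])
      fix v
      have "cnj (c n v) = (\<integral>u. cnj (V u * indicator (\<sigma> n -` {v}) u) \<partial>lborel)"
        unfolding c_def by (rule Bochner_Integration.integral_cnj[symmetric])
      also have "\<dots> = (\<integral>u. cnj (V u) * indicator (\<sigma> n -` {v}) u \<partial>lborel)"
        by (rule Bochner_Integration.integral_cong) (auto simp: indicator_def)
      finally show "(\<integral>u. cnj (V u) * indicator (\<sigma> n -` {v}) u \<partial>lborel) * \<phi> (tf_shift v a) = cnj (c n v) * \<phi> (tf_shift v a)"
        by simp
    qed
    also have "\<dots> = \<phi> (hn n)"
      unfolding hn_def by (rule dual_sum[symmetric]) (auto intro: \<phi> fin M1_tf_shift a)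
    finally show ?thesis
      unfolding D_def using dual_diff[OF \<phi> M1_scale(1)[OF h, of ?N] hnM] dual_scale[OF \<phi> h, of ?N] by simp
  qed
  moreover have "(\<lambda>n. \<integral>u. cnj (V u) * STFT_dual a \<phi> (\<sigma> n u) \<partial>lborel) \<longlonglongrightarrow> (\<integral>u. cnj (V u) * STFT_dual a \<phi> u \<partial>lborel)"
  proof -
    obtain C where C: "0 \<le> C" "\<And>z. norm (STFT_dual a \<phi> z) \<le> C * w z" using STFT_dual_bound[OF \<phi> a] by blast
    have [measurable]: "STFT_dual a \<phi> \<in> borel_measurable borel" by (rule STFT_dual_measurable[OF \<phi> a])
    show ?thesis
    proof (rule integral_dominated_convergence[where w = "\<lambda>u. C * K * (norm (V u) * w u)"])
      show "integrable lborel (\<lambda>u. C * K * (norm (V u) * w u))" using Vw by simp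
      show "AE u in lborel. (\<lambda>n. cnj (V u) * STFT_dual a \<phi> (\<sigma> n u)) \<longlonglongrightarrow> cnj (V u) * STFT_dual a \<phi> u"
      proof (intro always_eventually allI tendsto_mult tendsto_const)
        fix u
        show "(\<lambda>n. STFT_dual a \<phi> (\<sigma> n u)) \<longlonglongrightarrow> STFT_dual a \<phi> u"
          by (rule continuous_on_tendsto_compose[OF STFT_dual_continuous[OF \<phi> a] \<sigma>]) auto
      qed
      show "AE u in lborel. norm (cnj (V u) * STFT_dual a \<phi> (\<sigma> n u)) \<le> C * K * (norm (V u) * w u)" for n
      proof (intro always_eventually allI)
        fix u
        have "norm (STFT_dual a \<phi> (\<sigma> n u)) \<le> C * (K * w u)"
          using C(2)[of "\<sigma> n u"] mult_left_mono[OF w\<sigma>[of n u] C(1)] by linarith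
        from mult_left_mono[OF this, of "norm (V u)"] show "norm (cnj (V u) * STFT_dual a \<phi> (\<sigma> n u)) \<le> C * K * (norm (V u) * w u)"
          by (simp add: norm_mult mult_ac)
      qed
    qed measurable
  qed
  ultimately have "(\<lambda>n. ?N * \<phi> h - \<phi> (D n)) \<longlonglongrightarrow> (\<integral>u. cnj (V u) * STFT_dual a \<phi> u \<partial>lborel)"
    "(\<lambda>n. ?N * \<phi> h - \<phi> (D n)) \<longlonglongrightarrow> ?N * \<phi> h - 0"
    by (simp, intro tendsto_intros)
  then have "?N * \<phi> h = (\<integral>u. cnj (V u) * STFT_dual a \<phi> u \<partial>lborel)"
    using LIMSEQ_unique by fastforce
  then show ?thesis by (simp add: V_def mult.commute)
qed

end

section \<open>Analysis and synthesis\<close>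

lemma measurable_pair_measure_countable2:
  assumes "countable A" and f: "\<And>y. y \<in> A \<Longrightarrow> (\<lambda>x. f x y) \<in> measurable N K"
  shows "(\<lambda>(x, y). f x y) \<in> measurable (N \<Otimes>\<^sub>M count_space A) K"
  unfolding split_beta'
  by (rule measurable_compose_countable'[where f = "\<lambda>y p. f (fst p) y" and g = snd and I = A])
    (use assms in \<open>auto intro: measurable_compose[OF measurable_fst]\<close>)

lemma norm_integral_le_nn_integral:
  fixes f :: "'a \<Rightarrow> 'b::{banach, second_countable_topology}"
  shows "ennreal (norm (integral\<^sup>L M f)) \<le> (\<integral>\<^sup>+x. ennreal (norm (f x)) \<partial>M)"
  by (cases "integrable M f") (auto intro: integral_norm_bound_ennreal simp: not_integrable_integral_eq)

text \<open>Schur's test with a one-point target: V is the only row, and the supremum of V bounds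
  the columns. No conjugate exponent appears.\<close>

lemma Lp_pairing:
  assumes p: "1 \<le> p" and C: "0 \<le> C" and M: "sigma_finite_measure M"
    and V[measurable]: "V \<in> borel_measurable M" and int: "(\<integral>\<^sup>+y. V y \<partial>M) \<le> ennreal C" and sup: "\<And>y. V y \<le> ennreal C"
    and F: "Lp_bounded p M F a"
  shows "(\<integral>\<^sup>+y. V y * ennreal (norm (F y)) \<partial>M) \<le> ennreal (C * a)"
proof (cases "C = 0")
  case True
  then have "V y = 0" for y using sup[of y] by simp
  then show ?thesis by simp
next
  case False
  then have C0: "0 < C" using C by simp
  have a: "0 \<le> a" using F by (rule Lp_boundedD)
  let ?I = "\<integral>\<^sup>+y. V y * ennreal (norm (F y)) \<partial>M"
  have le: "t \<le> C * a" if t: "0 \<le> t" "ennreal t \<le> ?I" for t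
  proof -
    have "Lp_bounded p (count_space {()}) (\<lambda>_. of_real t) (C * a)"
    proof (rule Schur_test[OF p C0 M _ _ _ _ F, where K = "\<lambda>_. V"])
      show "sigma_finite_measure (count_space {()})" by (intro sigma_finite_measure_count_space_countable) auto
      show "(\<integral>\<^sup>+z. V y \<partial>count_space {()}) \<le> ennreal C" for y using sup[of y] by (simp add: nn_integral_count_space_finite)
    qed (use int t in \<open>auto simp: abs_of_nonneg\<close>)
    from Lp_bounded_count_space_pointwise[OF p this] show ?thesis using t by simp
  qed
  show ?thesis
  proof (cases ?I)
    case (real x)
    then show ?thesis using le[of x] by (simp add: ennreal_leI)
  next
    case top
    then have "C * a + 1 \<le> C * a" using C a by (intro le) auto
    then show ?thesis by simp
  qed
qed

text \<open>The left inverse yields what is still missing: vanishing coefficients force \<phi> = 0,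
  and boundedness of R is the lower frame bound.\<close>

lemma banach_frame_of_left_inverse:
  assumes B: "fun_banach_space B Nb" and X: "fun_subspace X" and N: "\<And>\<phi>. \<phi> \<in> X \<Longrightarrow> 0 \<le> N \<phi>"
    and gs: "\<And>j. j \<in> I \<Longrightarrow> gs j \<in> H"
    and C: "\<And>\<phi>. \<phi> \<in> X \<Longrightarrow> frame_coeffs I gs \<phi> \<in> B" and c: "0 < c" "\<And>\<phi>. \<phi> \<in> X \<Longrightarrow> Nb (frame_coeffs I gs \<phi>) \<le> c * N \<phi>"
    and R: "bounded_linear_between B Nb X N R" "\<And>\<phi>. \<phi> \<in> X \<Longrightarrow> R (frame_coeffs I gs \<phi>) = \<phi>"
  shows "banach_frame H X N B Nb I gs"
proof -
  let ?C = "frame_coeffs I gs"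
  have nb: "is_norm_on B Nb" using B by (simp add: fun_banach_space_def)
  have Cadd: "?C (\<lambda>x. f x + h x) = (\<lambda>j. ?C f j + ?C h j)" for f h by (auto simp: frame_coeffs_def)
  have Cscale: "?C (\<lambda>x. a * f x) = (\<lambda>j. a * ?C f j)" for a f by (auto simp: frame_coeffs_def)
  have inj: "?C \<phi> = (\<lambda>_. 0) \<longleftrightarrow> \<phi> = (\<lambda>_. 0)" if \<phi>: "\<phi> \<in> X" for \<phi>
  proof
    assume 0: "?C \<phi> = (\<lambda>_. 0)"
    have "R (\<lambda>j. 0 * ?C \<phi> j) = (\<lambda>y. 0 * R (?C \<phi>) y)"
      using R(1) C[OF \<phi>] unfolding bounded_linear_between_def by blast
    then have "R (?C \<phi>) = (\<lambda>_. 0)" using 0 by simp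
    then show "\<phi> = (\<lambda>_. 0)" using R(2)[OF \<phi>] by simp
  qed (auto simp: frame_coeffs_def)
  obtain K where K: "\<And>b. b \<in> B \<Longrightarrow> N (R b) \<le> K * Nb b"
    using R(1) unfolding bounded_linear_between_def by blast
  have "is_norm_on X (\<lambda>\<phi>. Nb (?C \<phi>))"
    using nb C inj unfolding is_norm_on_def by (simp add: Cadd Cscale)
  \<comment> \<open>K may fail to be positive, whereas the lower bound needs a positive
    constant.\<close>
  moreover have "1 / max K 1 * N \<phi> \<le> Nb (?C \<phi>)" if \<phi>: "\<phi> \<in> X" for \<phi>
  proof -
    have "0 \<le> Nb (?C \<phi>)" using nb C[OF \<phi>] by (auto simp: is_norm_on_def)
    then have "N \<phi> \<le> max K 1 * Nb (?C \<phi>)"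
      using K[OF C[OF \<phi>]] R(2)[OF \<phi>] mult_right_mono[of K "max K 1" "Nb (?C \<phi>)"] by simp
    then show ?thesis by (simp add: field_simps)
  qed
  then have "equivalent_on X N (\<lambda>\<phi>. Nb (?C \<phi>))"
    unfolding equivalent_on_def using c by (intro exI[of _ "1 / max K 1"] exI[of _ c] conjI ballI) (auto simp: less_max_iff_disj)
  ultimately show ?thesis
    unfolding banach_frame_def using B gs C R by blast
qed

locale frame_setup = tf_window r s g0 for r s :: real and g0 :: "real^'d \<Rightarrow> complex" +
  fixes p :: ennreal and g :: "real^'d \<Rightarrow> complex"
  assumes p: "1 \<le> p" and g: "g \<in> M1_space r s g0" and norm_g: "L2_norm g = 1"
begin

abbreviation X :: "((real^'d \<Rightarrow> complex) \<Rightarrow> complex) set" where "X \<equiv> modulation_space p r s g0"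
abbreviation N :: "((real^'d \<Rightarrow> complex) \<Rightarrow> complex) \<Rightarrow> real" where "N \<equiv> modulation_norm p r s g0"
abbreviation Lpw :: "((real^'d) \<times> (real^'d) \<Rightarrow> complex) \<Rightarrow> real \<Rightarrow> bool" where
  "Lpw F a \<equiv> weighted_Lp_bounded p w lborel F a"

lemma g_L2: "g \<in> L2"
  using g by (rule M1_L2)

lemma Lpw_measurable:
  assumes "Lpw F a"
  shows "F \<in> borel_measurable borel"
proof -
  have [measurable]: "(\<lambda>z. F z * of_real (w z)) \<in> borel_measurable borel" using Lp_boundedD(1)[OF assms] by simp
  have "(\<lambda>z. F z * of_real (w z) / of_real (w z)) \<in> borel_measurable borel" by measurable
  then show ?thesis using less_imp_neq[OF tf_weight_pos[of r s]] by (simp add: less_imp_neq[OF tf_weight_pos, symmetric])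
qed

text \<open>Since w z \<le> w (y - z) * w y, the weight moves from the output to the kernel and the
  input; by translation invariance, rows and columns of the new kernel both have mass
  \<open>wint K\<close>. The argument is y - z because covariance of the transform produces kernels
  of that form.\<close>

lemma Young_weighted:
  assumes K[measurable]: "K \<in> borel_measurable borel" and KC: "wint K \<le> ennreal C" and C: "0 < C"
    and F: "Lpw F a" and T[measurable]: "T \<in> borel_measurable borel"
    and le: "\<And>z. ennreal (norm (T z)) \<le> (\<integral>\<^sup>+y. K (y - z) * ennreal (norm (F y)) \<partial>lborel)"
  shows "Lpw T (C * a)"
proof (rule Schur_test[OF p C _ _ _ _ _ F, where K = "\<lambda>z y. K (y - z) * ennreal (w (y - z))"])
  have [measurable]: "F \<in> borel_measurable borel" by (rule Lpw_measurable[OF F])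
  show "sigma_finite_measure lborel" "sigma_finite_measure lborel" by (rule sigma_finite_lborel)+
  show "(\<lambda>(z, y). K (y - z) * ennreal (w (y - z))) \<in> borel_measurable (lborel \<Otimes>\<^sub>M lborel)" by measurable
  show "(\<integral>\<^sup>+y. K (y - z) * ennreal (w (y - z)) \<partial>lborel) \<le> ennreal C" for z
    using nn_integral_lborel_shift(2)[of "\<lambda>y. K y * ennreal (w y)" z] KC by (simp add: weighted_integral_def)
  show "(\<integral>\<^sup>+z. K (y - z) * ennreal (w (y - z)) \<partial>lborel) \<le> ennreal C" for y
    using nn_integral_lborel_shift(3)[of "\<lambda>y. K y * ennreal (w y)" y] KC by (simp add: weighted_integral_def)
  show "(\<lambda>z. T z * of_real (w z)) \<in> borel_measurable lborel" by measurable
  fix z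
  have "ennreal (norm (T z * of_real (w z))) = ennreal (norm (T z)) * ennreal (w z)"
    by (simp add: norm_mult ennreal_mult)
  also have "\<dots> \<le> (\<integral>\<^sup>+y. K (y - z) * ennreal (norm (F y)) \<partial>lborel) * ennreal (w z)"
    by (intro mult_right_mono le) auto
  also have "\<dots> = (\<integral>\<^sup>+y. K (y - z) * ennreal (norm (F y)) * ennreal (w z) \<partial>lborel)"
    by (rule nn_integral_multc[symmetric]) measurable
  also have "\<dots> \<le> (\<integral>\<^sup>+y. K (y - z) * ennreal (w (y - z)) * ennreal (norm (F y * of_real (w y))) \<partial>lborel)"
  proof (intro nn_integral_mono)
    fix y
    have "w z \<le> w (y - z) * w y" using w_submult[of "z - y" y] tf_weight_minus[of r s "y - z"] by simp
    then have "ennreal (w z) \<le> ennreal (w (y - z)) * ennreal (w y)" by (simp add: ennreal_mult[symmetric] ennreal_leI)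
    then have "K (y - z) * ennreal (norm (F y)) * ennreal (w z) \<le> K (y - z) * ennreal (norm (F y)) * (ennreal (w (y - z)) * ennreal (w y))"
      by (intro mult_left_mono) auto
    also have "\<dots> = K (y - z) * ennreal (w (y - z)) * ennreal (norm (F y * of_real (w y)))"
      by (simp add: norm_mult ennreal_mult mult_ac)
    finally show "K (y - z) * ennreal (norm (F y)) * ennreal (w z) \<le> K (y - z) * ennreal (w (y - z)) * ennreal (norm (F y * of_real (w y)))" .
  qed
  finally show "ennreal (norm (T z * of_real (w z))) \<le> (\<integral>\<^sup>+y. K (y - z) * ennreal (w (y - z)) * ennreal (norm (F y * of_real (w y))) \<partial>lborel)" .
qed

lemma X_dual: "\<phi> \<in> X \<Longrightarrow> \<phi> \<in> dual"
  by (simp add: modulation_space_def)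

lemma X_bounded: "\<phi> \<in> X \<Longrightarrow> Lpw (STFT_dual g0 \<phi>) (N \<phi>)"
  unfolding modulation_norm_def using p by (intro weighted_Lp_bounded_norm) (auto simp: modulation_space_def)

lemma X_I:
  assumes "\<phi> \<in> dual" "Lpw (STFT_dual g0 \<phi>) a"
  shows "\<phi> \<in> X" "N \<phi> \<le> a"
  using assms weighted_Lp_boundedD[OF p assms(2)] by (auto simp: modulation_space_def modulation_norm_def)

lemma N_nonneg: "\<phi> \<in> X \<Longrightarrow> 0 \<le> N \<phi>"
  using X_bounded Lp_boundedD(2) by blast

text \<open>The reproducing formula as a pointwise convolution estimate, close to the shape that
  \<open>Young_weighted\<close> expects. Changing the window of \<phi>, sampling, and the
  interpolation error all go through it.\<close>

lemma dual_estimate: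
  assumes \<phi>: "\<phi> \<in> dual" and a: "a \<in> M1" "0 < L2_norm a" and h: "h \<in> M1"
  shows "ennreal (norm (\<phi> (tf_shift z h))) \<le>
    (\<integral>\<^sup>+y. (ennreal (1 / (L2_norm a)\<^sup>2) * abs_STFT a h (y - z)) * ennreal (norm (STFT_dual a \<phi> y)) \<partial>lborel)"
proof -
  have L: "a \<in> L2" "h \<in> L2" using a h by (auto intro: M1_L2)
  have [measurable]: "STFT_dual a \<phi> \<in> borel_measurable borel" by (rule STFT_dual_measurable[OF \<phi> a(1)])
  have [measurable]: "STFT a h \<in> borel_measurable borel" by (rule STFT_measurable) (use L in auto)
  have "ennreal ((L2_norm a)\<^sup>2) * ennreal (norm (\<phi> (tf_shift z h))) = ennreal (norm (of_real ((L2_norm a)\<^sup>2) * \<phi> (tf_shift z h)))"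
    by (simp add: norm_mult ennreal_mult norm_power)
  also have "\<dots> \<le> (\<integral>\<^sup>+y. ennreal (norm (STFT_dual a \<phi> y * cnj (STFT a (tf_shift z h) y))) \<partial>lborel)"
    unfolding dual_reproducing[OF \<phi> a(1) M1_tf_shift(1)[OF h]] by (rule norm_integral_le_nn_integral)
  also have "\<dots> = (\<integral>\<^sup>+y. abs_STFT a h (y - z) * ennreal (norm (STFT_dual a \<phi> y)) \<partial>lborel)"
    by (intro nn_integral_cong) (simp add: norm_mult ennreal_mult norm_STFT_tf_shift[OF L(2,1)] mult.commute)
  finally have "ennreal (norm (\<phi> (tf_shift z h))) \<le> ennreal (1 / (L2_norm a)\<^sup>2) * \<dots>"
    using a(2) by (intro ennreal_cmult_le_imp) auto
  then show ?thesis by (subst (asm) nn_integral_cmult[symmetric]) (measurable, simp add: mult.assoc)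
qed

lemma STFT_dual_g_bounded: "\<exists>C>0. \<forall>\<phi>\<in>X. Lpw (STFT_dual g \<phi>) (C * N \<phi>)"
proof -
  \<comment> \<open>\<open>+ 1\<close> only makes the constant strictly positive, as Schur's test
    demands.\<close>
  define C where "C = 1 / (L2_norm g0)\<^sup>2 * M1n g + 1"
  have C: "0 < C" by (simp add: C_def M1n_nonneg add_nonneg_pos)
  have "Lpw (STFT_dual g \<phi>) (C * N \<phi>)" if \<phi>: "\<phi> \<in> X" for \<phi>
  proof (rule Young_weighted[OF _ _ C X_bounded[OF \<phi>]])
    note m = abs_STFT_measurable[OF g_L2 g0_L2]
    show "(\<lambda>y. ennreal (1 / (L2_norm g0)\<^sup>2) * abs_STFT g0 g y) \<in> borel_measurable borel" using m by measurable
    have "wint (\<lambda>y. ennreal (1 / (L2_norm g0)\<^sup>2) * abs_STFT g0 g y) = ennreal (1 / (L2_norm g0)\<^sup>2 * M1n g)"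
      by (subst weighted_integral_cmult[OF m tf_weight_measurable]) (simp add: wint_M1[OF g] ennreal_mult[symmetric] M1n_nonneg)
    also have "\<dots> \<le> ennreal C" unfolding C_def by (intro ennreal_leI) simp
    finally show "wint (\<lambda>y. ennreal (1 / (L2_norm g0)\<^sup>2) * abs_STFT g0 g y) \<le> ennreal C" .
    show "STFT_dual g \<phi> \<in> borel_measurable borel" by (rule STFT_dual_measurable[OF X_dual[OF \<phi>] g])
    show "ennreal (norm (STFT_dual g \<phi> z)) \<le> (\<integral>\<^sup>+y. ennreal (1 / (L2_norm g0)\<^sup>2) * abs_STFT g0 g (y - z) * ennreal (norm (STFT_dual g0 \<phi> y)) \<partial>lborel)" for z
      unfolding STFT_dual_eq[of g] by (rule dual_estimate[OF X_dual[OF \<phi>] g0_M1 norm_g0_pos g])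
  qed
  with C show ?thesis by blast
qed

text \<open>The weak integral of F y times \<open>tf_shift y g\<close>, as an antilinear functional
  on M^1. The value 0 elsewhere follows the convention of \<open>antidual\<close>.\<close>

definition synth :: "((real^'d) \<times> (real^'d) \<Rightarrow> complex) \<Rightarrow> (real^'d \<Rightarrow> complex) \<Rightarrow> complex" where
  "synth F h = (if h \<in> M1 then \<integral>y. F y * cnj (STFT g h y) \<partial>lborel else 0)"

lemma pairing_bound:
  "\<exists>c\<ge>0. \<forall>F a h. Lpw F a \<longrightarrow> h \<in> M1 \<longrightarrow>
     (\<integral>\<^sup>+y. ennreal (norm (F y * cnj (STFT g h y))) \<partial>lborel) \<le> ennreal (c * a * M1n h)"
proof -
  \<comment> \<open>The sum of the two constants serves the \<open>L1\<close> bound and the supremum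
    bound of \<open>STFT g h\<close> simultaneously.\<close>
  define c where "c = 1 / (L2_norm g0)\<^sup>2 * M1n g + 1 / L2_norm g0"
  have c: "0 \<le> c" by (simp add: c_def M1n_nonneg L2_norm_nonneg)
  have "(\<integral>\<^sup>+y. ennreal (norm (F y * cnj (STFT g h y))) \<partial>lborel) \<le> ennreal (c * a * M1n h)" if F: "Lpw F a" and h: "h \<in> M1" for F a h
  proof -
    have "(\<integral>\<^sup>+y. ennreal (norm (F y * cnj (STFT g h y))) \<partial>lborel) \<le> (\<integral>\<^sup>+y. abs_STFT g h y * ennreal (norm (F y * of_real (w y))) \<partial>lborel)"
    proof (intro nn_integral_mono)
      fix y
      have "norm (F y) * 1 \<le> norm (F y) * w y" by (intro mult_left_mono w_ge_1) auto
      then have "norm (STFT g h y) * norm (F y) \<le> norm (STFT g h y) * (norm (F y) * w y)" by (intro mult_left_mono) auto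
      then show "ennreal (norm (F y * cnj (STFT g h y))) \<le> abs_STFT g h y * ennreal (norm (F y * of_real (w y)))"
        by (simp add: norm_mult ennreal_mult[symmetric] ennreal_leI mult_ac)
    qed
    also have "\<dots> \<le> ennreal ((c * M1n h) * a)"
    proof (rule Lp_pairing[OF p _ sigma_finite_lborel _ _ _ F])
      show "0 \<le> c * M1n h" using c by (simp add: M1n_nonneg)
      show "abs_STFT g h \<in> borel_measurable lborel" using abs_STFT_measurable[OF M1_L2[OF h] g_L2] by simp
      have "(\<integral>\<^sup>+y. abs_STFT g h y \<partial>lborel) \<le> ennreal (1 / (L2_norm g0)\<^sup>2 * (M1n h * M1n g))"
        using wint_ge_integral[of "abs_STFT g h"] wint_STFT_le[OF h g] by simp
      also have "\<dots> \<le> ennreal (c * M1n h)"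
        by (intro ennreal_leI) (simp add: c_def M1n_nonneg L2_norm_nonneg algebra_simps)
      finally show "(\<integral>\<^sup>+y. abs_STFT g h y \<partial>lborel) \<le> ennreal (c * M1n h)" .
      show "abs_STFT g h y \<le> ennreal (c * M1n h)" for y
      proof (intro ennreal_leI)
        have "norm (STFT g h y) \<le> 1 / L2_norm g0 * M1n h" using STFT_sup_le[OF h g_L2, of y] by (simp add: norm_g)
        also have "\<dots> \<le> c * M1n h" by (intro mult_right_mono) (auto simp: c_def M1n_nonneg)
        finally show "norm (STFT g h y) \<le> c * M1n h" .
      qed
    qed
    finally show ?thesis by (simp add: mult_ac)
  qed
  with c show ?thesis by blast
qed

lemma synth_integrable:
  assumes F: "Lpw F a" and h: "h \<in> M1"
  shows "integrable lborel (\<lambda>y. F y * cnj (STFT g h y))"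
proof (rule integrableI_bounded)
  have [measurable]: "F \<in> borel_measurable borel" "STFT g h \<in> borel_measurable borel"
    using Lpw_measurable[OF F] STFT_measurable[OF M1_L2[OF h] g_L2] by auto
  show "(\<lambda>y. F y * cnj (STFT g h y)) \<in> borel_measurable lborel" by measurable
  obtain c where "(\<integral>\<^sup>+y. ennreal (norm (F y * cnj (STFT g h y))) \<partial>lborel) \<le> ennreal (c * a * M1n h)"
    using pairing_bound F h by blast
  then show "(\<integral>\<^sup>+y. ennreal (norm (F y * cnj (STFT g h y))) \<partial>lborel) < \<infinity>" by (auto simp: less_top[symmetric] top_unique)
qed

lemma synth_bound: "\<exists>c\<ge>0. \<forall>F a h. Lpw F a \<longrightarrow> h \<in> M1 \<longrightarrow> norm (synth F h) \<le> c * a * M1n h"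
proof -
  obtain c where c: "0 \<le> c" and le: "\<And>F a h. Lpw F a \<Longrightarrow> h \<in> M1 \<Longrightarrow>
     (\<integral>\<^sup>+y. ennreal (norm (F y * cnj (STFT g h y))) \<partial>lborel) \<le> ennreal (c * a * M1n h)"
    using pairing_bound by blast
  have "norm (synth F h) \<le> c * a * M1n h" if F: "Lpw F a" and h: "h \<in> M1" for F a h
  proof -
    have "ennreal (norm (synth F h)) \<le> ennreal (c * a * M1n h)"
      using order_trans[OF norm_integral_le_nn_integral le[OF F h]] h by (simp add: synth_def)
    moreover have "0 \<le> c * a * M1n h" using c Lp_boundedD(2)[OF F] by (simp add: M1n_nonneg)
    ultimately show ?thesis by (simp add: ennreal_le_iff)
  qed
  with c show ?thesis by blast
qed

lemma synth_dual:
  assumes F: "Lpw F a"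
  shows "synth F \<in> dual"
proof -
  obtain c where "\<And>h. h \<in> M1 \<Longrightarrow> norm (synth F h) \<le> c * a * M1n h" using synth_bound F by blast
  moreover have "synth F (\<lambda>t. h t + k t) = synth F h + synth F k" if h: "h \<in> M1" and k: "k \<in> M1" for h k
  proof -
    have "STFT g (\<lambda>t. h t + k t) y = STFT g h y + STFT g k y" for y
      unfolding STFT_eq by (intro L2_inner_left_add M1_L2 h k tf_shift_L2 g_L2)
    then show ?thesis using synth_integrable[OF F h] synth_integrable[OF F k] h k
      by (simp add: synth_def M1_add distrib_left)
  qed
  moreover have "synth F (\<lambda>t. b * h t) = cnj b * synth F h" if h: "h \<in> M1" for b h
    using h by (simp add: synth_def M1_scale STFT_eq L2_inner_left_scale mult.left_commute)
  ultimately show ?thesis unfolding antidual_def by (auto simp: synth_def)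
qed

lemma synth_X: "\<exists>C>0. \<forall>F a. Lpw F a \<longrightarrow> synth F \<in> X \<and> N (synth F) \<le> C * a"
proof -
  define C where "C = 1 / (L2_norm g0)\<^sup>2 * (M1n g0 * M1n g) + 1"
  have C: "0 < C" by (simp add: C_def M1n_nonneg add_nonneg_pos)
  have "synth F \<in> X \<and> N (synth F) \<le> C * a" if F: "Lpw F a" for F a
  proof -
    have "Lpw (STFT_dual g0 (synth F)) (C * a)"
    proof (rule Young_weighted[OF _ _ C F])
      show "abs_STFT g g0 \<in> borel_measurable borel" by (rule abs_STFT_measurable[OF g0_L2 g_L2])
      show "wint (abs_STFT g g0) \<le> ennreal C"
        using wint_STFT_le[OF g0_M1 g] unfolding C_def by (rule order_trans) (intro ennreal_leI, simp)
      show "STFT_dual g0 (synth F) \<in> borel_measurable borel" by (rule STFT_dual_measurable[OF synth_dual[OF F] g0_M1])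
      fix z
      have "STFT_dual g0 (synth F) z = (\<integral>y. F y * cnj (STFT g (tf_shift z g0) y) \<partial>lborel)"
        by (simp add: STFT_dual_eq synth_def M1_tf_shift g0_M1)
      then have "ennreal (norm (STFT_dual g0 (synth F) z)) \<le> (\<integral>\<^sup>+y. ennreal (norm (F y * cnj (STFT g (tf_shift z g0) y))) \<partial>lborel)"
        by (simp only: norm_integral_le_nn_integral)
      also have "\<dots> = (\<integral>\<^sup>+y. abs_STFT g g0 (y - z) * ennreal (norm (F y)) \<partial>lborel)"
        by (intro nn_integral_cong) (simp add: norm_mult ennreal_mult norm_STFT_tf_shift[OF g0_L2 g_L2] mult.commute)
      finally show "ennreal (norm (STFT_dual g0 (synth F) z)) \<le> (\<integral>\<^sup>+y. abs_STFT g g0 (y - z) * ennreal (norm (F y)) \<partial>lborel)" .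
    qed
    then show ?thesis using X_I[OF synth_dual[OF F]] by blast
  qed
  with C show ?thesis by blast
qed

lemma synth_add: "Lpw F a \<Longrightarrow> Lpw G b \<Longrightarrow> synth (\<lambda>y. F y + G y) = (\<lambda>h. synth F h + synth G h)"
  using synth_integrable by (auto simp: fun_eq_iff synth_def distrib_right)

lemma synth_diff: "Lpw F a \<Longrightarrow> Lpw G b \<Longrightarrow> synth (\<lambda>y. F y - G y) = (\<lambda>h. synth F h - synth G h)"
  using synth_integrable by (auto simp: fun_eq_iff synth_def left_diff_distrib)

lemma synth_scale: "synth (\<lambda>y. b * F y) = (\<lambda>h. b * synth F h)"
  by (auto simp: fun_eq_iff synth_def mult.assoc)

lemma synth_STFT_dual:
  assumes \<phi>: "\<phi> \<in> dual"
  shows "synth (STFT_dual g \<phi>) = \<phi>"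
  using dual_reproducing[OF \<phi> g] dual_off[OF \<phi>] by (auto simp: fun_eq_iff synth_def norm_g)

text \<open>Writing \<phi> as the synthesis of its own transform shows that N dominates the norm of
  the antidual. Decay in N therefore implies convergence at every element of M^1.\<close>

lemma X_evaluation: "\<exists>c\<ge>0. \<forall>\<phi>\<in>X. \<forall>h\<in>M1. norm (\<phi> h) \<le> c * N \<phi> * M1n h"
proof -
  obtain c where c: "0 \<le> c" "\<And>F a h. Lpw F a \<Longrightarrow> h \<in> M1 \<Longrightarrow> norm (synth F h) \<le> c * a * M1n h"
    using synth_bound by blast
  obtain C where C: "0 < C" "\<And>\<phi>. \<phi> \<in> X \<Longrightarrow> Lpw (STFT_dual g \<phi>) (C * N \<phi>)" using STFT_dual_g_bounded by blast
  have "norm (\<phi> h) \<le> (c * C) * N \<phi> * M1n h" if "\<phi> \<in> X" "h \<in> M1" for \<phi> h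
    using c(2)[OF C(2)[OF that(1)] that(2)] synth_STFT_dual[OF X_dual[OF that(1)]] by (simp add: mult.assoc)
  then show ?thesis using c C by (intro exI[of _ "c * C"]) auto
qed

section \<open>The modulation space: linear structure and bounded pointwise limits\<close>

lemma dual_add_closed:
  assumes f: "f \<in> dual" and h: "h \<in> dual"
  shows "(\<lambda>x. f x + h x) \<in> dual"
proof -
  obtain C1 where C1: "\<And>k. k \<in> M1 \<Longrightarrow> norm (f k) \<le> C1 * M1n k" using dual_bound[OF f] by blast
  obtain C2 where C2: "\<And>k. k \<in> M1 \<Longrightarrow> norm (h k) \<le> C2 * M1n k" using dual_bound[OF h] by blast
  have "norm (f k + h k) \<le> (C1 + C2) * M1n k" if "k \<in> M1" for k
    using norm_triangle_le[OF add_mono[OF C1[OF that] C2[OF that]]] by (simp add: distrib_right)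
  then show ?thesis
    using dual_off[OF f] dual_off[OF h] dual_add[OF f] dual_add[OF h] dual_scale[OF f] dual_scale[OF h]
    unfolding antidual_def by (auto simp: distrib_left)
qed

lemma dual_scale_closed:
  assumes f: "f \<in> dual"
  shows "(\<lambda>x. a * f x) \<in> dual"
proof -
  obtain C1 where C1: "\<And>k. k \<in> M1 \<Longrightarrow> norm (f k) \<le> C1 * M1n k" using dual_bound[OF f] by blast
  have "norm (a * f k) \<le> (norm a * C1) * M1n k" if "k \<in> M1" for k
    using mult_left_mono[OF C1[OF that] norm_ge_zero[of a]] by (simp add: norm_mult mult.assoc)
  then show ?thesis
    using dual_off[OF f] dual_add[OF f] dual_scale[OF f]
    unfolding antidual_def by (auto simp: distrib_left)
qed

lemma X_subspace: "fun_subspace X"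
  and N_add: "\<phi> \<in> X \<Longrightarrow> \<psi> \<in> X \<Longrightarrow> N (\<lambda>x. \<phi> x + \<psi> x) \<le> N \<phi> + N \<psi>"
  and N_zero: "N (\<lambda>_. 0) = 0"
proof -
  have add: "(\<lambda>x. \<phi> x + \<psi> x) \<in> X \<and> N (\<lambda>x. \<phi> x + \<psi> x) \<le> N \<phi> + N \<psi>" if "\<phi> \<in> X" "\<psi> \<in> X" for \<phi> \<psi>
  proof -
    have "Lpw (STFT_dual g0 (\<lambda>x. \<phi> x + \<psi> x)) (N \<phi> + N \<psi>)"
      using weighted_Lp_bounded_add[OF p X_bounded[OF that(1)] X_bounded[OF that(2)]] by (simp add: STFT_dual_eq[abs_def])
    then show ?thesis using X_I dual_add_closed[OF X_dual X_dual, OF that] by blast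
  qed
  have scale: "(\<lambda>x. a * \<phi> x) \<in> X \<and> N (\<lambda>x. a * \<phi> x) \<le> norm a * N \<phi>" if "\<phi> \<in> X" for \<phi> a
  proof -
    have "Lpw (STFT_dual g0 (\<lambda>x. a * \<phi> x)) (norm a * N \<phi>)"
      using weighted_Lp_bounded_scale[OF X_bounded[OF that], of a] by (simp add: STFT_dual_eq[abs_def])
    then show ?thesis using X_I dual_scale_closed[OF X_dual[OF that]] by blast
  qed
  have z: "(\<lambda>_. 0) \<in> dual"
    by (auto simp: antidual_def intro!: exI[of _ 0])
  have "Lpw (STFT_dual g0 (\<lambda>_. 0)) 0" by (auto simp: Lp_bounded_def STFT_dual_eq[abs_def])
  note zero = X_I[OF z this]
  show "fun_subspace X" using add scale zero by (auto simp: fun_subspace_def)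
  show "N (\<lambda>x. \<phi> x + \<psi> x) \<le> N \<phi> + N \<psi>" if "\<phi> \<in> X" "\<psi> \<in> X" using add that by blast
  show "N (\<lambda>_. 0) = 0" using zero N_nonneg[OF zero(1)] by simp
qed

text \<open>\<open>X_evaluation\<close> bounds u n in the antidual uniformly in n, so the pointwise
  limit is again a bounded functional; Fatou's lemma for the transforms gives the norm
  bound.\<close>

lemma X_closed:
  assumes u: "\<And>n :: nat. u n \<in> X" and le: "\<And>n. N (u n) \<le> a" and lim: "\<And>x. (\<lambda>n. u n x) \<longlonglongrightarrow> f x"
  shows "f \<in> X \<and> N f \<le> a"
proof -
  obtain c where c: "0 \<le> c" "\<And>\<phi> h. \<phi> \<in> X \<Longrightarrow> h \<in> M1 \<Longrightarrow> norm (\<phi> h) \<le> c * N \<phi> * M1n h"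
    using X_evaluation by blast
  have "f h = 0" if "h \<notin> M1" for h
    using lim[of h] dual_off[OF X_dual[OF u] that] by (simp add: LIMSEQ_const_iff)
  moreover have "f (\<lambda>t. h t + k t) = f h + f k" if "h \<in> M1" "k \<in> M1" for h k
    using lim[of "\<lambda>t. h t + k t"] tendsto_add[OF lim[of h] lim[of k]] dual_add[OF X_dual[OF u] that]
    by (simp add: LIMSEQ_unique)
  moreover have "f (\<lambda>t. b * h t) = cnj b * f h" if "h \<in> M1" for b h
    using lim[of "\<lambda>t. b * h t"] tendsto_mult[OF tendsto_const[of "cnj b"] lim[of h]] dual_scale[OF X_dual[OF u] that]
    by (simp add: LIMSEQ_unique)
  moreover have "norm (f h) \<le> (c * a) * M1n h" if h: "h \<in> M1" for h
  proof (rule LIMSEQ_le_const2[OF tendsto_norm[OF lim[of h]]])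
    have "norm (u n h) \<le> c * a * M1n h" for n
      using c(2)[OF u h, of n] mult_right_mono[OF mult_left_mono[OF le[of n] c(1)] M1n_nonneg[of h]] by linarith
    then show "\<exists>n0. \<forall>n\<ge>n0. norm (u n h) \<le> c * a * M1n h" by blast
  qed
  ultimately have f: "f \<in> dual" unfolding antidual_def by blast
  have "Lpw (STFT_dual g0 f) a"
  proof (rule Lp_bounded_Fatou[OF p])
    show "Lpw (STFT_dual g0 (u n)) a" for n
      by (rule Lp_bounded_mono[OF X_bounded[OF u[of n]] _ _ le p]) (use Lp_boundedD(1)[OF X_bounded[OF u[of n]]] in auto)
    show "(\<lambda>n. STFT_dual g0 (u n) x * of_real (w x)) \<longlonglongrightarrow> STFT_dual g0 f x * of_real (w x)" for x
      unfolding STFT_dual_eq by (intro tendsto_intros lim)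
  qed
  then show ?thesis using X_I[OF f] by blast
qed

end

section \<open>Sampling\<close>

text \<open>If q - z i and q - z j both lie in B, the translates of B by z i and z j meet in q.
  Fixing one such i bounds the number of all such j, uniformly in q.\<close>

lemma well_spread_count:
  fixes z :: "'i \<Rightarrow> 'b::real_normed_vector"
  assumes ws: "well_spread U I z" and B: "compact B"
  shows "\<exists>n. \<forall>q. emeasure (count_space I) {j \<in> I. q - z j \<in> B} \<le> ennreal n"
proof -
  obtain n where n: "\<And>i. i \<in> I \<Longrightarrow> finite {j \<in> I. (+) (z i) ` B \<inter> (+) (z j) ` B \<noteq> {}}"
    "\<And>i. i \<in> I \<Longrightarrow> card {j \<in> I. (+) (z i) ` B \<inter> (+) (z j) ` B \<noteq> {}} \<le> n"
    using ws B unfolding well_spread_def by meson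
  have "emeasure (count_space I) {j \<in> I. q - z j \<in> B} \<le> ennreal (real n)" for q
  proof (cases "{j \<in> I. q - z j \<in> B} = {}")
    case False
    then obtain i where i: "i \<in> I" "q - z i \<in> B" by blast
    have q: "q \<in> (+) (z j) ` B" if "q - z j \<in> B" for j using that by (intro image_eqI[of _ _ "q - z j"]) auto
    then have sub: "{j \<in> I. q - z j \<in> B} \<subseteq> {j \<in> I. (+) (z i) ` B \<inter> (+) (z j) ` B \<noteq> {}}" using i by blast
    have fin: "finite {j \<in> I. q - z j \<in> B}" by (rule finite_subset[OF sub n(1)[OF i(1)]])
    have "card {j \<in> I. q - z j \<in> B} \<le> n" using card_mono[OF n(1)[OF i(1)] sub] n(2)[OF i(1)] by linarith
    then show ?thesis using fin by (subst emeasure_count_space_finite) (auto simp: ennreal_of_nat_eq_real_of_nat)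
  next
    case True
    show ?thesis unfolding True by simp
  qed
  then show ?thesis by blast
qed

context frame_setup
begin

text \<open>
  Two bounds on \<open>STFT g (g - tf_shift u g)\<close>: a uniform one, by strong continuity in \<open>L\<^sup>2\<close>, and
  the integrable majorant. Their minimum has small weighted integral.
\<close>

lemma oscillation_small:
  assumes e: "0 < e"
  shows "\<exists>\<delta>>0. \<delta> \<le> 1 \<and> (\<exists>K \<in> borel_measurable borel. wint K \<le> ennreal e \<and>
     (\<forall>u v. norm u \<le> \<delta> \<longrightarrow> abs_STFT g (\<lambda>t. g t - tf_shift u g t) v \<le> K v))"
proof -
  obtain H where "local_majorant (abs_STFT g g) H" using STFT_local_majorant[OF g g] by blast
  then have [measurable]: "H \<in> borel_measurable borel" and Hf: "wint H < \<infinity>" and Hm: "\<And>z u. norm u \<le> 1 \<Longrightarrow> abs_STFT g g (z + u) \<le> H z"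
    unfolding local_majorant_def by blast+
  define K where "K n v = min (ennreal (1 / (real n + 1))) (2 * H v)" for n v
  have [measurable]: "K n \<in> borel_measurable borel" for n unfolding K_def[abs_def] by measurable
  have "(\<lambda>n. wint (K n)) \<longlonglongrightarrow> (\<integral>\<^sup>+v. 0 \<partial>(lborel :: ((real^'d) \<times> (real^'d)) measure))"
    unfolding weighted_integral_def
  proof (rule nn_integral_dominated_convergence[where w = "\<lambda>v. 2 * (H v * ennreal (w v))"])
    show "AE v in lborel. K n v * ennreal (w v) \<le> 2 * (H v * ennreal (w v))" for n
      by (auto simp: K_def mult.assoc[symmetric] intro!: mult_right_mono)
    show "(\<integral>\<^sup>+v. 2 * (H v * ennreal (w v)) \<partial>lborel) < \<infinity>"
      using Hf by (subst nn_integral_cmult) (auto simp: weighted_integral_def ennreal_mult_less_top)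
    show "AE v in lborel. (\<lambda>n. K n v * ennreal (w v)) \<longlonglongrightarrow> 0"
    proof (intro always_eventually allI)
      fix v
      have "(\<lambda>n. 1 / (real n + 1)) \<longlonglongrightarrow> 0"
        using LIMSEQ_inverse_real_of_nat by (simp add: inverse_eq_divide add.commute)
      then have "(\<lambda>n. ennreal (1 / (real n + 1) * w v)) \<longlonglongrightarrow> ennreal (0 * w v)"
        by (intro tendsto_ennrealI tendsto_mult tendsto_const)
      then have l: "(\<lambda>n. ennreal (1 / (real n + 1) * w v)) \<longlonglongrightarrow> 0" by simp
      have le: "K n v * ennreal (w v) \<le> ennreal (1 / (real n + 1) * w v)" for n
      proof -
        have "K n v * ennreal (w v) \<le> ennreal (1 / (real n + 1)) * ennreal (w v)"
          by (intro mult_right_mono) (auto simp: K_def)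
        then show ?thesis by (simp add: ennreal_mult[symmetric])
      qed
      show "(\<lambda>n. K n v * ennreal (w v)) \<longlonglongrightarrow> 0"
        by (rule tendsto_sandwich[OF _ _ tendsto_const l]) (use le in \<open>simp_all\<close>)
    qed
  qed auto
  then have "(\<lambda>n. wint (K n)) \<longlonglongrightarrow> 0" by simp
  then have "\<forall>\<^sub>F n in sequentially. wint (K n) < ennreal e" using e by (intro order_tendstoD) auto
  then obtain n where n: "wint (K n) < ennreal e" by (auto simp: eventually_sequentially)
  \<comment> \<open>The uniform bound to be reached: by \<open>norm_STFT_bound\<close> and |g| = 1,
    an \<open>L2\<close> bound on g - \<open>tf_shift u g\<close> is at once a bound on its
    transform.\<close>
  define \<eta> where "\<eta> = 1 / (real n + 1)"
  have \<eta>: "0 < \<eta>" by (simp add: \<eta>_def)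
  have "\<exists>\<delta>>0. \<delta> \<le> 1 \<and> (\<forall>u. norm u \<le> \<delta> \<longrightarrow> L2_norm (\<lambda>t. g t - tf_shift u g t) \<le> \<eta>)"
  \<comment> \<open>Continuity of shifts is known along sequences, so failure for every \<delta> is
    turned into a sequence of shifts tending to 0.\<close>
  proof (rule ccontr)
    assume no: "\<not> ?thesis"
    have "\<exists>u. norm u \<le> 1 / (real m + 1) \<and> \<eta> < L2_norm (\<lambda>t. g t - tf_shift u g t)" for m
      using no[simplified, rule_format, of "1 / (real m + 1)"] by (auto simp: not_le)
    then obtain u where u: "\<And>m. norm (u m) \<le> 1 / (real m + 1)" "\<And>m. \<eta> < L2_norm (\<lambda>t. g t - tf_shift (u m) g t)" by metis
    have "(\<lambda>m. 1 / (real m + 1)) \<longlonglongrightarrow> 0"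
      using LIMSEQ_inverse_real_of_nat by (simp add: inverse_eq_divide add.commute)
    then have "u \<longlonglongrightarrow> 0" by (rule Lim_null_comparison[rotated]) (use u in auto)
    from tf_shift_continuous_0[OF g_L2 this] have "(\<lambda>m. L2_norm (\<lambda>t. g t - tf_shift (u m) g t)) \<longlonglongrightarrow> 0"
      by (simp add: L2_norm_diff_commute[of g])
    then have "\<forall>\<^sub>F m in sequentially. L2_norm (\<lambda>t. g t - tf_shift (u m) g t) < \<eta>" using \<eta> by (intro order_tendstoD)
    then show False using u(2) by (auto simp: eventually_sequentially not_less[symmetric]) (metis less_asym order_refl)
  qed
  then obtain \<delta> where \<delta>: "0 < \<delta>" "\<delta> \<le> 1" "\<And>u. norm u \<le> \<delta> \<Longrightarrow> L2_norm (\<lambda>t. g t - tf_shift u g t) \<le> \<eta>" by blast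
  have "abs_STFT g (\<lambda>t. g t - tf_shift u g t) v \<le> K n v" if u: "norm u \<le> \<delta>" for u v
    unfolding K_def
  proof (rule min.boundedI)
    have d: "(\<lambda>t. g t - tf_shift u g t) \<in> L2" by (intro L2_diff tf_shift_L2 g_L2)
    show "abs_STFT g (\<lambda>t. g t - tf_shift u g t) v \<le> ennreal (1 / (real n + 1))"
      using norm_STFT_bound[OF d g_L2, of v] \<delta>(3)[OF u] norm_g by (intro ennreal_leI) (simp add: \<eta>_def)
    have 1: "abs_STFT g g v \<le> H v" using Hm[of 0 v] by simp
    have 2: "abs_STFT g (tf_shift u g) v \<le> H v"
      using Hm[of "- u" v] u \<delta>(2) by (simp add: norm_STFT_tf_shift[OF g_L2 g_L2])
    have "STFT g (\<lambda>t. g t - tf_shift u g t) v = STFT g g v - STFT g (tf_shift u g) v"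
      unfolding STFT_eq by (intro L2_inner_left_diff tf_shift_L2 g_L2)
    then have "abs_STFT g (\<lambda>t. g t - tf_shift u g t) v \<le> abs_STFT g g v + abs_STFT g (tf_shift u g) v"
      by (simp add: norm_triangle_ineq4 ennreal_leI flip: ennreal_plus)
    also have "\<dots> \<le> 2 * H v" using add_mono[OF 1 2] by (simp add: mult_2)
    finally show "abs_STFT g (\<lambda>t. g t - tf_shift u g t) v \<le> 2 * H v" .
  qed
  then show ?thesis using \<delta> n by (intro exI[of _ \<delta>] conjI bexI[of _ "K n"]) auto
qed

end

locale frame_sampling = frame_setup r s g0 p g for r s :: real and g0 :: "real^'d \<Rightarrow> complex" and p and g +
  fixes I :: "nat set" and z :: "nat \<Rightarrow> (real^'d) \<times> (real^'d)" and \<delta> :: real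
  assumes ws: "well_spread (cball 0 \<delta>) I z" and \<delta>: "0 < \<delta>" "\<delta> \<le> 1"
begin

abbreviation B :: "(nat \<Rightarrow> complex) set" where "B \<equiv> weighted_seq_space p (\<lambda>j. w (z j)) I"
abbreviation Nb :: "(nat \<Rightarrow> complex) \<Rightarrow> real" where "Nb \<equiv> weighted_seq_norm p (\<lambda>j. w (z j)) I"
abbreviation coeffs :: "((real^'d \<Rightarrow> complex) \<Rightarrow> complex) \<Rightarrow> nat \<Rightarrow> complex" where
  "coeffs \<equiv> frame_coeffs I (\<lambda>j. tf_shift (z j) g)"

text \<open>Taking the least index turns the cover by balls into a partition, the cell of j lying in
  the ball of radius \<delta> around z j.\<close>

definition idx :: "(real^'d) \<times> (real^'d) \<Rightarrow> nat" where
  "idx y = (LEAST j. j \<in> I \<and> norm (y - z j) \<le> \<delta>)"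

lemma idx: "idx y \<in> I" "norm (y - z (idx y)) \<le> \<delta>"
proof -
  have "y \<in> (\<Union>j\<in>I. (+) (z j) ` cball 0 \<delta>)" using ws by (simp add: well_spread_def)
  then obtain j where "j \<in> I" "dist (z j) y \<le> \<delta>" by auto
  then have "\<exists>j. j \<in> I \<and> norm (y - z j) \<le> \<delta>" by (auto simp: dist_norm norm_minus_commute)
  from LeastI_ex[OF this] show "idx y \<in> I" "norm (y - z (idx y)) \<le> \<delta>" by (auto simp: idx_def)
qed

lemma idx_measurable[measurable]: "idx \<in> borel \<rightarrow>\<^sub>M count_space UNIV"
  unfolding idx_def[abs_def] by measurable

text \<open>Constant interpolation on each cell, up to the phase from \<open>tf_shift_comp\<close>.
  If c consists of the coefficients of \<phi>, the value at y is \<phi> at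
  \<open>tf_shift y (tf_shift (z (idx y) - y) g)\<close>, a function close to
  \<open>tf_shift y g\<close>.\<close>

definition step :: "(nat \<Rightarrow> complex) \<Rightarrow> (real^'d) \<times> (real^'d) \<Rightarrow> complex" where
  "step c y = phase (snd (z (idx y) - y) \<bullet> fst y) * c (idx y)"

lemma step_measurable: "step c \<in> borel_measurable borel"
  unfolding step_def[abs_def]
proof (rule measurable_compose_countable[where f = "\<lambda>j y. phase (snd (z j - y) \<bullet> fst y) * c j" and g = idx])
  show "(\<lambda>y. phase (snd (z j - y) \<bullet> fst y) * c j) \<in> borel_measurable borel" for j
    by (intro borel_measurable_continuous_onI continuous_intros)
qed measurable

lemma step_add: "step (\<lambda>j. c j + d j) = (\<lambda>y. step c y + step d y)"
  and step_scale: "step (\<lambda>j. a * c j) = (\<lambda>y. a * step c y)"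
  by (simp_all only: step_def[abs_def] distrib_left mult.left_commute)

text \<open>Schur's test for the incidence kernel of the partition: each y has exactly one index,
  and each cell has at most the measure of a unit ball. \<open>Kw\<close> pays for replacing w y by
  w (z (idx y)).\<close>

lemma step_bounded: "\<exists>C>0. \<forall>c a. weighted_Lp_bounded p (\<lambda>j. w (z j)) (count_space I) c a \<longrightarrow> Lpw (step c) (C * a)"
proof -
  define Kw where "Kw = 2 powr r * 2 powr s"
  have Kw: "0 < Kw" by (simp add: Kw_def)
  have near: "w u \<le> Kw" if "norm u \<le> 1" for u
    using tf_weight_near_0[OF r s that] by (simp add: Kw_def)
  let ?m = "measure lborel (cball (0 :: (real^'d) \<times> (real^'d)) 1)"
  \<comment> \<open>Covers the row bound \<open>Kw\<close> and the column bound
    \<open>Kw * ?m\<close>.\<close>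
  define C where "C = Kw * max 1 ?m"
  have C: "0 < C" by (auto simp: C_def less_max_iff_disj Kw intro!: mult_pos_pos)
  have KC: "Kw \<le> C" unfolding C_def using mult_left_mono[of 1 "max 1 ?m" Kw] Kw by simp
  have KC2: "Kw * ?m \<le> C" unfolding C_def using Kw by (intro mult_left_mono) auto
  have "Lpw (step c) (C * a)" if c: "weighted_Lp_bounded p (\<lambda>j. w (z j)) (count_space I) c a" for c a
  proof (rule Schur_test[OF p C _ _ _ _ _ c, where K = "\<lambda>y j. ennreal Kw * indicator {j} (idx y)"])
    show "sigma_finite_measure (count_space I)" by (intro sigma_finite_measure_count_space_countable) simp
    show "sigma_finite_measure lborel" by (rule sigma_finite_lborel)
    show "(\<lambda>(y, j). ennreal Kw * indicator {j} (idx y)) \<in> borel_measurable (lborel \<Otimes>\<^sub>M count_space I)"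
    proof (rule measurable_pair_measure_countable2)
      show "(\<lambda>y. ennreal Kw * indicator {j} (idx y)) \<in> borel_measurable lborel" for j
        using measurable_compose[OF idx_measurable, of "\<lambda>i. ennreal Kw * indicator {j} i" borel] by simp
    qed simp
    have eq: "(\<integral>\<^sup>+j. ennreal Kw * indicator {j} (idx y) * X j \<partial>count_space I) = ennreal Kw * X (idx y)" for y and X :: "nat \<Rightarrow> ennreal"
    proof -
      have "(\<integral>\<^sup>+j. ennreal Kw * indicator {j} (idx y) * X j \<partial>count_space I) = (\<integral>\<^sup>+j. (ennreal Kw * X (idx y)) * indicator {idx y} j \<partial>count_space I)"
        by (intro nn_integral_cong) (auto simp: indicator_def)
      also have "\<dots> = ennreal Kw * X (idx y)" using idx(1)[of y] by (subst nn_integral_cmult_indicator) auto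
      finally show ?thesis .
    qed
    show "(\<integral>\<^sup>+j. ennreal Kw * indicator {j} (idx y) \<partial>count_space I) \<le> ennreal C" for y
      using eq[of y "\<lambda>_. 1"] KC by (simp add: ennreal_leI)
    show "(\<integral>\<^sup>+y. ennreal Kw * indicator {j} (idx y) \<partial>lborel) \<le> ennreal C" for j
    proof -
      have "(\<integral>\<^sup>+y. ennreal Kw * indicator {j} (idx y) \<partial>lborel) \<le> (\<integral>\<^sup>+y. ennreal Kw * indicator (cball (z j) 1) y \<partial>lborel)"
      proof (intro nn_integral_mono mult_left_mono)
        fix y
        show "indicator {j} (idx y) \<le> (indicator (cball (z j) 1) y :: ennreal)"
          using idx(2)[of y] \<delta>(2) by (auto simp: indicator_def dist_norm norm_minus_commute)
      qed auto
      also have "\<dots> = ennreal Kw * emeasure lborel (cball (z j) 1)" by (intro nn_integral_cmult_indicator) auto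
      also have "emeasure lborel (cball (z j) 1) = emeasure lborel (cball (0 :: (real^'d) \<times> (real^'d)) 1)"
        using nn_integral_lborel_shift(2)[OF borel_measurable_indicator[OF borel_closed[OF closed_cball]], of "0 :: (real^'d) \<times> (real^'d)" 1 "z j"]
        by (simp add: nn_integral_indicator[symmetric] indicator_def dist_norm norm_minus_commute del: nn_integral_indicator)
      also have "ennreal Kw * \<dots> = ennreal (Kw * ?m)"
        using emeasure_lborel_cball_finite[of "0 :: (real^'d) \<times> (real^'d)" 1] less_imp_le[OF Kw] by (simp add: emeasure_eq_ennreal_measure ennreal_mult)
      also have "\<dots> \<le> ennreal C" using KC2 by (rule ennreal_leI)
      finally show ?thesis .
    qed
    show "(\<lambda>y. step c y * of_real (w y)) \<in> borel_measurable lborel" using step_measurable by measurable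
    show "ennreal (norm (step c y * of_real (w y))) \<le> (\<integral>\<^sup>+j. ennreal Kw * indicator {j} (idx y) * ennreal (norm (c j * of_real (w (z j)))) \<partial>count_space I)" for y
    proof -
      have "w y \<le> w (z (idx y)) * w (y - z (idx y))" using w_submult[of "z (idx y)" "y - z (idx y)"] by simp
      also have "\<dots> \<le> w (z (idx y)) * Kw"
        using idx(2)[of y] \<delta>(2) by (intro mult_left_mono near) auto
      finally have "norm (c (idx y)) * w y \<le> norm (c (idx y)) * (w (z (idx y)) * Kw)" by (intro mult_left_mono) auto
      then have "norm (step c y * of_real (w y)) \<le> Kw * norm (c (idx y) * of_real (w (z (idx y))))"
        by (simp add: step_def norm_mult mult_ac)
      then show ?thesis unfolding eq using less_imp_le[OF Kw] by (simp only: ennreal_mult[symmetric] norm_ge_zero ennreal_leI)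
    qed
  qed
  with C show ?thesis by blast
qed

lemma coeffs_eq: "j \<in> I \<Longrightarrow> coeffs \<phi> j = \<phi> (tf_shift (z j) g)" "j \<notin> I \<Longrightarrow> coeffs \<phi> j = 0"
  by (auto simp: frame_coeffs_def)

text \<open>Row integrals of the sampling kernel are weighted integrals of \<open>STFT g g\<close>.
  Column sums run over the points of the family; averaging over unit balls replaces them by an
  integral of the local majorant H, in which every location is met by at most n balls.\<close>

lemma coeffs_bounded: "\<exists>C>0. \<forall>\<phi>\<in>X. weighted_Lp_bounded p (\<lambda>j. w (z j)) (count_space I) (coeffs \<phi>) (C * N \<phi>)"
proof -
  obtain C1 where C1: "0 < C1" "\<And>\<phi>. \<phi> \<in> X \<Longrightarrow> Lpw (STFT_dual g \<phi>) (C1 * N \<phi>)" using STFT_dual_g_bounded by blast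
  obtain H where H: "local_majorant (abs_STFT g g) H" using STFT_local_majorant[OF g g] by blast
  then have [measurable]: "H \<in> borel_measurable borel" and Hf: "wint H < \<infinity>" and Hm: "\<And>z u. norm u \<le> 1 \<Longrightarrow> abs_STFT g g (z + u) \<le> H z"
    unfolding local_majorant_def by blast+
  have [measurable]: "abs_STFT g g \<in> borel_measurable borel" by (rule abs_STFT_measurable[OF g_L2 g_L2])
  define \<kappa> where "\<kappa> v = abs_STFT g g v * ennreal (w v)" for v
  have \<kappa>m[measurable]: "\<kappa> \<in> borel_measurable borel" unfolding \<kappa>_def[abs_def] by measurable
  let ?Ball = "cball (0 :: (real^'d) \<times> (real^'d)) 1"
  have [measurable]: "?Ball \<in> sets borel" by simp
  have "compact ?Ball" by simp
  from well_spread_count[OF ws this] obtain n where n: "\<And>q. emeasure (count_space I) {j \<in> I. q - z j \<in> ?Ball} \<le> ennreal n" by blast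
  define Kw where "Kw = 2 powr r * 2 powr s"
  have Kw: "0 < Kw" by (simp add: Kw_def)
  have near: "w u \<le> Kw" if "norm u \<le> 1" for u
    using tf_weight_near_0[OF r s that] by (simp add: Kw_def)
  let ?m = "measure lborel ?Ball"
  have m: "0 < ?m" "emeasure lborel ?Ball = ennreal ?m"
  proof -
    show "0 < ?m" by (rule content_cball_pos) simp
    show "emeasure lborel ?Ball = ennreal ?m"
      using emeasure_lborel_cball_finite[of "0 :: (real^'d) \<times> (real^'d)" 1] by (simp add: emeasure_eq_ennreal_measure)
  qed
  have col: "ennreal ?m * (\<integral>\<^sup>+j. \<kappa> (y - z j) \<partial>count_space I) \<le> ennreal Kw * (ennreal n * wint H)" for y
  proof -
    \<comment> \<open>For |v - u| \<le> 1, the kernel at v is at most \<open>Kw\<close> times H u *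
      w u; integrating over these u gives the factor \<open>?m\<close>.\<close>
    have pt: "ennreal ?m * \<kappa> v \<le> (\<integral>\<^sup>+u. indicator ?Ball (v - u) * (ennreal Kw * (H u * ennreal (w u))) \<partial>lborel)" for v
    proof -
      have "ennreal ?m * \<kappa> v = (\<integral>\<^sup>+u. \<kappa> v * indicator ?Ball u \<partial>lborel)"
        unfolding m(2)[symmetric] by (subst nn_integral_cmult_indicator) (auto simp: mult.commute)
      also have "\<dots> = (\<integral>\<^sup>+u. \<kappa> v * indicator ?Ball (v - u) \<partial>lborel)"
        by (rule nn_integral_lborel_shift(3)[symmetric]) measurable
      also have "\<dots> \<le> (\<integral>\<^sup>+u. indicator ?Ball (v - u) * (ennreal Kw * (H u * ennreal (w u))) \<partial>lborel)"
      proof (intro nn_integral_mono)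
        fix u
        show "\<kappa> v * indicator ?Ball (v - u) \<le> indicator ?Ball (v - u) * (ennreal Kw * (H u * ennreal (w u)))"
        proof (cases "norm (v - u) \<le> 1")
          case True
          have "w v \<le> w u * w (v - u)" using w_submult[of u "v - u"] by simp
          also have "\<dots> \<le> w u * Kw" using True by (intro mult_left_mono near) auto
          finally have "ennreal (w v) \<le> ennreal Kw * ennreal (w u)" using less_imp_le[OF Kw] by (simp add: ennreal_leI mult.commute ennreal_mult[symmetric])
          moreover have "abs_STFT g g v \<le> H u" using Hm[OF True, of u] by simp
          ultimately have "\<kappa> v \<le> H u * (ennreal Kw * ennreal (w u))" unfolding \<kappa>_def by (intro mult_mono) auto
          then show ?thesis using True by (simp add: indicator_def mult_ac)
        qed (simp add: indicator_def)
      qed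
      finally show ?thesis .
    qed
    have "ennreal ?m * (\<integral>\<^sup>+j. \<kappa> (y - z j) \<partial>count_space I) = (\<integral>\<^sup>+j. ennreal ?m * \<kappa> (y - z j) \<partial>count_space I)"
      by (rule nn_integral_cmult[symmetric]) simp
    also have "\<dots> \<le> (\<integral>\<^sup>+j. (\<integral>\<^sup>+u. indicator ?Ball (y - z j - u) * (ennreal Kw * (H u * ennreal (w u))) \<partial>lborel) \<partial>count_space I)"
      by (intro nn_integral_mono pt)
    also have "\<dots> = (\<integral>\<^sup>+u. (\<integral>\<^sup>+j. indicator ?Ball (y - z j - u) * (ennreal Kw * (H u * ennreal (w u))) \<partial>count_space I) \<partial>lborel)"
    proof -
      interpret C: sigma_finite_measure "count_space I" by (intro sigma_finite_measure_count_space_countable) simp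
      interpret pair_sigma_finite lborel "count_space I" ..
      show ?thesis
      proof (rule Fubini')
        show "(\<lambda>(u, j). indicator ?Ball (y - z j - u) * (ennreal Kw * (H u * ennreal (w u)))) \<in> borel_measurable (lborel \<Otimes>\<^sub>M count_space I)"
        proof (rule measurable_pair_measure_countable2)
          show "(\<lambda>u. indicator ?Ball (y - z j - u) * (ennreal Kw * (H u * ennreal (w u)))) \<in> borel_measurable lborel" for j by measurable
        qed simp
      qed
    qed
    also have "\<dots> \<le> (\<integral>\<^sup>+u. ennreal n * (ennreal Kw * (H u * ennreal (w u))) \<partial>lborel)"
    proof (intro nn_integral_mono)
      fix u
      \<comment> \<open>Only the indices with z j within distance 1 of y - u contribute, and
        \<open>well_spread_count\<close> limits their number.\<close>
      have "(\<integral>\<^sup>+j. indicator ?Ball (y - z j - u) * (ennreal Kw * (H u * ennreal (w u))) \<partial>count_space I)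
        = (\<integral>\<^sup>+j. indicator {j \<in> I. (y - u) - z j \<in> ?Ball} j \<partial>count_space I) * (ennreal Kw * (H u * ennreal (w u)))"
        by (subst nn_integral_multc[symmetric]) (auto intro!: nn_integral_cong simp: indicator_def algebra_simps)
      also have "(\<integral>\<^sup>+j. indicator {j \<in> I. (y - u) - z j \<in> ?Ball} j \<partial>count_space I) = emeasure (count_space I) {j \<in> I. (y - u) - z j \<in> ?Ball}"
        by (rule nn_integral_indicator) auto
      finally show "(\<integral>\<^sup>+j. indicator ?Ball (y - z j - u) * (ennreal Kw * (H u * ennreal (w u))) \<partial>count_space I) \<le> ennreal n * (ennreal Kw * (H u * ennreal (w u)))"
        using n[of "y - u"] by (simp add: mult_right_mono)
    qed
    also have "\<dots> = ennreal Kw * (ennreal n * wint H)"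
      unfolding weighted_integral_def by (simp add: nn_integral_cmult mult_ac)
    finally show ?thesis .
  qed
  obtain h where h: "0 \<le> h" "wint H = ennreal h" using Hf by (cases "wint H") auto
  \<comment> \<open>One summand for each of the two Schur bounds, and 1 for positivity. The absolute
    value appears because n is only known as a real bound.\<close>
  define C where "C = 1 + (1 / (L2_norm g0)\<^sup>2 * (M1n g * M1n g)) + 1 / ?m * (Kw * (\<bar>n\<bar> * h))"
  have C: "0 < C" using m(1) h(1) less_imp_le[OF Kw] by (auto simp: C_def M1n_nonneg intro!: add_pos_nonneg mult_nonneg_nonneg divide_nonneg_nonneg)
  have "weighted_Lp_bounded p (\<lambda>j. w (z j)) (count_space I) (coeffs \<phi>) (C * (C1 * N \<phi>))" if \<phi>: "\<phi> \<in> X" for \<phi>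
  proof (rule Schur_test[OF p C _ _ _ _ _ C1(2)[OF \<phi>], where K = "\<lambda>j y. \<kappa> (y - z j)"])
    show "sigma_finite_measure (count_space I)" by (intro sigma_finite_measure_count_space_countable) simp
    show "sigma_finite_measure lborel" by (rule sigma_finite_lborel)
    show "(\<lambda>(j, y). \<kappa> (y - z j)) \<in> borel_measurable (count_space I \<Otimes>\<^sub>M lborel)"
      by (rule measurable_pair_measure_countable1) auto
    show "(\<integral>\<^sup>+y. \<kappa> (y - z j) \<partial>lborel) \<le> ennreal C" for j
    proof -
      have "(\<integral>\<^sup>+y. \<kappa> (y - z j) \<partial>lborel) = wint (abs_STFT g g)"
        by (subst nn_integral_lborel_shift(2)) (auto simp: \<kappa>_def[abs_def] weighted_integral_def)
      also have "\<dots> \<le> ennreal (1 / (L2_norm g0)\<^sup>2 * (M1n g * M1n g))" by (rule wint_STFT_le[OF g g])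
      also have "\<dots> \<le> ennreal C" using m(1) h(1) less_imp_le[OF Kw] by (intro ennreal_leI) (simp add: C_def)
      finally show ?thesis .
    qed
    show "(\<integral>\<^sup>+j. \<kappa> (y - z j) \<partial>count_space I) \<le> ennreal C" for y
    proof -
      have "(\<integral>\<^sup>+j. \<kappa> (y - z j) \<partial>count_space I) \<le> ennreal (1 / ?m) * (ennreal Kw * (ennreal n * wint H))"
        by (rule ennreal_cmult_le_imp[OF m(1) col])
      also have "\<dots> \<le> ennreal (1 / ?m) * (ennreal Kw * (ennreal \<bar>n\<bar> * wint H))"
        by (intro mult_left_mono mult_right_mono ennreal_leI) auto
      also have "\<dots> = ennreal (1 / ?m * (Kw * (\<bar>n\<bar> * h)))"
        using h m(1) less_imp_le[OF Kw] by (simp add: ennreal_mult[symmetric])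
      also have "\<dots> \<le> ennreal C" by (intro ennreal_leI) (simp add: C_def M1n_nonneg)
      finally show ?thesis .
    qed
    show "(\<lambda>j. coeffs \<phi> j * of_real (w (z j))) \<in> borel_measurable (count_space I)" by simp
    fix j assume "j \<in> space (count_space I)"
    then have j: "j \<in> I" by simp
    have [measurable]: "STFT_dual g \<phi> \<in> borel_measurable borel" by (rule STFT_dual_measurable[OF X_dual[OF \<phi>] g])
    have "ennreal (norm (coeffs \<phi> j * of_real (w (z j)))) = ennreal (norm (\<phi> (tf_shift (z j) g))) * ennreal (w (z j))"
      using j by (simp add: coeffs_eq norm_mult ennreal_mult)
    also have "\<dots> \<le> (\<integral>\<^sup>+y. abs_STFT g g (y - z j) * ennreal (norm (STFT_dual g \<phi> y)) \<partial>lborel) * ennreal (w (z j))"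
      using dual_estimate[OF X_dual[OF \<phi>] g _ g, of "z j"] by (intro mult_right_mono) (auto simp: norm_g)
    also have "\<dots> = (\<integral>\<^sup>+y. abs_STFT g g (y - z j) * ennreal (norm (STFT_dual g \<phi> y)) * ennreal (w (z j)) \<partial>lborel)"
      by (rule nn_integral_multc[symmetric]) measurable
    also have "\<dots> \<le> (\<integral>\<^sup>+y. \<kappa> (y - z j) * ennreal (norm (STFT_dual g \<phi> y * of_real (w y))) \<partial>lborel)"
    proof (intro nn_integral_mono)
      fix y
      have "w (z j) \<le> w (y - z j) * w y" using w_submult[of "z j - y" y] tf_weight_minus[of r s "y - z j"] by simp
      then have "ennreal (w (z j)) \<le> ennreal (w (y - z j)) * ennreal (w y)" by (simp add: ennreal_mult[symmetric] ennreal_leI)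
      then have "abs_STFT g g (y - z j) * ennreal (norm (STFT_dual g \<phi> y)) * ennreal (w (z j)) \<le>
          abs_STFT g g (y - z j) * ennreal (norm (STFT_dual g \<phi> y)) * (ennreal (w (y - z j)) * ennreal (w y))"
        by (intro mult_left_mono) auto
      also have "\<dots> = \<kappa> (y - z j) * ennreal (norm (STFT_dual g \<phi> y * of_real (w y)))"
        unfolding \<kappa>_def by (simp add: norm_mult ennreal_mult mult_ac)
      finally show "abs_STFT g g (y - z j) * ennreal (norm (STFT_dual g \<phi> y)) * ennreal (w (z j)) \<le> \<kappa> (y - z j) * ennreal (norm (STFT_dual g \<phi> y * of_real (w y)))" .
    qed
    finally show "ennreal (norm (coeffs \<phi> j * of_real (w (z j)))) \<le> (\<integral>\<^sup>+y. \<kappa> (y - z j) * ennreal (norm (STFT_dual g \<phi> y * of_real (w y))) \<partial>lborel)" .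
  qed
  then show ?thesis using C C1(1) by (intro exI[of _ "C * C1"]) (auto simp: mult.assoc)
qed

lemma B_boundedD:
  assumes "c \<in> B"
  shows "weighted_Lp_bounded p (\<lambda>j. w (z j)) (count_space I) c (Nb c)"
  using assms unfolding weighted_seq_norm_def by (intro weighted_Lp_bounded_norm p) (simp add: weighted_seq_space_def)

lemma coeffs_B: "\<exists>C>0. \<forall>\<phi>\<in>X. coeffs \<phi> \<in> B \<and> Nb (coeffs \<phi>) \<le> C * N \<phi>"
proof -
  obtain C where C: "0 < C" "\<And>\<phi>. \<phi> \<in> X \<Longrightarrow> weighted_Lp_bounded p (\<lambda>j. w (z j)) (count_space I) (coeffs \<phi>) (C * N \<phi>)"
    using coeffs_bounded by blast
  have "coeffs \<phi> \<in> B \<and> Nb (coeffs \<phi>) \<le> C * N \<phi>" if "\<phi> \<in> X" for \<phi>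
    using weighted_Lp_boundedD[OF p C(2)[OF that]] coeffs_eq(2)
    by (simp add: weighted_seq_space_def weighted_seq_norm_def)
  with C(1) show ?thesis by blast
qed

text \<open>Thanks to the phase in \<open>step\<close>, the interpolation error is \<phi> on a shift
  of g - \<open>tf_shift u g\<close>, where |u| \<le> \<delta> by the choice of \<open>idx\<close>.
  To such values \<open>dual_estimate\<close> applies.\<close>

lemma step_coeffs:
  assumes \<phi>: "\<phi> \<in> dual"
  shows "STFT_dual g \<phi> y - step (coeffs \<phi>) y = \<phi> (tf_shift y (\<lambda>t. g t - tf_shift (z (idx y) - y) g t))"
proof -
  let ?u = "z (idx y) - y"
  have "\<phi> (tf_shift y (tf_shift ?u g)) = cnj (phase (- (snd ?u \<bullet> fst y))) * \<phi> (tf_shift (z (idx y)) g)"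
    unfolding tf_shift_comp using dual_scale[OF \<phi> M1_tf_shift(1)[OF g]] by simp
  then have "\<phi> (tf_shift y (tf_shift ?u g)) = step (coeffs \<phi>) y"
    by (simp add: step_def coeffs_eq idx phase_cnj)
  then show ?thesis
    unfolding tf_shift_diff STFT_dual_eq
    by (simp add: dual_diff[OF \<phi> M1_tf_shift(1)[OF g] M1_tf_shift(1)[OF M1_tf_shift(1)[OF g]]])
qed

text \<open>The error operator has three constants: C1 for the transform with window g, e for the
  oscillation kernel, C2 for synthesis. Their product being at most 1/2 is the hypothesis of the
  Neumann series, with D the synthesis of the step function. The constants of \<open>step\<close>
  and \<open>coeffs\<close>, which may depend on the family, enter only the boundedness of D and of
  the coefficients.\<close>

lemma banach_frame_tf_shifts:
  assumes K: "K \<in> borel_measurable borel" "wint K \<le> ennreal e" "0 < e"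
    and osc: "\<And>u v. norm u \<le> \<delta> \<Longrightarrow> abs_STFT g (\<lambda>t. g t - tf_shift u g t) v \<le> K v"
    and C1: "\<And>\<phi>. \<phi> \<in> X \<Longrightarrow> Lpw (STFT_dual g \<phi>) (C1 * N \<phi>)"
    and C2: "0 < C2" "\<And>F a. Lpw F a \<Longrightarrow> synth F \<in> X \<and> N (synth F) \<le> C2 * a"
    and small: "C2 * (e * C1) \<le> 1 / 2"
  shows "banach_frame M1 X N B Nb I (\<lambda>j. tf_shift (z j) g)"
proof -
  obtain Cs where Cs: "\<And>c a. weighted_Lp_bounded p (\<lambda>j. w (z j)) (count_space I) c a \<Longrightarrow> Lpw (step c) (Cs * a)"
    using step_bounded by blast
  obtain Cc where Cc: "0 < Cc" "\<And>\<phi>. \<phi> \<in> X \<Longrightarrow> coeffs \<phi> \<in> B \<and> Nb (coeffs \<phi>) \<le> Cc * N \<phi>" using coeffs_B by blast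
  have half: "N (\<lambda>x. \<phi> x - synth (step (coeffs \<phi>)) x) \<le> 1 / 2 * N \<phi>" if \<phi>: "\<phi> \<in> X" for \<phi>
  proof -
    note d = X_dual[OF \<phi>]
    have b: "Lpw (step (coeffs \<phi>)) (Cs * Nb (coeffs \<phi>))" by (intro Cs B_boundedD) (use Cc(2)[OF \<phi>] in blast)
    have "Lpw (\<lambda>y. STFT_dual g \<phi> y - step (coeffs \<phi>) y) (e * (C1 * N \<phi>))"
    \<comment> \<open>The oscillation \<open>?h\<close> varies with y; the common majorant K turns
      the estimate into a convolution with one fixed kernel.\<close>
    proof (rule Young_weighted[OF K C1[OF \<phi>]])
      show "(\<lambda>y. STFT_dual g \<phi> y - step (coeffs \<phi>) y) \<in> borel_measurable borel"
        by (intro borel_measurable_diff STFT_dual_measurable d g step_measurable)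
      fix y
      let ?h = "\<lambda>t. g t - tf_shift (z (idx y) - y) g t"
      have hM: "?h \<in> M1" by (intro M1_diff M1_tf_shift g)
      have "ennreal (norm (STFT_dual g \<phi> y - step (coeffs \<phi>) y)) \<le> (\<integral>\<^sup>+v. abs_STFT g ?h (v - y) * ennreal (norm (STFT_dual g \<phi> v)) \<partial>lborel)"
        unfolding step_coeffs[OF d] using dual_estimate[OF d g _ hM, of y] by (simp add: norm_g)
      also have "\<dots> \<le> (\<integral>\<^sup>+v. K (v - y) * ennreal (norm (STFT_dual g \<phi> v)) \<partial>lborel)"
        using idx(2)[of y] by (intro nn_integral_mono mult_right_mono osc) (auto simp: norm_minus_commute)
      finally show "ennreal (norm (STFT_dual g \<phi> y - step (coeffs \<phi>) y)) \<le> (\<integral>\<^sup>+v. K (v - y) * ennreal (norm (STFT_dual g \<phi> v)) \<partial>lborel)" .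
    qed
    from C2(2)[OF this] have "N (synth (\<lambda>y. STFT_dual g \<phi> y - step (coeffs \<phi>) y)) \<le> C2 * (e * (C1 * N \<phi>))" by blast
    also have "\<dots> = (C2 * (e * C1)) * N \<phi>" by (simp add: mult_ac)
    also have "\<dots> \<le> 1 / 2 * N \<phi>" using small N_nonneg[OF \<phi>] by (rule mult_right_mono)
    finally show ?thesis unfolding synth_diff[OF C1[OF \<phi>] b] synth_STFT_dual[OF d] .
  qed
  have D: "bounded_linear_between B Nb X N (\<lambda>c. synth (step c))"
    unfolding bounded_linear_between_def
  proof (intro conjI ballI allI)
    show "synth (step c) \<in> X" if "c \<in> B" for c using C2(2)[OF Cs[OF B_boundedD[OF that]]] by blast
    show "synth (step (\<lambda>j. c j + d j)) = (\<lambda>y. synth (step c) y + synth (step d) y)" if "c \<in> B" "d \<in> B" for c d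
      unfolding step_add by (rule synth_add[OF Cs[OF B_boundedD[OF that(1)]] Cs[OF B_boundedD[OF that(2)]]])
    show "synth (step (\<lambda>j. a * c j)) = (\<lambda>y. a * synth (step c) y)" for a c
      unfolding step_scale by (rule synth_scale)
    have "N (synth (step c)) \<le> (C2 * Cs) * Nb c" if "c \<in> B" for c
      using C2(2)[OF Cs[OF B_boundedD[OF that]]] by (simp add: mult.assoc)
    then show "\<exists>C. \<forall>c\<in>B. N (synth (step c)) \<le> C * Nb c" by blast
  qed
  have ev: "\<exists>c. \<forall>f\<in>X. norm (f h) \<le> c * N f" for h
  proof (cases "h \<in> M1")
    case True
    obtain c where "\<And>\<phi> h. \<phi> \<in> X \<Longrightarrow> h \<in> M1 \<Longrightarrow> norm (\<phi> h) \<le> c * N \<phi> * M1n h" using X_evaluation by blast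
    then show ?thesis using True by (intro exI[of _ "c * M1n h"]) (auto simp: mult_ac)
  next
    case False
    then show ?thesis using dual_off[OF X_dual] by (intro exI[of _ 0]) auto
  qed
  have "\<exists>R. bounded_linear_between B Nb X N R \<and> (\<forall>f\<in>X. R (coeffs f) = f)"
  proof (rule Neumann_left_inverse[where C = coeffs, OF X_subspace _ _ N_zero _ ev D])
    show "0 \<le> N f" if "f \<in> X" for f using N_nonneg[OF that] .
    show "N (\<lambda>x. f x + h x) \<le> N f + N h" if "f \<in> X" "h \<in> X" for f h using N_add[OF that] .
    show "f \<in> X \<and> N f \<le> a" if "\<And>n :: nat. u n \<in> X" "\<And>n. N (u n) \<le> a" "\<And>x. (\<lambda>n. u n x) \<longlonglongrightarrow> f x" for u a f
      using X_closed[OF that] .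
    show "coeffs f \<in> B" if "f \<in> X" for f using Cc(2)[OF that] by blast
    show "coeffs (\<lambda>x. f x + h x) = (\<lambda>j. coeffs f j + coeffs h j)" "coeffs (\<lambda>x. a * f x) = (\<lambda>j. a * coeffs f j)" for f h a
      by (auto simp: frame_coeffs_def)
    show "N (\<lambda>x. f x - synth (step (coeffs f)) x) \<le> 1 / 2 * N f" if "f \<in> X" for f using half[OF that] .
  qed
  then obtain R where R: "bounded_linear_between B Nb X N R" "\<And>f. f \<in> X \<Longrightarrow> R (coeffs f) = f" by blast
  show ?thesis
  proof (rule banach_frame_of_left_inverse[OF _ X_subspace N_nonneg _ _ Cc(1) _ R])
    show "fun_banach_space B Nb" by (intro weighted_seq_space_banach p) simp
  qed (use Cc(2) M1_tf_shift(1)[OF g] in auto)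
qed

end

theorem proposition6p2p3:
  fixes r s :: real and p :: ennreal and g0 g :: "real^'d \<Rightarrow> complex"
  assumes "r \<ge> 0" and "s \<ge> 0" and "1 \<le> p"
    and "g0 \<in> window_class r s" and "\<not> (AE t in lborel. g0 t = 0)"
    and "g \<in> M1_space r s g0" and "Lp_norm 2 lborel g = 1"
  shows "\<exists>U :: ((real^'d) \<times> (real^'d)) set. compact U \<and> (0, 0) \<in> interior U \<and>
    (\<forall>(I :: nat set) (x :: nat \<Rightarrow> real^'d) (\<omega> :: nat \<Rightarrow> real^'d).
      well_spread U I (\<lambda>j. (x j, \<omega> j)) \<longrightarrow>
      banach_frame (M1_space r s g0) (modulation_space p r s g0) (modulation_norm p r s g0)
        (weighted_seq_space p (\<lambda>j. tf_weight r s (x j, \<omega> j)) I)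
        (weighted_seq_norm p (\<lambda>j. tf_weight r s (x j, \<omega> j)) I)
        I (\<lambda>j. modul (\<omega> j) (transl (x j) g)))"
proof -
  interpret frame_setup r s g0 p g
    using assms by unfold_locales auto
  obtain C1 where C1: "0 < C1" "\<And>\<phi>. \<phi> \<in> X \<Longrightarrow> Lpw (STFT_dual g \<phi>) (C1 * N \<phi>)" using STFT_dual_g_bounded by blast
  obtain C2 where C2: "0 < C2" "\<And>F a. Lpw F a \<Longrightarrow> synth F \<in> X \<and> N (synth F) \<le> C2 * a" using synth_X by blast
  \<comment> \<open>Chosen so that C2 * (e * C1) = 1/2. C1, C2 and e are fixed before the family is
    given, hence so is the radius \<delta> obtained from e.\<close>
  define e where "e = 1 / (2 * C1 * C2)"
  have e: "0 < e" "C2 * (e * C1) \<le> 1 / 2" using C1(1) C2(1) by (auto simp: e_def)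
  obtain \<delta> K where \<delta>: "0 < \<delta>" "\<delta> \<le> 1" and K: "K \<in> borel_measurable borel" "wint K \<le> ennreal e"
    and osc: "\<And>u v. norm u \<le> \<delta> \<Longrightarrow> abs_STFT g (\<lambda>t. g t - tf_shift u g t) v \<le> K v"
    using oscillation_small[OF e(1)] by blast
  show ?thesis
  proof (intro exI[of _ "cball 0 \<delta>"] conjI allI impI)
    show "compact (cball 0 \<delta> :: ((real^'d) \<times> (real^'d)) set)" by simp
    have "0 \<in> interior (cball 0 \<delta> :: ((real^'d) \<times> (real^'d)) set)" using \<delta>(1) by simp
    then show "(0, 0) \<in> interior (cball 0 \<delta> :: ((real^'d) \<times> (real^'d)) set)" by (simp add: zero_prod_def)
    fix I :: "nat set" and x \<omega> :: "nat \<Rightarrow> real^'d"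
    assume "well_spread (cball 0 \<delta>) I (\<lambda>j. (x j, \<omega> j))"
    then interpret frame_sampling r s g0 p g I "\<lambda>j. (x j, \<omega> j)" \<delta>
      by unfold_locales (use \<delta> in auto)
    show "banach_frame (M1_space r s g0) (modulation_space p r s g0) (modulation_norm p r s g0)
        (weighted_seq_space p (\<lambda>j. tf_weight r s (x j, \<omega> j)) I)
        (weighted_seq_norm p (\<lambda>j. tf_weight r s (x j, \<omega> j)) I)
        I (\<lambda>j. modul (\<omega> j) (transl (x j) g))"
      using banach_frame_tf_shifts[OF K e(1) osc C1(2) C2 e(2)] by (simp add: tf_shift_def)
  qed
qed

end
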